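(* Let $A\in M^+(n,\mathbb{R})$ and let $\alpha$ be the trace of $A$. Let $\varphi\in C^0(\mathbb{R}^n)\cap C^\infty(\mathbb{R}^n\setminus\{0\})$ be a positive $A$-homogeneous function. Then the series $$\zeta(\varphi,s)=\sum_{\omega\in\mathbb{Z}^n\setminus\{0\}}\varphi(\omega)^{-s}$$ converges to a holomorphic function on the half plane $\operatorname{Re}s>\alpha$ and extends to a holomorphic function on $\mathbb{C}\setminus\{\alpha\}$ having a simple pole at $s=\alpha$ with residue $$\operatorname{Res}_{s=\alpha}\zeta(\varphi,s)=\alpha\,|B_\varphi|.$$ Moreover $\zeta(\varphi,0)=-1$ (the value at $0$ of the extended function).
   Context: $n$ is a positive integer. $M^+(n,\mathbb{R})$ is the set of real $n\times n$ matrices all of whose eigenvalues $\lambda$ satisfy $\operatorname{Re}\lambda>0$. For $t>0$, $t^A:=e^{(\log t)A}$. A function $\varphi:\mathbb{R}^n\to\mathbb{R}$ is $A$-homogeneous if $\varphi(t^Ax)=t\varphi(x)$ for all $t>0$ and $x\in\mathbb{R}^n$ (so $\varphi(0)=0$). An $A$-homogeneous function with values in $[0,+\infty)$ is positive if $\varphi(x)>0$ for all $x\neq0$. $B_\varphi=\{x\in\mathbb{R}^n:\varphi(x)<1\}$ and $|E|$ denotes the Lebesgue measure of $E\subset\mathbb{R}^n$. *)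

theory Defs
  imports "HOL-Complex_Analysis.Complex_Analysis"
begin

definition complex_eigenvalue :: "real^'n^'n \<Rightarrow> complex \<Rightarrow> bool" where
  "complex_eigenvalue A c \<longleftrightarrow>
     (\<exists>v :: complex^'n. v \<noteq> 0 \<and> map_matrix complex_of_real A *v v = c *s v)"

definition M_plus :: "(real^'n^'n) set" where
  "M_plus = {A. \<forall>c. complex_eigenvalue A c \<longrightarrow> 0 < Re c}"

text \<open>
  The type \<^typ>\<open>real^'n^'n\<close> carries no Banach algebra structure for matrix multiplication, so the
  overloaded \<^const>\<open>exp\<close> is not available and the exponential series is written out; its limit is
  taken entrywise.
\<close>

definition mat_pow :: "real^'n^'n \<Rightarrow> nat \<Rightarrow> real^'n^'n" where
  "mat_pow A k = (((**) A) ^^ k) (mat 1)"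

definition mat_exp :: "real^'n^'n \<Rightarrow> real^'n^'n" where
  "mat_exp A = (\<Sum>k. (1 / fact k) *\<^sub>R mat_pow A k)"

definition powr_mat :: "real \<Rightarrow> real^'n^'n \<Rightarrow> real^'n^'n" where
  "powr_mat t A = mat_exp (ln t *\<^sub>R A)"

definition homogeneous :: "real^'n^'n \<Rightarrow> (real^'n \<Rightarrow> real) \<Rightarrow> bool" where
  "homogeneous A \<phi> \<longleftrightarrow> (\<forall>t>0. \<forall>x. \<phi> (powr_mat t A *v x) = t * \<phi> x)"

definition positive_homogeneous :: "real^'n^'n \<Rightarrow> (real^'n \<Rightarrow> real) \<Rightarrow> bool" where
  "positive_homogeneous A \<phi> \<longleftrightarrow>
     homogeneous A \<phi> \<and> (\<forall>x. 0 \<le> \<phi> x) \<and> (\<forall>x. x \<noteq> 0 \<longrightarrow> 0 < \<phi> x)"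

text \<open>
  Only meant for open \<open>U\<close>: the derivatives are taken in the full space, at points of \<open>U\<close>.  In
  finite dimension, continuity of all iterated directional derivatives up to order \<open>k\<close> is the
  usual \<open>C\<^sup>k\<close> condition.
\<close>

primrec Ck_on :: "nat \<Rightarrow> (real^'n) set \<Rightarrow> (real^'n \<Rightarrow> real) \<Rightarrow> bool" where
  "Ck_on 0 U f \<longleftrightarrow> continuous_on U f"
| "Ck_on (Suc k) U f \<longleftrightarrow>
     (\<forall>x\<in>U. f differentiable (at x)) \<and>
     (\<forall>v. Ck_on k U (\<lambda>x. frechet_derivative f (at x) v))"

definition Cinfinity_on :: "(real^'n) set \<Rightarrow> (real^'n \<Rightarrow> real) \<Rightarrow> bool" where
  "Cinfinity_on U f \<longleftrightarrow> (\<forall>k. Ck_on k U f)"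

definition B_set :: "(real^'n \<Rightarrow> real) \<Rightarrow> (real^'n) set" where
  "B_set \<phi> = {x. \<phi> x < 1}"

definition int_lattice :: "(real^'n) set" where
  "int_lattice = {\<omega>. \<forall>i. \<omega> $ i \<in> \<int>}"

definition zeta_term :: "(real^'n \<Rightarrow> real) \<Rightarrow> complex \<Rightarrow> real^'n \<Rightarrow> complex" where
  "zeta_term \<phi> s \<omega> = complex_of_real (\<phi> \<omega>) powr (- s)"

definition zeta_series :: "(real^'n \<Rightarrow> real) \<Rightarrow> complex \<Rightarrow> complex" where
  "zeta_series \<phi> s = (\<Sum>\<^sub>\<infinity>\<omega>\<in>int_lattice - {0}. zeta_term \<phi> s \<omega>)"

end

theory Submission
  imports Defs "HOL-Probability.Probability" "HOL-Real_Asymp.Real_Asymp"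
begin

text \<open>
  Write \<open>T u = exp (u A)\<close>, \<open>L = ln \<circ> \<phi>\<close> and \<open>\<alpha> = trace A\<close>.  Homogeneity then reads
  \<open>L (T u x) = u + L x\<close>, and the zeta series is the sum of \<open>exp (- s L(\<omega>))\<close> over the nonzero
  lattice points.

  The lattice points are counted with a smooth weight.  Let \<open>Q v\<close> be the probability that a standard
  normal variable exceeds \<open>v\<close>, and let \<open>N u\<close> be the sum of \<open>Q (L \<omega> - u)\<close> over nonzero lattice
  points \<open>\<omega>\<close>.  For \<open>Re s > 0\<close> the two-sided Laplace transform of \<open>u \<mapsto> Q (l - u)\<close> is
  \<open>exp (- s l) exp (s\<^sup>2 / 2) / s\<close> (lemma \<open>gauss_tail_laplace\<close>), so for \<open>Re s > \<alpha>\<close> the Laplace transform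
  of \<open>N\<close> is the zeta function times \<open>exp (s\<^sup>2 / 2) / s\<close>.  The point of the Gaussian is that this factor has
  no zeros: dividing by it creates no poles, so that the asymptotic behaviour of \<open>N\<close> alone determines
  the continuation.

  That behaviour is as good as possible: \<open>N u\<close> decays faster than every exponential as \<open>u \<rightarrow> -\<infinity>\<close>, and
  \<open>N u = exp (\<alpha> u) exp (\<alpha>\<^sup>2 / 2) vol B - 1 + O(exp (- k u))\<close> for every \<open>k\<close> as \<open>u \<rightarrow> \<infinity>\<close>, where \<open>B\<close> is the
  set \<open>\<phi> < 1\<close>.  The transform of the two main terms is \<open>exp (\<alpha>\<^sup>2 / 2) vol B / (s - \<alpha>) - 1 / s\<close>, that of the
  remainder is entire, and multiplication by \<open>s exp (- s\<^sup>2 / 2)\<close> gives the continuation, the residue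
  \<open>\<alpha> vol B\<close>, and the value \<open>- 1\<close> at \<open>0\<close>.  The \<open>- 1\<close> is the contribution of the lattice point \<open>0\<close>, which
  the smooth weight sees but the zeta series omits.

  For the expansion as \<open>u \<rightarrow> \<infinity>\<close>, put \<open>\<psi> x = Q (L x)\<close> and \<open>\<psi> 0 = 1\<close>.  Then \<open>1 + N u\<close> is the value at \<open>0\<close> of the
  periodization of \<open>\<psi> \<circ> T (- u)\<close>.  The mean of this periodic function over a unit cube is the integral of
  \<open>\<psi> \<circ> T (- u)\<close>, which is the main term (\<open>psi_flow_integral\<close>), so the error is at most the
  oscillation.  A derivative of a periodic function in a lattice direction vanishes somewhere on each line in
  that direction, hence is bounded by its own oscillation; and since \<open>T (- u)\<close> contracts exponentially,
  each differentiation of \<open>\<psi> \<circ> T (- u)\<close> gains a factor \<open>exp (- \<delta> u)\<close>.  Iterating bounds the oscillation by every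
  power of that factor (\<open>periodization_oscillation\<close>).  The iteration needs a class of rapidly decaying
  functions closed under differentiation that contains the derivatives of \<open>\<psi>\<close>: the products of
  the Gaussian density at \<open>L\<close> with \<^emph>\<open>symbols\<close>, smooth functions away from \<open>0\<close> that grow at most
  exponentially along the flow.
\<close>

section \<open>The matrix exponential and its determinant\<close>

(* The dollar sign is reserved for vector components, also used below for matrix entries. *)
no_notation fps_nth (infixl "$" 75)

lemma matrix_mult_entry: "(A ** B) $ i $ j = (\<Sum>l\<in>UNIV. A $ i $ l * B $ l $ j)"
  by (simp add: matrix_matrix_mult_def)

lemma mat_pow_0 [simp]: "mat_pow A 0 = mat 1"
  by (simp add: mat_pow_def)

lemma mat_pow_Suc: "mat_pow A (Suc k) = A ** mat_pow A k"
  by (simp add: mat_pow_def)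

lemma mat_pow_Suc_right: "mat_pow A (Suc k) = mat_pow A k ** A"
proof (induction k)
  case (Suc k)
  have "mat_pow A (Suc (Suc k)) = A ** (mat_pow A k ** A)"
    by (metis Suc mat_pow_Suc)
  then show ?case by (simp add: mat_pow_Suc matrix_mul_assoc)
qed (simp add: mat_pow_Suc)

lemma mat_pow_scaleR: "mat_pow (u *\<^sub>R A) k = u ^ k *\<^sub>R mat_pow A k"
  by (induction k) (simp_all add: mat_pow_Suc scalar_matrix_assoc matrix_scalar_ac mult.commute flip: scalar_matrix_assoc)

definition entry_sum :: "real^'n^'n \<Rightarrow> real" where
  "entry_sum A = (\<Sum>i\<in>UNIV. \<Sum>j\<in>UNIV. \<bar>A $ i $ j\<bar>)"

lemma entry_sum_nonneg: "0 \<le> entry_sum A"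
  by (simp add: entry_sum_def sum_nonneg)

lemma abs_mat_pow_entry_le: "\<bar>mat_pow A k $ i $ j\<bar> \<le> entry_sum A ^ k"
proof (induction k arbitrary: i j)
  case 0
  show ?case by (simp add: mat_def)
next
  case (Suc k)
  have "\<bar>mat_pow A (Suc k) $ i $ j\<bar> \<le> (\<Sum>l\<in>UNIV. \<bar>A $ i $ l\<bar> * \<bar>mat_pow A k $ l $ j\<bar>)"
    by (simp add: mat_pow_Suc matrix_matrix_mult_def) (metis (no_types, lifting) abs_mult sum_abs sum.cong)
  also have "\<dots> \<le> (\<Sum>l\<in>UNIV. \<bar>A $ i $ l\<bar> * entry_sum A ^ k)"
    by (intro sum_mono mult_left_mono Suc) auto
  also have "\<dots> = (\<Sum>l\<in>UNIV. \<bar>A $ i $ l\<bar>) * entry_sum A ^ k"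
    by (simp add: sum_distrib_right)
  also have "\<dots> \<le> entry_sum A * entry_sum A ^ k"
    by (intro mult_right_mono zero_le_power entry_sum_nonneg)
      (auto simp: entry_sum_def intro!: member_le_sum[where f = "\<lambda>i. \<Sum>l\<in>UNIV. \<bar>A $ i $ l\<bar>"] sum_nonneg)
  finally show ?case by simp
qed

lemma summable_mat_exp_entry:
  "summable (\<lambda>k. mat_pow A k $ i $ j / fact k * u ^ k)"
proof (rule summable_comparison_test)
  show "summable (\<lambda>k. inverse (fact k) *\<^sub>R (entry_sum A * \<bar>u\<bar>) ^ k)"
    by (rule summable_exp_generic)
  show "\<exists>N. \<forall>k\<ge>N. norm (mat_pow A k $ i $ j / fact k * u ^ k)
      \<le> inverse (fact k) *\<^sub>R (entry_sum A * \<bar>u\<bar>) ^ k"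
    using abs_mat_pow_entry_le[of A _ i j]
    by (intro exI[of _ 0]) (auto simp: abs_mult power_mult_distrib power_abs divide_simps intro!: mult_right_mono)
qed

lemma mat_exp_sums:
  "(\<lambda>k. (1 / fact k) *\<^sub>R mat_pow (u *\<^sub>R A) k) sums mat_exp (u *\<^sub>R A)"
proof -
  define E where "E = (\<chi> i j. \<Sum>k. mat_pow A k $ i $ j / fact k * u ^ k)"
  have "(\<lambda>k. (1 / fact k) *\<^sub>R mat_pow (u *\<^sub>R A) k) sums E"
    unfolding sums_def
  proof (intro vec_tendstoI)
    fix i j
    have "(\<lambda>k. mat_pow A k $ i $ j / fact k * u ^ k) sums (E $ i $ j)"
      unfolding E_def using summable_mat_exp_entry by (simp only: vec_lambda_beta) (rule summable_sums)
    then show "(\<lambda>n. (\<Sum>k<n. (1 / fact k) *\<^sub>R mat_pow (u *\<^sub>R A) k) $ i $ j) \<longlonglongrightarrow> E $ i $ j"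
      by (simp add: sums_def mat_pow_scaleR algebra_simps)
  qed
  then show ?thesis
    unfolding mat_exp_def by (simp add: sums_iff)
qed

lemma mat_exp_entry_sums:
  "(\<lambda>k. mat_pow A k $ i $ j / fact k * u ^ k) sums (mat_exp (u *\<^sub>R A) $ i $ j)"
proof -
  have "(\<lambda>n. (\<Sum>k<n. (1 / fact k) *\<^sub>R mat_pow (u *\<^sub>R A) k) $ i $ j)
      \<longlonglongrightarrow> mat_exp (u *\<^sub>R A) $ i $ j"
    using mat_exp_sums[of u A] unfolding sums_def by (intro tendsto_vec_nth)
  then show ?thesis
    by (simp add: sums_def mat_pow_scaleR algebra_simps)
qed

lemma mat_exp_entry_eq:
  "mat_exp (u *\<^sub>R A) $ i $ j = (\<Sum>k. mat_pow A k $ i $ j / fact k * u ^ k)"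
  using mat_exp_entry_sums by (rule sums_unique)

lemma abs_mat_exp_entry_le: "\<bar>mat_exp (u *\<^sub>R A) $ i $ j\<bar> \<le> exp (entry_sum A * \<bar>u\<bar>)"
proof -
  have s: "summable (\<lambda>k. inverse (fact k) *\<^sub>R (entry_sum A * \<bar>u\<bar>) ^ k)"
    by (rule summable_exp_generic)
  have le: "norm (mat_pow A k $ i $ j / fact k * u ^ k)
      \<le> inverse (fact k) *\<^sub>R (entry_sum A * \<bar>u\<bar>) ^ k" for k
    using abs_mat_pow_entry_le[of A k i j]
    by (auto simp: abs_mult power_mult_distrib power_abs divide_simps intro!: mult_right_mono)
  have "norm (\<Sum>k. mat_pow A k $ i $ j / fact k * u ^ k) \<le> (\<Sum>k. inverse (fact k) *\<^sub>R (entry_sum A * \<bar>u\<bar>) ^ k)"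
    by (rule norm_suminf_le[OF le s])
  then show ?thesis by (simp add: mat_exp_entry_eq exp_def)
qed

lemma mat_exp_0 [simp]: "mat_exp 0 = mat 1"
proof -
  have "mat_exp (0 *\<^sub>R (0::real^'n^'n)) = mat 1"
  proof (simp only: vec_eq_iff, intro allI)
    fix i j :: 'n
    have "(\<lambda>k. mat_pow (0::real^'n^'n) k $ i $ j / fact k * 0 ^ k) sums (mat_pow 0 0 $ i $ j / fact 0)"
      using powser_sums_zero[of "\<lambda>k. mat_pow (0::real^'n^'n) k $ i $ j / fact k"] by simp
    from sums_unique2[OF this mat_exp_entry_sums]
    show "mat_exp (0 *\<^sub>R 0) $ i $ j = mat 1 $ i $ j" by simp
  qed
  then show ?thesis by simp
qed

lemma has_derivative_mat_exp_entry:
  "((\<lambda>u. mat_exp (u *\<^sub>R A) $ i $ j) has_real_derivative (A ** mat_exp (u *\<^sub>R A)) $ i $ j) (at u)"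
  "((\<lambda>u. mat_exp (u *\<^sub>R A) $ i $ j) has_real_derivative (mat_exp (u *\<^sub>R A) ** A) $ i $ j) (at u)"
proof -
  define c where "c k = mat_pow A k $ i $ j / fact k" for k
  have D: "((\<lambda>u. \<Sum>k. c k * u ^ k) has_real_derivative (\<Sum>k. diffs c k * u ^ k)) (at u)"
    unfolding c_def by (rule termdiffs_strong_converges_everywhere) (rule summable_mat_exp_entry)
  have d: "diffs c k = mat_pow A (Suc k) $ i $ j / fact k" for k
    by (simp add: diffs_def c_def del: of_nat_Suc)
  have "(\<lambda>k. \<Sum>l\<in>UNIV. A $ i $ l * (mat_pow A k $ l $ j / fact k * u ^ k)) sums
      (\<Sum>l\<in>UNIV. A $ i $ l * mat_exp (u *\<^sub>R A) $ l $ j)"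
    by (intro sums_sum sums_mult mat_exp_entry_sums)
  then have 1: "(\<Sum>k. diffs c k * u ^ k) = (A ** mat_exp (u *\<^sub>R A)) $ i $ j"
    by (intro sums_unique[symmetric])
      (simp add: d mat_pow_Suc matrix_matrix_mult_def sum_distrib_right sum_divide_distrib mult.assoc)
  have "(\<lambda>k. \<Sum>l\<in>UNIV. (mat_pow A k $ i $ l / fact k * u ^ k) * A $ l $ j) sums
      (\<Sum>l\<in>UNIV. mat_exp (u *\<^sub>R A) $ i $ l * A $ l $ j)"
    by (intro sums_sum sums_mult2 mat_exp_entry_sums)
  then have 2: "(\<Sum>k. diffs c k * u ^ k) = (mat_exp (u *\<^sub>R A) ** A) $ i $ j"
    by (intro sums_unique[symmetric])
      (simp add: d mat_pow_Suc_right matrix_matrix_mult_def sum_distrib_left sum_distrib_right sum_divide_distrib mult_ac)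
  show "((\<lambda>u. mat_exp (u *\<^sub>R A) $ i $ j) has_real_derivative (A ** mat_exp (u *\<^sub>R A)) $ i $ j) (at u)"
    "((\<lambda>u. mat_exp (u *\<^sub>R A) $ i $ j) has_real_derivative (mat_exp (u *\<^sub>R A) ** A) $ i $ j) (at u)"
    using D[unfolded 1] D[unfolded 2] by (simp_all add: mat_exp_entry_eq c_def)
qed

text \<open>
  By the two forms of the derivative of the exponential, the derivative in \<open>u\<close> of the left-hand side
  cancels, so it has its value at \<open>u = 0\<close>.  Inverses and the group law both follow from this.
\<close>

lemma mat_exp_shift_constant:
  "mat_exp ((- u) *\<^sub>R A) ** mat_exp ((u + w) *\<^sub>R A) = mat_exp (w *\<^sub>R A)"
proof -
  define P where "P u = mat_exp ((- u) *\<^sub>R A) ** mat_exp ((u + w) *\<^sub>R A)" for u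
  have "((\<lambda>u. P u $ i $ j) has_real_derivative 0) (at u)" for i j u
  proof -
    have 1: "((\<lambda>u. mat_exp ((- u) *\<^sub>R A) $ i $ l) has_real_derivative
        - (mat_exp ((- u) *\<^sub>R A) ** A) $ i $ l) (at u)" for l
      using DERIV_chain2[where f = "\<lambda>u. mat_exp (u *\<^sub>R A) $ i $ l" and g = uminus and x = u and Db = "-1", OF has_derivative_mat_exp_entry(2)] 
      by (simp add: DERIV_minus)
    have 2: "((\<lambda>u. mat_exp ((u + w) *\<^sub>R A) $ l $ j) has_real_derivative
        (A ** mat_exp ((u + w) *\<^sub>R A)) $ l $ j) (at u)" for l
      using has_derivative_mat_exp_entry(1)[of A l j "u + w"] by (simp add: DERIV_shift)
    have "((\<lambda>u. P u $ i $ j) has_real_derivative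
        (\<Sum>l\<in>UNIV. (- (mat_exp ((- u) *\<^sub>R A) ** A) $ i $ l) * mat_exp ((u + w) *\<^sub>R A) $ l $ j +
          (A ** mat_exp ((u + w) *\<^sub>R A)) $ l $ j * mat_exp ((- u) *\<^sub>R A) $ i $ l)) (at u)"
      unfolding P_def matrix_matrix_mult_def[of "mat_exp _" "mat_exp _"] vec_lambda_beta
      by (intro DERIV_sum DERIV_mult 1 2)
    also have "(\<Sum>l\<in>UNIV. (- (mat_exp ((- u) *\<^sub>R A) ** A) $ i $ l) * mat_exp ((u + w) *\<^sub>R A) $ l $ j +
          (A ** mat_exp ((u + w) *\<^sub>R A)) $ l $ j * mat_exp ((- u) *\<^sub>R A) $ i $ l)
      = - ((mat_exp ((- u) *\<^sub>R A) ** A) ** mat_exp ((u + w) *\<^sub>R A)) $ i $ j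
        + (mat_exp ((- u) *\<^sub>R A) ** (A ** mat_exp ((u + w) *\<^sub>R A))) $ i $ j"
      by (simp only: matrix_mult_entry[of "mat_exp _ ** A"] matrix_mult_entry[of "mat_exp _" "A ** _"]
          sum.distrib sum_negf mult_minus_left mult_minus_right mult.commute)
    also have "\<dots> = 0" by (simp add: matrix_mul_assoc)
    finally show ?thesis .
  qed
  then have "P u $ i $ j = P 0 $ i $ j" for i j
    using DERIV_isconst_all[of "\<lambda>u. P u $ i $ j" u 0] by blast
  then have "P u = P 0" by (simp add: vec_eq_iff)
  then show ?thesis by (simp add: P_def)
qed

lemma mat_exp_minus_mult [simp]: "mat_exp ((- u) *\<^sub>R A) ** mat_exp (u *\<^sub>R A) = mat 1"
  using mat_exp_shift_constant[of u A 0] by simp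

lemma mat_exp_add: "mat_exp ((u + w) *\<^sub>R A) = mat_exp (u *\<^sub>R A) ** mat_exp (w *\<^sub>R A)"
proof -
  have "mat_exp (u *\<^sub>R A) ** (mat_exp ((- u) *\<^sub>R A) ** mat_exp ((u + w) *\<^sub>R A)) = mat_exp ((u + w) *\<^sub>R A)"
    using mat_exp_minus_mult[of "- u" A] by (simp add: matrix_mul_assoc)
  then show ?thesis by (simp only: mat_exp_shift_constant)
qed

text \<open>
  In the Leibniz formula only the identity permutation contributes: any other permutation moves two
  points, and after one entry of a product has been differentiated an off-diagonal entry of the identity matrix
  remains.
\<close>

lemma has_derivative_det_mat_exp_0:
  fixes A :: "real^'n^'n"
  shows "((\<lambda>u. det (mat_exp (u *\<^sub>R A))) has_real_derivative trace A) (at 0)"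
proof -
  let ?P = "{p. p permutes (UNIV :: 'n set)}"
  have e: "mat_exp (0 *\<^sub>R A) = mat 1" by simp
  have "((\<lambda>u. det (mat_exp (u *\<^sub>R A))) has_real_derivative
     (\<Sum>p\<in>?P. of_int (sign p) * (\<Sum>i\<in>UNIV. A $ i $ p i * (\<Prod>j\<in>UNIV - {i}. mat 1 $ j $ p j)))) (at 0)"
    unfolding det_def
  proof (intro DERIV_sum DERIV_cmult)
    fix p
    show "((\<lambda>u. \<Prod>i\<in>UNIV. mat_exp (u *\<^sub>R A) $ i $ p i) has_real_derivative
       (\<Sum>i\<in>UNIV. A $ i $ p i * (\<Prod>j\<in>UNIV - {i}. mat 1 $ j $ p j))) (at 0)"
      using has_field_derivative_prod[of UNIV "\<lambda>i u. mat_exp (u *\<^sub>R A) $ i $ p i"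
          "\<lambda>i. (A ** mat_exp (0 *\<^sub>R A)) $ i $ p i" 0]
        has_derivative_mat_exp_entry(1)[of A _ _ 0] by simp
  qed
  also have "(\<Sum>p\<in>?P. of_int (sign p) * (\<Sum>i\<in>UNIV. A $ i $ p i * (\<Prod>j\<in>UNIV - {i}. mat 1 $ j $ p j)))
     = (\<Sum>p\<in>?P. if p = id then trace A else 0)"
  proof (rule sum.cong[OF refl])
    fix p assume p: "p \<in> ?P"
    show "of_int (sign p) * (\<Sum>i\<in>UNIV. A $ i $ p i * (\<Prod>j\<in>UNIV - {i}. mat 1 $ j $ p j)) =
       (if p = id then trace A else 0)"
    proof (cases "p = id")
      case True
      then show ?thesis by (simp add: trace_def mat_def)
    next
      case False
      then obtain a where a: "p a \<noteq> a" by (auto simp: fun_eq_iff)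
      \<comment> \<open>A nontrivial permutation moves a second point.\<close>
      have b: "p (p a) \<noteq> p a" using a p by (metis mem_Collect_eq permutes_def)
      have "(\<Prod>j\<in>UNIV - {i}. (mat 1 :: real^'n^'n) $ j $ p j) = 0" for i
      proof (cases "i = a")
        case True
        then show ?thesis using a b by (intro prod_zero) (auto intro!: bexI[of _ "p a"] simp: mat_def)
      next
        case i: False
        then show ?thesis using a b by (intro prod_zero) (auto intro!: bexI[of _ a] simp: mat_def)
      qed
      then show ?thesis using False
        by (simp only: mult_zero_right sum.neutral_const if_False)
    qed
  qed
  also have "\<dots> = trace A" by (simp add: sum.delta finite_permutations permutes_id)
  finally show ?thesis .
qed

text \<open>
  The determinant is multiplicative along the one-parameter group, so its derivative at \<open>0\<close>
  determines it.
\<close>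

lemma det_mat_exp: "det (mat_exp (u *\<^sub>R A)) = exp (u * trace A)"
proof -
  define d where "d u = det (mat_exp (u *\<^sub>R A))" for u
  have add: "d (u + w) = d u * d w" for u w
    by (simp add: d_def mat_exp_add det_mul)
  have D: "(d has_real_derivative d u * trace A) (at u)" for u
  proof -
    have "((\<lambda>h. d u * d h) has_real_derivative d u * trace A) (at 0)"
      unfolding d_def by (intro DERIV_cmult has_derivative_det_mat_exp_0)
    then have "((\<lambda>h. d (h + u)) has_real_derivative d u * trace A) (at 0)"
      by (simp add: add mult.commute)
    then show ?thesis using DERIV_shift[of d "d u * trace A" 0 u] by simp
  qed
  have "((\<lambda>u. d u * exp (- (u * trace A))) has_real_derivative 0) (at u)" for u
    by (rule derivative_eq_intros D refl | simp)+
  then have "d u * exp (- (u * trace A)) = d 0 * exp (- (0 * trace A))"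
    by (intro DERIV_isconst_all) auto
  then show ?thesis
    by (simp add: d_def exp_minus field_simps)
qed

section \<open>Smooth functions on open sets\<close>

text \<open>
  The direction comes first, so that \<open>ddir v\<close> maps functions to functions and can be iterated, as the
  recursion in \<^const>\<open>Ck_on\<close> does.
\<close>

definition ddir :: "real^'n \<Rightarrow> (real^'n \<Rightarrow> real) \<Rightarrow> real^'n \<Rightarrow> real" where
  "ddir v f x = frechet_derivative f (at x) v"

lemma ddir_eqI: "(f has_derivative f') (at x) \<Longrightarrow> ddir v f x = f' v"
  by (metis ddir_def frechet_derivative_at)

lemma has_derivative_ddir: "f differentiable (at x) \<Longrightarrow> (f has_derivative (\<lambda>v. ddir v f x)) (at x)"
  by (simp add: ddir_def frechet_derivative_works[symmetric])

lemma Ck_on_Suc_iff: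
  "Ck_on (Suc k) U f \<longleftrightarrow> (\<forall>x\<in>U. f differentiable (at x)) \<and> (\<forall>v. Ck_on k U (ddir v f))"
  by (simp add: ddir_def[abs_def])

(* Ck_on_Suc_iff takes the place of this equation and keeps derivatives in the form ddir. *)
declare Ck_on.simps(2) [simp del]

lemma Ck_on_Suc_has_derivative:
  "Ck_on (Suc k) U f \<Longrightarrow> x \<in> U \<Longrightarrow> (f has_derivative (\<lambda>v. ddir v f x)) (at x)"
  using has_derivative_ddir unfolding Ck_on_Suc_iff by blast

lemma Ck_on_Suc_ddir: "Ck_on (Suc k) U f \<Longrightarrow> Ck_on k U (ddir v f)"
  unfolding Ck_on_Suc_iff by blast

lemma Ck_on_cong:
  assumes "open U" "\<And>x. x \<in> U \<Longrightarrow> f x = g x" "Ck_on k U f"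
  shows "Ck_on k U g"
  using assms(2,3)
proof (induction k arbitrary: f g)
  case 0
  then show ?case using continuous_on_cong[of U U f g] unfolding Ck_on.simps(1) by blast
next
  case (Suc k)
  have D: "(g has_derivative (\<lambda>v. ddir v f x)) (at x)" if "x \<in> U" for x
    by (rule has_derivative_transform_within_open[OF Ck_on_Suc_has_derivative[OF Suc.prems(2) that]
          assms(1) that Suc.prems(1)])
  have "Ck_on k U (ddir v g)" for v
    by (rule Suc.IH[OF _ Ck_on_Suc_ddir[OF Suc.prems(2)]]) (rule ddir_eqI[OF D, symmetric])
  then show ?case using D unfolding Ck_on_Suc_iff differentiable_def by blast
qed

text \<open>
  Derivatives are usually known only at the points of \<open>U\<close>, whereas \<open>ddir v f\<close> has arbitrary values
  elsewhere; this rule makes the latter irrelevant.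
\<close>

lemma Ck_on_SucI:
  assumes "open U" "\<And>x. x \<in> U \<Longrightarrow> (f has_derivative f' x) (at x)" "\<And>v. Ck_on k U (\<lambda>x. f' x v)"
  shows "Ck_on (Suc k) U f"
  unfolding Ck_on_Suc_iff
proof (intro conjI ballI allI)
  show "f differentiable (at x)" if "x \<in> U" for x
    using assms(2)[OF that] by (auto simp: differentiable_def)
  show "Ck_on k U (ddir v f)" for v
    by (rule Ck_on_cong[OF assms(1) _ assms(3)[of v]]) (rule ddir_eqI[OF assms(2), symmetric])
qed

lemma Ck_on_SucD: "Ck_on (Suc k) U f \<Longrightarrow> Ck_on k U f"
proof (induction k arbitrary: f)
  case 0
  then show ?case
    using differentiable_imp_continuous_on[OF differentiable_at_imp_differentiable_on, of U f]
    unfolding Ck_on_Suc_iff Ck_on.simps(1) by blast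
next
  case (Suc k)
  have "f differentiable (at x)" if "x \<in> U" for x
    using Suc.prems that unfolding Ck_on_Suc_iff[of "Suc k" U f] by blast
  moreover have "Ck_on k U (ddir v f)" for v
    using Suc.prems unfolding Ck_on_Suc_iff[of "Suc k" U f] by (intro Suc.IH) blast
  ultimately show ?case unfolding Ck_on_Suc_iff[of k U f] by blast
qed

lemma Ck_on_const:
  fixes U :: "(real^'n) set"
  shows "Ck_on k U (\<lambda>x. c)"
proof (induction k arbitrary: c)
  case (Suc k)
  have "ddir v (\<lambda>x. c) = (\<lambda>x. 0)" for v :: "real^'n"
    by (rule ext) (simp add: ddir_def)
  then show ?case using Suc by (simp add: Ck_on_Suc_iff)
qed simp

lemma Ck_on_add:
  assumes "open U" "Ck_on k U f" "Ck_on k U g"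
  shows "Ck_on k U (\<lambda>x. f x + g x)"
  using assms(2,3)
proof (induction k arbitrary: f g)
  case 0
  then show ?case using continuous_on_add[of U f g] by simp
next
  case (Suc k)
  show ?case
  proof (rule Ck_on_SucI[where f' = "\<lambda>x v. ddir v f x + ddir v g x", OF assms(1)])
    show "((\<lambda>x. f x + g x) has_derivative (\<lambda>v. ddir v f x + ddir v g x)) (at x)" if "x \<in> U" for x
      using Suc.prems[THEN Ck_on_Suc_has_derivative, OF that] by (rule has_derivative_add)
    show "Ck_on k U (\<lambda>x. ddir v f x + ddir v g x)" for v
      using Suc.prems[THEN Ck_on_Suc_ddir] by (rule Suc.IH)
  qed
qed

lemma Ck_on_mult:
  assumes "open U" "Ck_on k U f" "Ck_on k U g"
  shows "Ck_on k U (\<lambda>x. f x * g x)"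
  using assms(2,3)
proof (induction k arbitrary: f g)
  case 0
  then show ?case using continuous_on_mult[of U f g] by simp
next
  case (Suc k)
  show ?case
  proof (rule Ck_on_SucI[where f' = "\<lambda>x v. f x * ddir v g x + ddir v f x * g x", OF assms(1)])
    show "((\<lambda>x. f x * g x) has_derivative (\<lambda>v. f x * ddir v g x + ddir v f x * g x)) (at x)"
      if "x \<in> U" for x
      using Suc.prems[THEN Ck_on_Suc_has_derivative, OF that] by (rule has_derivative_mult)
    show "Ck_on k U (\<lambda>x. f x * ddir v g x + ddir v f x * g x)" for v
      using Suc.prems[THEN Ck_on_Suc_ddir] Suc.prems[THEN Ck_on_SucD]
      by (intro Ck_on_add assms(1) Suc.IH)
  qed
qed

lemma Ck_on_inverse:
  assumes "open U" "\<And>x. x \<in> U \<Longrightarrow> g x \<noteq> 0" "Ck_on k U g"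
  shows "Ck_on k U (\<lambda>x. inverse (g x))"
  using assms(3)
proof (induction k)
  case 0
  then show ?case using continuous_on_inverse[of U g] assms(2) by simp
next
  case (Suc k)
  have IH: "Ck_on k U (\<lambda>x. inverse (g x))" using Suc by (auto dest: Ck_on_SucD)
  show ?case
  proof (rule Ck_on_SucI[where f' = "\<lambda>x v. - 1 * (inverse (g x) * ddir v g x * inverse (g x))", OF assms(1)])
    show "((\<lambda>x. inverse (g x)) has_derivative
      (\<lambda>v. - 1 * (inverse (g x) * ddir v g x * inverse (g x)))) (at x)"
      if "x \<in> U" for x
      using Deriv.has_derivative_inverse[OF assms(2)[OF that] Ck_on_Suc_has_derivative[OF Suc.prems that]]
      by simp
    show "Ck_on k U (\<lambda>x. - 1 * (inverse (g x) * ddir v g x * inverse (g x)))" for v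
      using Suc.prems[THEN Ck_on_Suc_ddir] by (intro Ck_on_mult Ck_on_const assms(1) IH)
  qed
qed

lemma Ck_on_ln:
  assumes "open U" "\<And>x. x \<in> U \<Longrightarrow> 0 < g x" "Ck_on (Suc k) U g"
  shows "Ck_on (Suc k) U (\<lambda>x. ln (g x))"
proof (rule Ck_on_SucI[where f' = "\<lambda>x v. ddir v g x * inverse (g x)", OF assms(1)])
  show "((\<lambda>x. ln (g x)) has_derivative (\<lambda>v. ddir v g x * inverse (g x))) (at x)" if "x \<in> U" for x
    using has_derivative_ln[OF assms(2)[OF that] Ck_on_Suc_has_derivative[OF assms(3) that]] .
  show "Ck_on k U (\<lambda>x. ddir v g x * inverse (g x))" for v
    using assms(2) by (intro Ck_on_mult Ck_on_inverse assms(1) Ck_on_Suc_ddir assms(3) Ck_on_SucD[OF assms(3)]) force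
qed

lemma Cinfinity_on_continuous: "Cinfinity_on U f \<Longrightarrow> continuous_on U f"
  by (metis Cinfinity_on_def Ck_on.simps(1))

lemma Cinfinity_on_differentiable: "Cinfinity_on U f \<Longrightarrow> x \<in> U \<Longrightarrow> f differentiable (at x)"
  by (metis Cinfinity_on_def Ck_on_Suc_iff)

lemma Cinfinity_on_ddir: "Cinfinity_on U f \<Longrightarrow> Cinfinity_on U (ddir v f)"
  unfolding Cinfinity_on_def by (metis Ck_on_Suc_iff)

lemma Cinfinity_on_add:
  "open U \<Longrightarrow> Cinfinity_on U f \<Longrightarrow> Cinfinity_on U g \<Longrightarrow> Cinfinity_on U (\<lambda>x. f x + g x)"
  by (simp add: Cinfinity_on_def Ck_on_add)

lemma Cinfinity_on_mult:
  "open U \<Longrightarrow> Cinfinity_on U f \<Longrightarrow> Cinfinity_on U g \<Longrightarrow> Cinfinity_on U (\<lambda>x. f x * g x)"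
  by (simp add: Cinfinity_on_def Ck_on_mult)

lemma Cinfinity_on_const: "Cinfinity_on U (\<lambda>x. c)"
  by (simp add: Cinfinity_on_def Ck_on_const)

lemma Cinfinity_on_inverse:
  "open U \<Longrightarrow> (\<And>x. x \<in> U \<Longrightarrow> g x \<noteq> 0) \<Longrightarrow> Cinfinity_on U g \<Longrightarrow> Cinfinity_on U (\<lambda>x. inverse (g x))"
  by (simp add: Cinfinity_on_def Ck_on_inverse)

lemma Cinfinity_on_ln:
  "open U \<Longrightarrow> (\<And>x. x \<in> U \<Longrightarrow> 0 < g x) \<Longrightarrow> Cinfinity_on U g \<Longrightarrow> Cinfinity_on U (\<lambda>x. ln (g x))"
  unfolding Cinfinity_on_def using Ck_on_ln Ck_on_SucD by blast

section \<open>The flow of a matrix and a homogeneous function\<close>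

lemma norm_matrix_vector_le:
  fixes M :: "real^'n^'n"
  assumes "\<And>i j. \<bar>M $ i $ j\<bar> \<le> b"
  shows "norm (M *v x) \<le> real CARD('n) * real CARD('n) * b * norm (x :: real^'n)"
proof -
  have b: "0 \<le> b" using assms[of undefined undefined] by linarith
  have "norm (M *v x) \<le> (\<Sum>i\<in>UNIV. \<bar>(M *v x) $ i\<bar>)" by (rule norm_le_l1_cart)
  also have "\<dots> \<le> (\<Sum>i\<in>(UNIV::'n set). \<Sum>j\<in>(UNIV::'n set). b * norm x)"
  proof (rule sum_mono)
    fix i :: 'n
    have "\<bar>(M *v x) $ i\<bar> \<le> (\<Sum>j\<in>UNIV. \<bar>M $ i $ j * x $ j\<bar>)"
      by (simp add: matrix_vector_mult_def sum_abs)
    also have "\<dots> \<le> (\<Sum>j\<in>(UNIV::'n set). b * norm x)"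
      using assms b by (intro sum_mono) (auto simp: abs_mult intro!: mult_mono component_le_norm_cart)
    finally show "\<bar>(M *v x) $ i\<bar> \<le> (\<Sum>j\<in>(UNIV::'n set). b * norm x)" .
  qed
  finally show ?thesis by (simp add: mult_ac)
qed

locale homogeneous_function =
  fixes A :: "real^'n^'n" and \<phi> :: "real^'n \<Rightarrow> real"
  assumes phi_continuous: "continuous_on UNIV \<phi>"
    and phi_smooth: "Cinfinity_on (UNIV - {0}) \<phi>"
    and phi_homogeneous: "positive_homogeneous A \<phi>"
begin

definition T :: "real \<Rightarrow> real^'n \<Rightarrow> real^'n" where
  "T u x = mat_exp (u *\<^sub>R A) *v x"

definition L :: "real^'n \<Rightarrow> real" where
  "L x = ln (\<phi> x)"

lemma T_0 [simp]: "T 0 x = x"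
  by (simp add: T_def)

lemma T_add: "T (u + w) x = T u (T w x)"
  by (simp add: T_def mat_exp_add matrix_vector_mul_assoc)

lemma T_minus_cancel [simp]: "T (- u) (T u x) = x" "T u (T (- u) x) = x"
  using T_add[of "- u" u x] T_add[of u "- u" x] by simp_all

lemma T_linear: "linear (T u)"
  unfolding T_def[abs_def] by (rule matrix_vector_mul_linear)

lemma T_zero [simp]: "T u 0 = 0"
  by (simp add: T_def)

lemma T_eq_0_iff [simp]: "T u x = 0 \<longleftrightarrow> x = 0"
  by (metis T_minus_cancel(1) T_zero)

lemma phi_nonneg: "0 \<le> \<phi> x" and phi_pos: "x \<noteq> 0 \<Longrightarrow> 0 < \<phi> x"
  using phi_homogeneous by (auto simp: positive_homogeneous_def)

lemma phi_T: "\<phi> (T u x) = exp u * \<phi> x"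
proof -
  have "\<phi> (powr_mat (exp u) A *v x) = exp u * \<phi> x"
    using phi_homogeneous unfolding positive_homogeneous_def homogeneous_def by force
  then show ?thesis by (simp add: T_def powr_mat_def)
qed

lemma phi_zero [simp]: "\<phi> 0 = 0"
  using phi_T[of "ln 2" 0] by simp

lemma L_T: "x \<noteq> 0 \<Longrightarrow> L (T u x) = u + L x"
  using phi_pos[of x] by (simp add: L_def phi_T ln_mult)

lemma exp_L: "x \<noteq> 0 \<Longrightarrow> exp (L x) = \<phi> x"
  by (simp add: L_def phi_pos)

lemma T_continuous: "continuous_on UNIV (\<lambda>u. T u x)"
proof -
  have "continuous_on UNIV (\<lambda>u. mat_exp (u *\<^sub>R A) $ i $ j)" for i j
    by (intro continuous_at_imp_continuous_on ballI DERIV_isCont[OF has_derivative_mat_exp_entry(1)])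
  then show ?thesis
    unfolding T_def matrix_vector_mult_def
    by (intro continuous_on_vec_lambda continuous_on_sum continuous_on_mult continuous_on_const)
qed

definition growth :: real where
  "growth = entry_sum A + 1"

definition growth_const :: real where
  "growth_const = real CARD('n) * real CARD('n)"

lemma growth_pos: "0 < growth" and growth_const_ge_1: "1 \<le> growth_const"
proof -
  have "0 < CARD('n)" by (rule zero_less_card_finite)
  then have "1 \<le> real CARD('n)" by linarith
  then show "1 \<le> growth_const" unfolding growth_const_def by (metis mult_mono' mult_1 zero_le_one)
qed (use entry_sum_nonneg[of A] in \<open>simp add: growth_def\<close>)

lemma norm_T_le: "norm (T u x) \<le> growth_const * exp (growth * \<bar>u\<bar>) * norm x"
proof -
  have "\<bar>mat_exp (u *\<^sub>R A) $ i $ j\<bar> \<le> exp (growth * \<bar>u\<bar>)" for i j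
    by (rule order_trans[OF abs_mat_exp_entry_le]) (simp add: growth_def algebra_simps)
  from norm_matrix_vector_le[OF this] show ?thesis
    by (simp add: T_def growth_const_def)
qed

lemma phi_bounds_on_ball:
  obtains c M where "0 < c" "\<And>x. norm x = 1 \<Longrightarrow> c \<le> \<phi> x" "0 < M" "\<And>x. norm x \<le> 2 \<Longrightarrow> \<phi> x \<le> M"
proof -
  have cont: "continuous_on S \<phi>" for S
    by (rule continuous_on_subset[OF phi_continuous]) simp
  have ne: "sphere (0::real^'n) 1 \<noteq> {}" by simp
  obtain y where y: "y \<in> sphere 0 1" "\<And>x. x \<in> sphere 0 1 \<Longrightarrow> \<phi> y \<le> \<phi> x"
    using continuous_attains_inf[OF compact_sphere ne cont] by blast
  obtain z where z: "\<And>x. x \<in> cball 0 2 \<Longrightarrow> \<phi> x \<le> \<phi> z"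
    using continuous_attains_sup[OF compact_cball[of 0 2] _ cont] by fastforce
  show ?thesis
  proof (rule that[of "\<phi> y" "\<phi> z + 1"])
    show "0 < \<phi> y" using y(1) phi_pos[of y] by force
    show "0 < \<phi> z + 1" using phi_nonneg[of z] by linarith
  qed (use y(2) z in \<open>force+\<close>)
qed

text \<open>
  The expansion comes from \<open>\<phi>\<close>: on unit vectors \<open>\<phi>\<close> has a positive minimum, so \<open>\<phi> (T u x)\<close> exceeds
  the maximum of \<open>\<phi>\<close> on the ball of radius 2 once \<open>u\<close> is large, and \<open>T u x\<close> must have left that
  ball.
\<close>

lemma T_expands: obtains U where "0 < U" "\<And>u x. U \<le> u \<Longrightarrow> 2 * norm x \<le> norm (T u x)"
proof -
  obtain c M where c: "0 < c" "\<And>x. norm x = 1 \<Longrightarrow> c \<le> \<phi> x"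
    and M: "0 < M" "\<And>x. norm x \<le> 2 \<Longrightarrow> \<phi> x \<le> M"
    using phi_bounds_on_ball by blast
  have unit: "2 \<le> norm (T u x)" if "norm x = 1" "max 1 (ln (M / c) + 1) \<le> u" for u x
  proof (rule ccontr)
    assume "\<not> ?thesis"
    then have "exp u * \<phi> x \<le> M" using M(2)[of "T u x"] by (simp add: phi_T)
    moreover have "exp u * c \<le> exp u * \<phi> x" using c(2)[of x] that by simp
    ultimately have "exp u * c \<le> M" by linarith
    then have "exp u \<le> M / c" using c(1) by (simp add: field_simps)
    then have "u \<le> ln (M / c)" using c(1) M(1) by (simp add: ln_ge_iff)
    then show False using that by simp
  qed
  show ?thesis
  proof (rule that[of "max 1 (ln (M / c) + 1)"])
    fix u x assume u: "max 1 (ln (M / c) + 1) \<le> u"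
    show "2 * norm x \<le> norm (T u x)"
    proof (cases "x = 0")
      case False
      have "T u ((1 / norm x) *\<^sub>R x) = (1 / norm x) *\<^sub>R T u x"
        by (rule linear_scale[OF T_linear])
      then have "2 \<le> norm (T u x) / norm x"
        using unit[of "(1 / norm x) *\<^sub>R x" u] u False by simp
      then show ?thesis using False by (simp add: field_simps)
    qed simp
  qed simp
qed

text \<open>
  Repeatedly halving by \<open>T (- U)\<close> gives an exponential rate, and the remaining time in \<open>[0, U]\<close> costs a
  constant factor.
\<close>

lemma T_contracts:
  obtains C \<delta> where "0 < C" "0 < \<delta>" "\<And>u x. 0 \<le> u \<Longrightarrow> norm (T (- u) x) \<le> C * exp (- \<delta> * u) * norm x"
proof -
  obtain U where U: "0 < U" "\<And>u x. U \<le> u \<Longrightarrow> 2 * norm x \<le> norm (T u x)" using T_expands by blast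
  have half: "norm (T (- U) x) \<le> norm x / 2" for x
    using U(2)[of U "T (- U) x"] by simp
  have pow: "norm (T (- (real k * U)) x) \<le> norm x / 2 ^ k" for k x
  proof (induction k arbitrary: x)
    case (Suc k)
    have "T (- (real (Suc k) * U)) x = T (- (real k * U)) (T (- U) x)"
      by (simp add: T_add[symmetric] algebra_simps)
    then show ?case
      using order_trans[OF Suc.IH[of "T (- U) x"] divide_right_mono[OF half[of x], of "2 ^ k"]]
      by (simp add: field_simps)
  qed simp
  define C where "C = growth_const * exp (growth * U) * 2"
  have C: "0 < C" using growth_const_ge_1 by (simp add: C_def)
  show ?thesis
  proof (rule that[of C "ln 2 / U"])
    fix u :: real and x assume u: "0 \<le> u"
    define k where "k = nat \<lfloor>u / U\<rfloor>"
    have k: "real k \<le> u / U" "u / U < real k + 1"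
      using u U(1) unfolding k_def by (simp_all add: floor_correct le_nat_floor)
    define r where "r = u - real k * U"
    have r: "0 \<le> r" "r \<le> U" using k U(1) by (auto simp: r_def field_simps)
    have eq: "T (- u) x = T (- r) (T (- (real k * U)) x)"
      by (simp add: T_add[symmetric] r_def)
    have "2 powr (u / U) \<le> 2 powr (real k + 1)" using k by (intro powr_mono) auto
    also have "\<dots> = 2 * 2 ^ k" by (simp add: powr_add powr_realpow)
    finally have e: "exp (ln 2 / U * u) \<le> 2 * 2 ^ k" by (simp add: powr_def mult.commute)
    have "norm (T (- u) x) \<le> growth_const * exp (growth * U) * norm (T (- (real k * U)) x)"
      unfolding eq
    proof (rule order_trans[OF norm_T_le])
      show "growth_const * exp (growth * \<bar>- r\<bar>) * norm (T (- (real k * U)) x)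
        \<le> growth_const * exp (growth * U) * norm (T (- (real k * U)) x)"
        using r growth_pos growth_const_ge_1 by (intro mult_right_mono mult_left_mono) auto
    qed
    also have "\<dots> \<le> growth_const * exp (growth * U) * (norm x / 2 ^ k)"
      using growth_const_ge_1 by (intro mult_left_mono pow) auto
    also have "\<dots> = C * (1 / (2 * 2 ^ k)) * norm x" by (simp add: C_def)
    also have "\<dots> \<le> C * exp (- (ln 2 / U) * u) * norm x"
      using e C by (intro mult_right_mono mult_left_mono) (auto simp: exp_minus field_simps)
    finally show "norm (T (- u) x) \<le> C * exp (- (ln 2 / U) * u) * norm x" .
  qed (use C U in auto)
qed

text \<open>
  Flow \<open>x\<close> backwards until it meets the unit sphere, where \<open>\<phi>\<close> is bounded below.  The time needed is at most
  \<open>L x\<close> plus a constant, and \<open>x\<close> is recovered from the sphere by the flow, which grows at most exponentially.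
\<close>

lemma norm_le_exp_L:
  obtains C m where "0 < C" "0 < m" "\<And>x. 1 \<le> norm x \<Longrightarrow> norm x \<le> C * exp (m * L x)"
proof -
  obtain c where c: "0 < c" "\<And>x. norm x = 1 \<Longrightarrow> c \<le> \<phi> x"
    using phi_bounds_on_ball by metis
  obtain C0 d where C0: "0 < C0" "0 < d" "\<And>u x. 0 \<le> u \<Longrightarrow> norm (T (- u) x) \<le> C0 * exp (- d * u) * norm x"
    using T_contracts by blast
  show ?thesis
  proof (rule that[of "growth_const * exp (- growth * ln c)" growth])
    show "0 < growth_const * exp (- growth * ln c)" using growth_const_ge_1 by simp
    show "0 < growth" by (rule growth_pos)
    fix x :: "real^'n" assume x: "1 \<le> norm x"
    \<comment> \<open>At time \<open>u2\<close> the backward flow has brought \<open>x\<close> into the unit ball.\<close>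
    define u1 where "u1 = (ln (C0 * norm x)) / d"
    have pos: "0 < C0 * norm x" using C0 x by (intro mult_pos_pos) auto
    have "exp (- d * u1) = 1 / (C0 * norm x)" using C0 pos by (simp add: u1_def exp_minus field_simps)
    moreover define u2 where "u2 = max 0 u1"
    have "exp (- d * u2) \<le> exp (- d * u1)" using C0 by (simp add: u2_def)
    ultimately have "C0 * exp (- d * u2) * norm x \<le> 1" using pos by (simp add: field_simps)
    then have end2: "norm (T (- u2) x) \<le> 1" using C0(3)[of u2 x] by (simp add: u2_def)
    have "\<exists>u\<ge>0. u \<le> u2 \<and> norm (T (- u) x) = 1"
    proof (rule IVT2')
      show "norm (T (- u2) x) \<le> 1" by (rule end2)
      show "1 \<le> norm (T (- 0) x)" using x by simp
      show "0 \<le> u2" by (simp add: u2_def)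
      show "continuous_on {0..u2} (\<lambda>u. norm (T (- u) x))"
        by (intro continuous_on_norm continuous_on_compose2[OF T_continuous[of x]] continuous_intros) auto
    qed
    then obtain u where u: "0 \<le> u" "norm (T (- u) x) = 1" by blast
    have x0: "x \<noteq> 0" using x by force
    have "c \<le> \<phi> (T (- u) x)" using c(2) u by simp
    then have "ln c \<le> L (T (- u) x)" using c(1) phi_pos[of "T (- u) x"] x0 by (simp add: L_def)
    then have ule: "u \<le> L x - ln c" using L_T[OF x0, of "- u"] by simp
    have "norm x = norm (T u (T (- u) x))" by simp
    also have "\<dots> \<le> growth_const * exp (growth * \<bar>u\<bar>) * 1"
      using norm_T_le[of u "T (- u) x"] u by simp
    also have "\<dots> \<le> growth_const * exp (growth * (L x - ln c))"
      using u ule growth_pos growth_const_ge_1 by simp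
    also have "\<dots> = growth_const * exp (- growth * ln c) * exp (growth * L x)"
      by (simp add: exp_add[symmetric] algebra_simps)
    finally show "norm x \<le> growth_const * exp (- growth * ln c) * exp (growth * L x)" .
  qed
qed

lemma compact_level_set: "compact {x. \<phi> x = 1}"
proof -
  obtain C m where C: "0 < C" "0 < m" "\<And>x. 1 \<le> norm x \<Longrightarrow> norm x \<le> C * exp (m * L x)"
    using norm_le_exp_L by blast
  have "norm x \<le> max 1 C" if "\<phi> x = 1" for x
    using C(3)[of x] that by (cases "1 \<le> norm x") (auto simp: L_def)
  then have "bounded {x. \<phi> x = 1}" by (auto simp: bounded_iff)
  moreover have "closed {x. \<phi> x = 1}"
    using continuous_closed_preimage_constant[OF phi_continuous] by simp
  ultimately show ?thesis by (simp add: compact_eq_bounded_closed)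
qed

lemma norm_bounds_abs_L:
  obtains C m where "0 < C" "0 < m" "\<And>x. 1 + norm x \<le> C * exp (m * \<bar>L x\<bar>)"
    "\<And>x. x \<noteq> 0 \<Longrightarrow> 1 \<le> C * exp (m * \<bar>L x\<bar>) * norm x"
proof -
  obtain C m where C: "0 < C" "0 < m" "\<And>x. 1 \<le> norm x \<Longrightarrow> norm x \<le> C * exp (m * L x)"
    using norm_le_exp_L by blast
  have up: "1 + norm x \<le> (2 + C) * exp (m * \<bar>L x\<bar>)" for x
  proof -
    have 1: "1 \<le> exp (m * \<bar>L x\<bar>)" using C by simp
    have "norm x \<le> (1 + C) * exp (m * \<bar>L x\<bar>)"
    proof (cases "1 \<le> norm x")
      case True
      have "norm x \<le> C * exp (m * L x)" by (rule C(3)[OF True])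
      also have "\<dots> \<le> (1 + C) * exp (m * \<bar>L x\<bar>)"
        using C by (intro mult_mono) (auto intro!: mult_left_mono)
      finally show ?thesis .
    next
      case False
      have "norm x \<le> 1 * 1" using False by simp
      also have "\<dots> \<le> (1 + C) * exp (m * \<bar>L x\<bar>)" using 1 C by (intro mult_mono) auto
      finally show ?thesis .
    qed
    from add_mono[OF 1 this] show ?thesis by (simp add: algebra_simps)
  qed
  \<comment> \<open>The lower bound: move \<open>x\<close> along the flow to the level set, which avoids a ball about the origin.\<close>
  obtain r where r: "0 < r" "\<And>x. \<phi> x = 1 \<Longrightarrow> r \<le> norm x"
  proof -
    have "0 \<notin> {x. \<phi> x = 1}" by simp
    then obtain r where "r > 0" "\<And>x. x \<in> {x. \<phi> x = 1} \<Longrightarrow> r \<le> dist 0 x"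
      using separate_point_closed[OF compact_imp_closed[OF compact_level_set]] by metis
    then show ?thesis using that by force
  qed
  have lo: "1 \<le> growth_const / r * exp (growth * \<bar>L x\<bar>) * norm x" if "x \<noteq> 0" for x
  proof -
    have "\<phi> (T (- L x) x) = 1" using phi_pos[OF that] by (simp add: phi_T exp_minus exp_L[OF that])
    then have "r \<le> growth_const * exp (growth * \<bar>L x\<bar>) * norm x"
      using r(2) norm_T_le[of "- L x" x] by fastforce
    then show ?thesis using r(1) by (simp add: field_simps)
  qed
  define C' m' where "C' = 2 + C + growth_const / r" and "m' = m + growth"
  have pos: "0 \<le> growth_const / r" using growth_const_ge_1 r by simp
  have e: "exp (m * \<bar>L x\<bar>) \<le> exp (m' * \<bar>L x\<bar>)" "exp (growth * \<bar>L x\<bar>) \<le> exp (m' * \<bar>L x\<bar>)" for x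
    using C growth_pos by (auto simp: m'_def intro!: mult_right_mono)
  have cc: "2 + C \<le> C'" "growth_const / r \<le> C'" "0 < C'" using C pos by (auto simp: C'_def)
  show ?thesis
  proof (rule that[of C' m'])
    show "1 + norm x \<le> C' * exp (m' * \<bar>L x\<bar>)" for x
      using cc by (intro order_trans[OF up] mult_mono e) auto
    show "1 \<le> C' * exp (m' * \<bar>L x\<bar>) * norm x" if "x \<noteq> 0" for x
      using cc by (intro order_trans[OF lo[OF that]] mult_right_mono mult_mono e) auto
  qed (use C pos growth_pos in \<open>auto simp: C'_def m'_def\<close>)
qed

end

section \<open>Symbols\<close>

definition exp_bounded :: "(real \<Rightarrow> real) \<Rightarrow> bool" where
  "exp_bounded a \<longleftrightarrow> (\<exists>C\<ge>0. \<exists>m\<ge>0. \<forall>u. \<bar>a u\<bar> \<le> C * exp (m * \<bar>u\<bar>))"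

lemma exp_bounded_const: "exp_bounded (\<lambda>u. c)"
  unfolding exp_bounded_def by (rule exI[of _ "\<bar>c\<bar>"]) (auto intro!: exI[of _ 0])

lemma exp_bounded_exp: "exp_bounded (\<lambda>u. exp (c * u))"
  unfolding exp_bounded_def
  by (rule exI[of _ 1]) (auto intro!: exI[of _ "\<bar>c\<bar>"] simp: abs_mult[symmetric])

lemma exp_bounded_ident: "exp_bounded (\<lambda>u. u)"
  unfolding exp_bounded_def
proof (intro exI[of _ 1] conjI allI)
  show "\<bar>u\<bar> \<le> 1 * exp (1 * \<bar>u\<bar>)" for u :: real
    using exp_ge_add_one_self[of "\<bar>u\<bar>"] unfolding mult_1 by linarith
qed auto

lemma exp_bounded_mult:
  assumes "exp_bounded a" "exp_bounded b"
  shows "exp_bounded (\<lambda>u. a u * b u)"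
proof -
  obtain C m where a: "C \<ge> 0" "m \<ge> 0" "\<And>u. \<bar>a u\<bar> \<le> C * exp (m * \<bar>u\<bar>)"
    using assms(1) unfolding exp_bounded_def by blast
  obtain D k where b: "D \<ge> 0" "k \<ge> 0" "\<And>u. \<bar>b u\<bar> \<le> D * exp (k * \<bar>u\<bar>)"
    using assms(2) unfolding exp_bounded_def by blast
  have "\<bar>a u * b u\<bar> \<le> (C * D) * exp ((m + k) * \<bar>u\<bar>)" for u
    using mult_mono[OF a(3) b(3), of u u] a by (simp add: abs_mult exp_add algebra_simps)
  moreover have "0 \<le> C * D" "0 \<le> m + k" using a b by auto
  ultimately show ?thesis unfolding exp_bounded_def by blast
qed

abbreviation smooth :: "(real^'n \<Rightarrow> real) \<Rightarrow> bool" where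
  "smooth \<equiv> Cinfinity_on (UNIV - {0})"

text \<open>
  Families \<open>F u\<close> that are finite sums of smooth functions with coefficients exponentially bounded in
  \<open>u\<close>.  An inductive predicate avoids naming the index set of the sum, and each closure property becomes
  a two-case induction.
\<close>

inductive exp_family :: "(real \<Rightarrow> real^'n \<Rightarrow> real) \<Rightarrow> bool" where
  exp_family_term:
    "exp_bounded a \<Longrightarrow> smooth g \<Longrightarrow> exp_family (\<lambda>u x. a u * g x)"
| exp_family_add: "exp_family F \<Longrightarrow> exp_family G \<Longrightarrow> exp_family (\<lambda>u x. F u x + G u x)"

lemma open_punctured: "open (UNIV - {0 :: real^'n})"
  by (rule open_delete) simp

lemma exp_family_const: "exp_family (\<lambda>u x. c)"
  using exp_family_term[OF exp_bounded_const Cinfinity_on_const, of 1 c] by simp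

lemma exp_family_scale:
  assumes "exp_bounded b" "exp_family F"
  shows "exp_family (\<lambda>u x. b u * F u x)"
  using assms(2)
proof induction
  case (exp_family_term a g)
  from exp_family.exp_family_term[OF exp_bounded_mult[OF assms(1) this(1)] this(2)]
  show ?case by (simp add: mult.assoc)
next
  case (exp_family_add F G)
  from exp_family.exp_family_add[OF this(3,4)] show ?case by (simp add: distrib_left)
qed

lemma exp_family_smooth_mult:
  assumes "smooth h" "exp_family F"
  shows "exp_family (\<lambda>u x. h x * F u x)"
  using assms(2)
proof induction
  case (exp_family_term a g)
  from exp_family.exp_family_term[OF this(1) Cinfinity_on_mult[OF open_punctured assms(1) this(2)]]
  show ?case by (simp add: mult_ac)
next
  case (exp_family_add F G)
  from exp_family.exp_family_add[OF this(3,4)] show ?case by (simp add: distrib_left)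
qed

lemma exp_family_mult:
  assumes "exp_family F" "exp_family G"
  shows "exp_family (\<lambda>u x. F u x * G u x)"
  using assms(1)
proof induction
  case (exp_family_term a g)
  from exp_family_scale[OF this(1) exp_family_smooth_mult[OF this(2) assms(2)]]
  show ?case by (simp add: mult.assoc)
next
  case (exp_family_add F1 F2)
  from exp_family.exp_family_add[OF this(3,4)] show ?case by (simp add: distrib_right)
qed

lemma exp_family_sum:
  assumes "\<And>i. i \<in> I \<Longrightarrow> exp_family (F i)"
  shows "exp_family (\<lambda>u x. \<Sum>i\<in>I. F i u x)"
  using assms
proof (induction I rule: infinite_finite_induct)
  case (insert i I)
  have "exp_family (\<lambda>u x. F i u x + (\<Sum>i\<in>I. F i u x))"
    using insert by (intro exp_family_add) auto
  then show ?case using insert by simp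
qed (simp_all add: exp_family_const)

lemma exp_family_bound:
  assumes "exp_family F" "compact K" "0 \<notin> K"
  shows "\<exists>C\<ge>0. \<exists>m\<ge>0. \<forall>u. \<forall>x\<in>K. \<bar>F u x\<bar> \<le> C * exp (m * \<bar>u\<bar>)"
  using assms(1)
proof induction
  case (exp_family_term a g)
  obtain C m where a: "C \<ge> 0" "m \<ge> 0" "\<And>u. \<bar>a u\<bar> \<le> C * exp (m * \<bar>u\<bar>)"
    using exp_family_term(1) unfolding exp_bounded_def by blast
  have "continuous_on K g"
    using Cinfinity_on_continuous[OF exp_family_term(2)] by (rule continuous_on_subset) (use assms(3) in auto)
  then have "bounded (g ` K)" by (intro compact_imp_bounded compact_continuous_image assms(2))
  then obtain B where B: "\<And>x. x \<in> K \<Longrightarrow> \<bar>g x\<bar> \<le> B" unfolding bounded_iff by force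
  have "\<bar>a u * g x\<bar> \<le> C * \<bar>B\<bar> * exp (m * \<bar>u\<bar>)" if "x \<in> K" for u x
    using mult_mono[OF a(3)[of u] order_trans[OF B[OF that] abs_ge_self]] a
    by (simp add: abs_mult mult_ac)
  moreover have "0 \<le> C * \<bar>B\<bar>" using a by simp
  ultimately show ?case using a(2) by blast
next
  case (exp_family_add F G)
  obtain C m where a: "C \<ge> 0" "m \<ge> 0" "\<And>u x. x \<in> K \<Longrightarrow> \<bar>F u x\<bar> \<le> C * exp (m * \<bar>u\<bar>)"
    using exp_family_add(3) by blast
  obtain D k where b: "D \<ge> 0" "k \<ge> 0" "\<And>u x. x \<in> K \<Longrightarrow> \<bar>G u x\<bar> \<le> D * exp (k * \<bar>u\<bar>)"
    using exp_family_add(4) by blast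
  have "\<bar>F u x + G u x\<bar> \<le> (C + D) * exp (max m k * \<bar>u\<bar>)" if "x \<in> K" for u x
  proof -
    have "\<bar>F u x\<bar> \<le> C * exp (max m k * \<bar>u\<bar>)"
      by (rule order_trans[OF a(3)[OF that]]) (use a in \<open>auto intro!: mult_left_mono mult_right_mono\<close>)
    moreover have "\<bar>G u x\<bar> \<le> D * exp (max m k * \<bar>u\<bar>)"
      by (rule order_trans[OF b(3)[OF that]]) (use b in \<open>auto intro!: mult_left_mono mult_right_mono\<close>)
    ultimately show ?thesis unfolding distrib_right by linarith
  qed
  moreover have "0 \<le> C + D" "0 \<le> max m k" using a b by auto
  ultimately show ?case by blast
qed

text \<open>
  The derivative family is only determined away from \<open>0\<close>, hence the existential statement.
\<close>

lemma exp_family_ddir: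
  assumes "exp_family F"
  shows "\<exists>F'. exp_family F' \<and>
    (\<forall>u x. x \<noteq> 0 \<longrightarrow> F u differentiable (at x) \<and> ddir v (F u) x = F' u x)"
  using assms
proof induction
  case (exp_family_term a g)
  have D: "((\<lambda>x. a u * g x) has_derivative (\<lambda>w. a u * ddir w g x)) (at x)" if "x \<noteq> 0" for u x
    using that by (intro has_derivative_mult_right has_derivative_ddir
      Cinfinity_on_differentiable[OF exp_family_term(2)]) simp
  have "exp_family (\<lambda>u x. a u * ddir v g x)"
    using exp_family.exp_family_term[OF exp_family_term(1) Cinfinity_on_ddir[OF exp_family_term(2)]] .
  moreover have "\<forall>u x. x \<noteq> 0 \<longrightarrow> (\<lambda>x. a u * g x) differentiable (at x) \<and>
      ddir v (\<lambda>x. a u * g x) x = a u * ddir v g x"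
    using D ddir_eqI[OF D] unfolding differentiable_def by blast
  ultimately show ?case by blast
next
  case (exp_family_add F G)
  obtain F' where F': "exp_family F'"
    "\<And>u x. x \<noteq> 0 \<Longrightarrow> F u differentiable (at x)" "\<And>u x. x \<noteq> 0 \<Longrightarrow> ddir v (F u) x = F' u x"
    using exp_family_add(3) by blast
  obtain G' where G': "exp_family G'"
    "\<And>u x. x \<noteq> 0 \<Longrightarrow> G u differentiable (at x)" "\<And>u x. x \<noteq> 0 \<Longrightarrow> ddir v (G u) x = G' u x"
    using exp_family_add(4) by blast
  have D: "((\<lambda>x. F u x + G u x) has_derivative (\<lambda>w. ddir w (F u) x + ddir w (G u) x)) (at x)"
    if "x \<noteq> 0" for u x
    using has_derivative_add[OF has_derivative_ddir[OF F'(2)[OF that]] has_derivative_ddir[OF G'(2)[OF that]]] .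
  have "\<forall>u x. x \<noteq> 0 \<longrightarrow> (\<lambda>x. F u x + G u x) differentiable (at x) \<and>
      ddir v (\<lambda>x. F u x + G u x) x = F' u x + G' u x"
    using D ddir_eqI[OF D] F'(3) G'(3) unfolding differentiable_def by auto
  then show ?case using exp_family.exp_family_add[OF F'(1) G'(1)] by blast
qed

lemma ddir_expand:
  assumes "f differentiable (at x)"
  shows "ddir v f x = (\<Sum>i\<in>UNIV. v $ i * ddir (axis i 1) f x)"
proof -
  have lin: "linear (\<lambda>v. ddir v f x)"
    using has_derivative_ddir[OF assms] by (rule has_derivative_linear)
  have "ddir v f x = ddir (\<Sum>i\<in>UNIV. v $ i *\<^sub>R axis i 1) f x"
    using basis_expansion[of v] by (simp add: scalar_mult_eq_scaleR)
  also have "\<dots> = (\<Sum>i\<in>UNIV. v $ i * ddir (axis i 1) f x)"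
    by (simp add: linear_sum[OF lin] linear_scale[OF lin])
  finally show ?thesis .
qed

context homogeneous_function
begin

text \<open>
  The expansion of \<open>f \<circ> T u\<close> replaces a family of bounds on all derivatives of \<open>f\<close>: it is inherited by
  derivatives (\<open>symbol_ddir\<close>) and yields the bound itself by compactness (\<open>symbol_bound\<close>).
\<close>

definition symbol :: "(real^'n \<Rightarrow> real) \<Rightarrow> bool" where
  "symbol f \<longleftrightarrow> smooth f \<and>
     (\<exists>F. exp_family F \<and> (\<forall>u x. x \<noteq> 0 \<longrightarrow> f (T u x) = F u x))"

lemma symbolI:
  "smooth f \<Longrightarrow> exp_family F \<Longrightarrow> (\<And>u x. x \<noteq> 0 \<Longrightarrow> f (T u x) = F u x) \<Longrightarrow> symbol f"
  unfolding symbol_def by blast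

lemma symbolE:
  assumes "symbol f"
  obtains F where "smooth f" "exp_family F" "\<And>u x. x \<noteq> 0 \<Longrightarrow> f (T u x) = F u x"
  using assms unfolding symbol_def by blast

lemma symbol_const: "symbol (\<lambda>x. c)"
  by (rule symbolI[OF Cinfinity_on_const exp_family_const]) simp

lemma symbol_add: assumes "symbol f" "symbol g" shows "symbol (\<lambda>x. f x + g x)"
proof -
  obtain F where F: "smooth f" "exp_family F" "\<And>u x. x \<noteq> 0 \<Longrightarrow> f (T u x) = F u x"
    using assms(1) by (rule symbolE) (rule that)
  obtain G where G: "smooth g" "exp_family G" "\<And>u x. x \<noteq> 0 \<Longrightarrow> g (T u x) = G u x"
    using assms(2) by (rule symbolE) (rule that)
  show ?thesis
    by (rule symbolI[OF Cinfinity_on_add[OF open_punctured F(1) G(1)] exp_family_add[OF F(2) G(2)]])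
      (simp add: F(3) G(3))
qed

lemma symbol_mult: assumes "symbol f" "symbol g" shows "symbol (\<lambda>x. f x * g x)"
proof -
  obtain F where F: "smooth f" "exp_family F" "\<And>u x. x \<noteq> 0 \<Longrightarrow> f (T u x) = F u x"
    using assms(1) by (rule symbolE) (rule that)
  obtain G where G: "smooth g" "exp_family G" "\<And>u x. x \<noteq> 0 \<Longrightarrow> g (T u x) = G u x"
    using assms(2) by (rule symbolE) (rule that)
  show ?thesis
    by (rule symbolI[OF Cinfinity_on_mult[OF open_punctured F(1) G(1)] exp_family_mult[OF F(2) G(2)]])
      (simp add: F(3) G(3))
qed

lemma symbol_phi: "symbol \<phi>"
proof (rule symbolI[OF phi_smooth])
  show "exp_family (\<lambda>u x. exp (1 * u) * \<phi> x)"
    by (rule exp_family_term[OF exp_bounded_exp phi_smooth])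
qed (simp add: phi_T)

lemma symbol_inverse_phi: "symbol (\<lambda>x. inverse (\<phi> x))"
proof (rule symbolI)
  show S: "smooth (\<lambda>x. inverse (\<phi> x))"
    using phi_pos by (intro Cinfinity_on_inverse[OF open_punctured _ phi_smooth]) force
  show "exp_family (\<lambda>u x. exp (- 1 * u) * inverse (\<phi> x))"
    by (rule exp_family_term[OF exp_bounded_exp S])
qed (simp add: phi_T exp_minus)

lemma symbol_L: "symbol L"
proof (rule symbolI)
  show S: "smooth L"
    unfolding L_def[abs_def] using phi_pos by (intro Cinfinity_on_ln[OF open_punctured _ phi_smooth]) auto
  show "exp_family (\<lambda>u x. u * 1 + 1 * L x)"
    by (intro exp_family_add exp_family_term exp_bounded_ident exp_bounded_const Cinfinity_on_const S)
qed (simp add: L_T)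

lemma exp_bounded_T_component: "exp_bounded (\<lambda>u. T (- u) v $ i)"
  unfolding exp_bounded_def
proof (intro exI conjI allI)
  show "\<bar>T (- u) v $ i\<bar> \<le> growth_const * norm v * exp (growth * \<bar>u\<bar>)" for u
    using order_trans[OF component_le_norm_cart norm_T_le[of "- u" v]] by (simp add: mult_ac)
qed (use growth_pos growth_const_ge_1 in auto)

lemma T_has_derivative: "(T u has_derivative T u) (at x)"
  using T_linear linear_imp_has_derivative by blast

text \<open>
  By the chain rule the derivative of \<open>f\<close> at \<open>T u x\<close> in direction \<open>v\<close> is that of \<open>f \<circ> T u\<close> at \<open>x\<close> in
  direction \<open>T (- u) v\<close>, whose coordinates are exponentially bounded in \<open>u\<close>.
\<close>

lemma symbol_ddir: assumes "symbol f" shows "symbol (ddir v f)"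
proof -
  obtain F where F: "smooth f" "exp_family F" "\<And>u x. x \<noteq> 0 \<Longrightarrow> f (T u x) = F u x"
    using assms by (rule symbolE) (rule that)
  obtain F' where F': "\<And>i. exp_family (F' i)"
    "\<And>i u x. x \<noteq> 0 \<Longrightarrow> F u differentiable (at x)"
    "\<And>i u x. x \<noteq> 0 \<Longrightarrow> ddir (axis i 1) (F u) x = F' i u x"
    using exp_family_ddir[OF F(2), of "axis _ 1"] by metis
  show ?thesis
  proof (rule symbolI[OF Cinfinity_on_ddir[OF F(1)]])
    show "exp_family (\<lambda>u x. \<Sum>i\<in>UNIV. T (- u) v $ i * F' i u x)"
      by (intro exp_family_sum exp_family_scale[OF exp_bounded_T_component F'(1)])
    fix u x assume x: "x \<noteq> (0 :: real^'n)"
    have "f differentiable (at (T u x))"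
      using x by (intro Cinfinity_on_differentiable[OF F(1)]) simp
    then have "((\<lambda>y. f (T u y)) has_derivative (\<lambda>w. ddir (T u w) f (T u x))) (at x)"
      using has_derivative_compose[OF T_has_derivative has_derivative_ddir] by blast
    then have "(F u has_derivative (\<lambda>w. ddir (T u w) f (T u x))) (at x)"
      by (rule has_derivative_transform_within_open[OF _ open_punctured]) (use x F(3) in auto)
    from ddir_eqI[OF this, of "T (- u) v"]
    have "ddir v f (T u x) = ddir (T (- u) v) (F u) x" by simp
    also have "\<dots> = (\<Sum>i\<in>UNIV. T (- u) v $ i * F' i u x)"
      by (simp add: ddir_expand[OF F'(2)[OF x], of "T (- u) v"] F'(3)[OF x])
    finally show "ddir v f (T u x) = (\<Sum>i\<in>UNIV. T (- u) v $ i * F' i u x)" .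
  qed
qed

text \<open>
  Every nonzero point is carried to the compact level set \<open>\<phi> = 1\<close> by the flow in time \<open>- L x\<close>.
\<close>

lemma symbol_bound:
  assumes "symbol f"
  obtains C m where "0 \<le> C" "0 \<le> m" "\<And>x. x \<noteq> 0 \<Longrightarrow> \<bar>f x\<bar> \<le> C * exp (m * \<bar>L x\<bar>)"
proof -
  obtain F where F: "smooth f" "exp_family F" "\<And>u x. x \<noteq> 0 \<Longrightarrow> f (T u x) = F u x"
    using assms by (rule symbolE) (rule that)
  have "0 \<notin> {x. \<phi> x = 1}" by simp
  from exp_family_bound[OF F(2) compact_level_set this]
  obtain C m where b: "0 \<le> C" "0 \<le> m" "\<And>u x. \<phi> x = 1 \<Longrightarrow> \<bar>F u x\<bar> \<le> C * exp (m * \<bar>u\<bar>)" by blast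
  show ?thesis
  proof (rule that[OF b(1,2)])
    fix x assume x: "x \<noteq> (0 :: real^'n)"
    have "\<phi> (T (- L x) x) = 1"
      using phi_pos[OF x] by (simp add: phi_T exp_minus exp_L[OF x])
    from b(3)[OF this, of "L x"] show "\<bar>f x\<bar> \<le> C * exp (m * \<bar>L x\<bar>)"
      using F(3)[of "T (- L x) x" "L x"] x by simp
  qed
qed

end

section \<open>Gaussian tails\<close>

definition gauss_tail :: "real \<Rightarrow> real" where
  "gauss_tail v = (LINT w|lborel. indicator {v<..} w * std_normal_density w)"

lemma gauss_times_exp:
  "std_normal_density w * exp (k * w) = exp (k\<^sup>2 / 2) * normal_density k 1 w"
  by (simp add: normal_density_def exp_add[symmetric] power2_eq_square field_simps)

lemma gauss_exp_integrable: "integrable lborel (\<lambda>w. std_normal_density w * exp (k * w))"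
  unfolding gauss_times_exp by simp

lemma gauss_exp_integral: "(LINT w|lborel. std_normal_density w * exp (k * w)) = exp (k\<^sup>2 / 2)"
  unfolding gauss_times_exp by simp

lemma gauss_indicator_integrable [simp]:
  "S \<in> sets borel \<Longrightarrow> integrable lborel (\<lambda>w. indicator S w * std_normal_density w)"
  using integrable_real_mult_indicator[of S lborel std_normal_density] by (simp add: mult.commute)

lemma gauss_tail_nonneg: "0 \<le> gauss_tail v"
  unfolding gauss_tail_def by (rule Bochner_Integration.integral_nonneg) simp

lemma gauss_tail_complement:
  "1 - gauss_tail v = (LINT w|lborel. indicator {..v} w * std_normal_density w)"
proof -
  have "(LINT w|lborel. indicator {..v} w * std_normal_density w) + gauss_tail v
      = (LINT w|lborel. indicator {..v} w * std_normal_density w + indicator {v<..} w * std_normal_density w)"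
    unfolding gauss_tail_def by (rule Bochner_Integration.integral_add[symmetric]) auto
  also have "(\<lambda>w. indicator {..v} w * std_normal_density w + indicator {v<..} w * std_normal_density w)
      = std_normal_density"
    by (auto simp: fun_eq_iff indicator_def)
  finally show ?thesis by simp
qed

lemma gauss_tail_le_1: "gauss_tail v \<le> 1"
proof -
  have "0 \<le> 1 - gauss_tail v" unfolding gauss_tail_complement by (rule Bochner_Integration.integral_nonneg) simp
  then show ?thesis by simp
qed

text \<open>
  The Chernoff bound: compare the indicator of \<open>w > v\<close> with \<open>exp (k (w - v))\<close>.
\<close>

lemma gauss_tail_le_exp: "0 \<le> k \<Longrightarrow> gauss_tail v \<le> exp (k\<^sup>2 / 2) * exp (- k * v)"
proof -
  assume k: "0 \<le> k"
  have "gauss_tail v \<le> (LINT w|lborel. exp (- k * v) * (std_normal_density w * exp (k * w)))"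
    unfolding gauss_tail_def
  proof (rule integral_mono)
    fix w :: real
    have "1 * std_normal_density w \<le> exp (k * (w - v)) * std_normal_density w" if "v < w"
      using that k by (intro mult_right_mono) auto
    then show "indicator {v<..} w * std_normal_density w \<le> exp (- k * v) * (std_normal_density w * exp (k * w))"
      by (auto simp: indicator_def exp_add[symmetric] exp_diff exp_minus field_simps)
  qed (simp_all add: gauss_exp_integrable)
  also have "\<dots> = exp (k\<^sup>2 / 2) * exp (- k * v)" by (simp add: gauss_exp_integral)
  finally show ?thesis .
qed

lemma gauss_tail_ge_exp: "0 \<le> k \<Longrightarrow> 1 - gauss_tail v \<le> exp (k\<^sup>2 / 2) * exp (k * v)"
proof -
  assume k: "0 \<le> k"
  have "1 - gauss_tail v \<le> (LINT w|lborel. exp (k * v) * (std_normal_density w * exp ((- k) * w)))"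
    unfolding gauss_tail_complement
  proof (rule integral_mono)
    fix w :: real
    have "1 * std_normal_density w \<le> exp (k * (v - w)) * std_normal_density w" if "w \<le> v"
      using that k by (intro mult_right_mono) auto
    then show "indicator {..v} w * std_normal_density w \<le> exp (k * v) * (std_normal_density w * exp ((- k) * w))"
      by (auto simp: indicator_def exp_add[symmetric] exp_diff exp_minus field_simps)
  qed (use gauss_exp_integrable[of "- k"] in simp_all)
  also have "\<dots> = exp (k\<^sup>2 / 2) * exp (k * v)" using gauss_exp_integral[of "- k"] by simp
  finally show ?thesis .
qed

lemma gauss_le_exp: "std_normal_density v \<le> exp (k\<^sup>2 / 2) * exp (- k * \<bar>v\<bar>)"
proof -
  have "2 * (k * \<bar>v\<bar>) \<le> k\<^sup>2 + v\<^sup>2"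
    using sum_squares_bound[of k "\<bar>v\<bar>"] by simp
  then have 1: "exp (- v\<^sup>2 / 2) \<le> exp (k\<^sup>2 / 2) * exp (- k * \<bar>v\<bar>)"
    by (simp add: exp_add[symmetric])
  have "1 \<le> sqrt (2 * pi)" using pi_ge_two by simp
  then have "1 / sqrt (2 * pi) * exp (- v\<^sup>2 / 2) \<le> 1 * exp (- v\<^sup>2 / 2)"
    by (intro mult_right_mono) auto
  then show ?thesis using 1 by (simp add: std_normal_density_def)
qed

lemma gauss_has_derivative:
  "(std_normal_density has_real_derivative - v * std_normal_density v) (at v)"
  unfolding std_normal_density_def[abs_def] by (auto intro!: derivative_eq_intros simp: field_simps)

lemma gauss_tail_has_derivative:
  "(gauss_tail has_real_derivative - std_normal_density v) (at v)"
proof -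
  \<comment> \<open>On a bounded interval the tail is a constant minus a primitive of the density.\<close>
  define a b where "a = v - 1" and "b = v + 1"
  have eq: "gauss_tail t = gauss_tail a - integral {a..t} std_normal_density" if "a \<le> t" for t
  proof -
    have "gauss_tail a = (LINT w|lborel. indicator {a<..t} w * std_normal_density w + indicator {t<..} w * std_normal_density w)"
      unfolding gauss_tail_def
      by (rule Bochner_Integration.integral_cong) (use that in \<open>auto simp: indicator_def\<close>)
    also have "\<dots> = (LINT w|lborel. indicator {a<..t} w * std_normal_density w) + gauss_tail t"
      unfolding gauss_tail_def by (rule Bochner_Integration.integral_add) auto
    also have "(LINT w|lborel. indicator {a<..t} w * std_normal_density w)
        = (LINT w|lborel. indicator {a..t} w * std_normal_density w)"
      by (rule integral_cong_AE, simp, simp)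
        (rule AE_mp[OF AE_lborel_singleton[of a]], auto simp: indicator_def)
    also have "\<dots> = integral {a..t} std_normal_density"
      using set_borel_integral_eq_integral(2)[of "{a..t}" std_normal_density]
        gauss_indicator_integrable[of "{a..t}"]
      by (simp add: set_integrable_def set_lebesgue_integral_def)
    finally show ?thesis by simp
  qed
  have "continuous_on {a..b} std_normal_density"
    unfolding normal_density_def[abs_def] by (auto intro!: continuous_intros)
  then have "((\<lambda>t. integral {a..t} std_normal_density) has_real_derivative std_normal_density v) (at v within {a..b})"
    by (rule integral_has_real_derivative) (auto simp: a_def b_def)
  then have "((\<lambda>t. integral {a..t} std_normal_density) has_real_derivative std_normal_density v) (at v)"
    by (simp add: at_within_Icc_at a_def b_def)
  then have "((\<lambda>t. gauss_tail a - integral {a..t} std_normal_density) has_real_derivative - std_normal_density v) (at v)"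
    by (auto intro!: derivative_eq_intros)
  then show ?thesis
    by (rule has_field_derivative_transform_within_open[of _ _ _ "{a<..}"])
      (auto simp: a_def[symmetric] eq[symmetric], simp add: a_def)
qed

lemma gauss_tail_continuous: "continuous_on UNIV gauss_tail"
  by (intro continuous_at_imp_continuous_on ballI DERIV_isCont[OF gauss_tail_has_derivative])

lemma gauss_tail_measurable [measurable]: "gauss_tail \<in> borel_measurable borel"
  by (rule borel_measurable_continuous_onI[OF gauss_tail_continuous])

lemma half_line_exp_integrable:
  fixes c :: real
  assumes "0 < c"
  shows "integrable lborel (\<lambda>u. indicator {0..} u * exp (- c * u))"
proof (rule integrableI_nonneg)
  have lim: "((\<lambda>u. - exp (- c * u) / c) \<longlongrightarrow> - 0 / c) at_top"
    using assms by real_asymp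
  have "(\<integral>\<^sup>+u. ennreal (exp (- c * u)) * indicator {0..} u \<partial>lborel) = - 0 / c - (- exp (- c * 0) / c)"
    using assms by (intro nn_integral_FTC_atLeast[OF _ _ _ lim])
      (auto intro!: derivative_eq_intros)
  moreover have "(\<integral>\<^sup>+u. ennreal (indicator {0..} u * exp (- c * u)) \<partial>lborel)
      = (\<integral>\<^sup>+u. ennreal (exp (- c * u)) * indicator {0..} u \<partial>lborel)"
    by (rule nn_integral_cong) (auto simp: indicator_def)
  ultimately show "(\<integral>\<^sup>+u. ennreal (indicator {0..} u * exp (- c * u)) \<partial>lborel) < \<infinity>"
    by simp
qed auto

lemma exp_abs_integrable:
  fixes c :: real
  assumes "0 < c"
  shows "integrable lborel (\<lambda>u. exp (- c * \<bar>u\<bar>))"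
proof -
  have 1: "integrable lborel (\<lambda>u. indicator {0..} u * exp (- c * u))"
    by (rule half_line_exp_integrable[OF assms])
  have 2: "integrable lborel (\<lambda>u. indicator {0..} (- u) * exp (- c * (- u)))"
    using lborel_integrable_real_affine[OF 1, of "- 1" 0] by simp
  show ?thesis
    by (rule Bochner_Integration.integrable_bound[OF Bochner_Integration.integrable_add[OF 1 2]])
      (auto simp: indicator_def)
qed

lemma integrable_of_exp_decay:
  fixes f :: "real \<Rightarrow> complex"
  assumes "f \<in> borel_measurable borel" "0 < c" "\<And>u. norm (f u) \<le> C * exp (- c * \<bar>u\<bar>)"
  shows "integrable lborel f"
proof (rule Bochner_Integration.integrable_bound)
  show "integrable lborel (\<lambda>u. C * exp (- c * \<bar>u\<bar>))"
    by (intro integrable_mult_right exp_abs_integrable assms)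
  show "AE u in lborel. norm (f u) \<le> norm (C * exp (- c * \<bar>u\<bar>))"
    by (intro AE_I2 order_trans[OF assms(3)]) simp
qed (use assms in simp)

lemma tendsto_exp_linear_at_top: "0 < c \<Longrightarrow> ((\<lambda>u::real. C * exp (- c * u)) \<longlongrightarrow> 0) at_top"
  by real_asymp

lemma tendsto_exp_linear_at_bot: "0 < c \<Longrightarrow> ((\<lambda>u::real. C * exp (c * u)) \<longlongrightarrow> 0) at_bot"
  by real_asymp

lemma has_vector_derivative_exp_mult:
  "((\<lambda>u::real. exp (z * complex_of_real u)) has_vector_derivative z * exp (z * complex_of_real u)) (at u)"
proof -
  have "((\<lambda>w. exp (z * w)) has_field_derivative z * exp (z * complex_of_real u)) (at (complex_of_real u))"
    by (auto intro!: derivative_eq_intros)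
  from has_vector_derivative_real_field[OF this] show ?thesis by (simp add: o_def)
qed

lemma half_line_complex_exp:
  assumes "0 < Re z"
  shows "has_bochner_integral lborel (\<lambda>u. indicator {0..} u *\<^sub>R exp (- z * complex_of_real u)) (1 / z)"
proof -
  have z: "z \<noteq> 0" using assms by auto
  have int: "integrable lborel (\<lambda>u. indicator {0..} u *\<^sub>R exp (- z * complex_of_real u))"
  proof (rule Bochner_Integration.integrable_bound[OF half_line_exp_integrable[OF assms]])
    show "AE u in lborel. norm (indicator {0..} u *\<^sub>R exp (- z * complex_of_real u))
      \<le> norm (indicator {0..} u * exp (- Re z * u))"
      by (intro AE_I2) (auto simp: indicator_def)
  qed measurable
  have ae: "AE u in lborel. indicator {0..} u *\<^sub>R exp (- z * complex_of_real u)
      = indicator {0<..} u *\<^sub>R exp (- z * complex_of_real u)"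
    by (rule AE_mp[OF AE_lborel_singleton[of 0]]) (auto simp: indicator_def)
  have "integrable lborel (\<lambda>u. indicator {0<..} u *\<^sub>R exp (- z * complex_of_real u))"
    using integrable_cong_AE[OF _ _ ae] int by simp
  then have si: "set_integrable lborel (einterval 0 \<infinity>) (\<lambda>u. exp (- z * complex_of_real u))"
    by (simp add: set_integrable_def zero_ereal_def)
  have "(LBINT u=0..\<infinity>. exp (- z * complex_of_real u)) = 0 - (- 1 / z)"
  proof (rule interval_integral_FTC_integrable[where F = "\<lambda>u. - exp (- z * complex_of_real u) / z"])
    show "((\<lambda>u. - exp (- z * complex_of_real u) / z) has_vector_derivative exp (- z * complex_of_real u)) (at u)" for u
      using has_vector_derivative_mult_right[OF has_vector_derivative_exp_mult[of "- z" u], of "- 1 / z"] z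
      by simp
    show "isCont (\<lambda>u. exp (- z * complex_of_real u)) u" for u by (intro continuous_intros)
    have "((\<lambda>u. - exp (- z * complex_of_real u) / z) \<longlongrightarrow> - exp (- z * complex_of_real 0) / z) (at_right 0)"
      by (intro tendsto_intros z)
    then show "(((\<lambda>u. - exp (- z * complex_of_real u) / z) \<circ> real_of_ereal) \<longlongrightarrow> - 1 / z) (at_right 0)"
      unfolding zero_ereal_def ereal_tendsto_simps1 by simp
    have "((\<lambda>u. norm (- exp (- z * complex_of_real u) / z)) \<longlongrightarrow> 0) at_top"
      using tendsto_exp_linear_at_top[OF assms, of "1 / norm z"] by (simp add: norm_divide)
    then have "((\<lambda>u. - exp (- z * complex_of_real u) / z) \<longlongrightarrow> 0) at_top"
      by (rule tendsto_norm_zero_cancel)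
    then show "(((\<lambda>u. - exp (- z * complex_of_real u) / z) \<circ> real_of_ereal) \<longlongrightarrow> 0) (at_left \<infinity>)"
      by (simp add: ereal_tendsto_simps1)
  qed (use si in auto)
  then have "(LINT u|lborel. indicator {0<..} u *\<^sub>R exp (- z * complex_of_real u)) = 1 / z"
    by (simp add: interval_lebesgue_integral_def set_lebesgue_integral_def zero_ereal_def)
  moreover have "(LINT u|lborel. indicator {0..} u *\<^sub>R exp (- z * complex_of_real u))
     = (LINT u|lborel. indicator {0<..} u *\<^sub>R exp (- z * complex_of_real u))"
    by (rule integral_cong_AE[OF _ _ ae]) auto
  ultimately show ?thesis using int by (simp add: has_bochner_integral_iff)
qed

lemma has_bochner_integral_lborel_shift:
  fixes f :: "real \<Rightarrow> complex"
  assumes "has_bochner_integral lborel f x"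
  shows "has_bochner_integral lborel (\<lambda>u. f (t + u)) x"
  using lborel_has_bochner_integral_real_affine_iff[of 1 f x t] assms by simp

text \<open>
  The moment generating function at a complex argument: translating by the real part of \<open>s\<close> reduces it to the
  characteristic function.
\<close>

lemma gauss_complex_exp:
  "has_bochner_integral lborel (\<lambda>u. of_real (std_normal_density u) * exp (- s * complex_of_real u)) (exp (s\<^sup>2 / 2))"
proof -
  define \<sigma> \<tau> where "\<sigma> = Re s" and "\<tau> = Im s"
  have s: "s = of_real \<sigma> + \<i> * of_real \<tau>" by (simp add: \<sigma>_def \<tau>_def complex_eq_iff)
  have int: "integrable lborel (\<lambda>u. of_real (std_normal_density u) * iexp (- \<tau> * u))"
    by (rule Bochner_Integration.integrable_bound[OF integrable_normal_density[of 1 0]])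
      (auto simp: norm_mult)
  have "(LINT u|lborel. of_real (std_normal_density u) * iexp (- \<tau> * u)) = char std_normal_distribution (- \<tau>)"
    unfolding char_def by (subst integral_density) (auto simp: scaleR_conv_of_real)
  also have "\<dots> = of_real (exp (- \<tau>\<^sup>2 / 2))" by (simp add: char_std_normal_distribution)
  finally have "has_bochner_integral lborel (\<lambda>u. of_real (std_normal_density u) * iexp (- \<tau> * u))
     (of_real (exp (- \<tau>\<^sup>2 / 2)))"
    using int by (simp add: has_bochner_integral_iff)
  then have "has_bochner_integral lborel (\<lambda>u. of_real (std_normal_density (\<sigma> + u)) * iexp (- \<tau> * (\<sigma> + u)))
     (of_real (exp (- \<tau>\<^sup>2 / 2)))"
    by (rule has_bochner_integral_lborel_shift)
  then have "has_bochner_integral lborel (\<lambda>u. exp (of_real (\<sigma>\<^sup>2 / 2) + \<i> * of_real (\<tau> * \<sigma>)) *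
       (of_real (std_normal_density (\<sigma> + u)) * iexp (- \<tau> * (\<sigma> + u))))
     (exp (of_real (\<sigma>\<^sup>2 / 2) + \<i> * of_real (\<tau> * \<sigma>)) * of_real (exp (- \<tau>\<^sup>2 / 2)))"
    by (rule has_bochner_integral_mult_right)
  moreover have "exp (of_real (\<sigma>\<^sup>2 / 2) + \<i> * of_real (\<tau> * \<sigma>)) *
       (of_real (std_normal_density (\<sigma> + u)) * iexp (- \<tau> * (\<sigma> + u)))
     = of_real (std_normal_density u) * exp (- s * complex_of_real u)" for u
  proof -
    have "std_normal_density (\<sigma> + u) = std_normal_density u * exp (- \<sigma>\<^sup>2 / 2 - \<sigma> * u)"
      by (simp add: std_normal_density_def exp_add[symmetric] power2_eq_square field_simps)
    then have "exp (of_real (\<sigma>\<^sup>2 / 2) + \<i> * of_real (\<tau> * \<sigma>)) *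
         (of_real (std_normal_density (\<sigma> + u)) * iexp (- \<tau> * (\<sigma> + u)))
       = of_real (std_normal_density u) * exp (of_real (\<sigma>\<^sup>2 / 2) + \<i> * of_real (\<tau> * \<sigma>)
           + of_real (- \<sigma>\<^sup>2 / 2 - \<sigma> * u) + \<i> * of_real (- \<tau> * (\<sigma> + u)))"
      by (simp only: of_real_mult exp_of_real[symmetric] exp_add mult_ac)
    also have "of_real (\<sigma>\<^sup>2 / 2) + \<i> * of_real (\<tau> * \<sigma>)
           + of_real (- \<sigma>\<^sup>2 / 2 - \<sigma> * u) + \<i> * of_real (- \<tau> * (\<sigma> + u)) = - s * of_real u"
      by (simp add: s complex_eq_iff algebra_simps)
    finally show ?thesis .
  qed
  moreover have "exp (of_real (\<sigma>\<^sup>2 / 2) + \<i> * of_real (\<tau> * \<sigma>)) * of_real (exp (- \<tau>\<^sup>2 / 2)) = exp (s\<^sup>2 / 2)"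
  proof -
    have "of_real (\<sigma>\<^sup>2 / 2) + \<i> * of_real (\<tau> * \<sigma>) + of_real (- \<tau>\<^sup>2 / 2) = s\<^sup>2 / 2"
      by (simp add: s complex_eq_iff power2_eq_square algebra_simps diff_divide_distrib)
    then show ?thesis by (simp only: exp_of_real[symmetric] exp_add[symmetric])
  qed
  ultimately show ?thesis by simp
qed

text \<open>
  Integration by parts against the derivative of the tail turns the transform into the moment generating function
  divided by \<open>s\<close>.  The condition on \<open>Re s\<close> makes the boundary term at \<open>\<infinity>\<close> vanish.
\<close>

lemma gauss_tail_laplace:
  assumes s: "0 < Re s"
  shows "has_bochner_integral lborel (\<lambda>u. of_real (gauss_tail (l - u)) * exp (- s * complex_of_real u))
    (exp (- s * of_real l) * (exp (s\<^sup>2 / 2) / s))"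
proof -
  define F where "F u = of_real (gauss_tail (- u)) * exp (- s * complex_of_real u)" for u
  have s0: "s \<noteq> 0" using s by auto
  define C where "C = exp ((Re s + 1)\<^sup>2 / 2) + 1"
  define c where "c = min (Re s) 1"
  have Fpos: "norm (F u) \<le> exp (- Re s * u)" for u
    using gauss_tail_le_1[of "- u"] gauss_tail_nonneg[of "- u"] by (simp add: F_def norm_mult mult_left_le_one_le)
  have Fneg: "norm (F u) \<le> exp ((Re s + 1)\<^sup>2 / 2) * exp u" for u
  proof -
    have "norm (F u) \<le> (exp ((Re s + 1)\<^sup>2 / 2) * exp (- (Re s + 1) * (- u))) * exp (- Re s * u)"
      unfolding F_def using gauss_tail_le_exp[of "Re s + 1" "- u"] s gauss_tail_nonneg[of "- u"]
      by (auto simp: norm_mult intro!: mult_right_mono)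
    also have "\<dots> = exp ((Re s + 1)\<^sup>2 / 2) * exp u"
      by (simp only: mult.assoc exp_add[symmetric]) (simp add: algebra_simps)
    finally show ?thesis .
  qed
  have bound: "norm (F u) \<le> C * exp (- c * \<bar>u\<bar>)" for u
  proof (cases "0 \<le> u")
    case True
    have "norm (F u) \<le> exp (- Re s * u)" by (rule Fpos)
    also have "\<dots> \<le> exp (- c * \<bar>u\<bar>)" using True by (auto simp: c_def intro!: mult_right_mono)
    also have "\<dots> \<le> C * exp (- c * \<bar>u\<bar>)" by (simp add: C_def)
    finally show ?thesis .
  next
    case False
    have "norm (F u) \<le> exp ((Re s + 1)\<^sup>2 / 2) * exp u" by (rule Fneg)
    also have "\<dots> \<le> C * exp (- c * \<bar>u\<bar>)"
      using False by (intro mult_mono) (auto simp: c_def C_def min_mult_distrib_right mult_left_le)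
    finally show ?thesis .
  qed
  have meas: "F \<in> borel_measurable borel"
    unfolding F_def by measurable
  have intF: "integrable lborel F"
    by (rule integrable_of_exp_decay[OF meas _ bound]) (use s in \<open>simp add: c_def\<close>)
  define G where "G u = of_real (std_normal_density u) * exp (- s * complex_of_real u)" for u
  have G: "has_bochner_integral lborel G (exp (s\<^sup>2 / 2))"
    using gauss_complex_exp[of s] unfolding G_def .
  have intH: "integrable lborel (\<lambda>u. G u - s * F u)"
    using G intF by (auto simp: has_bochner_integral_iff)
  have "(LBINT u=-\<infinity>..\<infinity>. G u - s * F u) = 0 - 0"
  proof (rule interval_integral_FTC_integrable[where F = F])
    fix u :: real
    have D: "((\<lambda>u. gauss_tail (- u)) has_real_derivative std_normal_density u) (at u)"
      using DERIV_chain2[where f = gauss_tail and g = uminus and x = u and Db = "- 1", OF gauss_tail_has_derivative]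
        DERIV_minus[OF DERIV_ident[of "at u"]]
      by (simp add: std_normal_density_def)
    from D have 1: "((\<lambda>u. complex_of_real (gauss_tail (- u))) has_vector_derivative of_real (std_normal_density u)) (at u)"
      by (intro has_vector_derivative_of_real) (simp add: has_real_derivative_iff_has_vector_derivative)
    from has_vector_derivative_mult[OF 1 has_vector_derivative_exp_mult[of "- s" u]]
    show "(F has_vector_derivative G u - s * F u) (at u)"
      unfolding F_def[abs_def] G_def by (simp add: algebra_simps)
    have "isCont std_normal_density u" using gauss_has_derivative DERIV_isCont by blast
    moreover have "isCont (\<lambda>u. gauss_tail (- u)) u"
      using D by (rule DERIV_isCont)
    ultimately show "isCont (\<lambda>u. G u - s * F u) u"
      unfolding F_def G_def by (intro continuous_intros) auto
  next
    show "set_integrable lborel (einterval (- \<infinity>) \<infinity>) (\<lambda>u. G u - s * F u)"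
      using intH by (simp add: set_integrable_def)
    have "(F \<longlongrightarrow> 0) at_top"
      by (rule tendsto_norm_zero_cancel, rule tendsto_sandwich[OF _ _ tendsto_const tendsto_exp_linear_at_top[OF s, of 1]])
        (use Fpos in \<open>auto intro!: always_eventually\<close>)
    then show "((F \<circ> real_of_ereal) \<longlongrightarrow> 0) (at_left \<infinity>)"
      by (simp add: ereal_tendsto_simps1)
    have "(F \<longlongrightarrow> 0) at_bot"
      by (rule tendsto_norm_zero_cancel, rule tendsto_sandwich[OF _ _ tendsto_const
            tendsto_exp_linear_at_bot[of 1 "exp ((Re s + 1)\<^sup>2 / 2)"]])
        (use Fneg in \<open>auto intro!: always_eventually\<close>)
    then show "((F \<circ> real_of_ereal) \<longlongrightarrow> 0) (at_right (- \<infinity>))"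
      by (simp add: ereal_tendsto_simps1)
  qed auto
  then have "(LINT u|lborel. G u - s * F u) = 0"
    by (simp add: interval_lebesgue_integral_def set_lebesgue_integral_def)
  then have "s * (LINT u|lborel. F u) = exp (s\<^sup>2 / 2)"
    using G intF by (simp add: has_bochner_integral_iff)
  then have hb: "has_bochner_integral lborel F (exp (s\<^sup>2 / 2) / s)"
    using intF s0 by (simp add: has_bochner_integral_iff field_simps)
  then have "has_bochner_integral lborel (\<lambda>u. F (- l + u)) (exp (s\<^sup>2 / 2) / s)"
    by (rule has_bochner_integral_lborel_shift)
  then have "has_bochner_integral lborel (\<lambda>u. exp (- s * of_real l) * F (- l + u))
      (exp (- s * of_real l) * (exp (s\<^sup>2 / 2) / s))"
    by (rule has_bochner_integral_mult_right)
  moreover have "exp (- s * of_real l) * F (- l + u)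
      = of_real (gauss_tail (l - u)) * exp (- s * complex_of_real u)" for u
    by (simp add: F_def exp_add[symmetric] algebra_simps)
  ultimately show ?thesis by simp
qed

section \<open>Periodization over the integer lattice\<close>

lemma countable_int_lattice: "countable (int_lattice :: (real^'n) set)"
proof -
  have "(int_lattice :: (real^'n) set) \<subseteq> range (\<lambda>f :: 'n \<Rightarrow> int. \<chi> i. of_int (f i))"
  proof
    fix \<omega> :: "real^'n" assume "\<omega> \<in> int_lattice"
    then have "\<forall>i. \<exists>k::int. \<omega> $ i = of_int k" by (auto simp: int_lattice_def elim!: Ints_cases)
    then obtain f :: "'n \<Rightarrow> int" where "\<And>i. \<omega> $ i = of_int (f i)" by metis
    then have "\<omega> = (\<chi> i. of_int (f i))" by (simp add: vec_eq_iff)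
    then show "\<omega> \<in> range (\<lambda>f :: 'n \<Rightarrow> int. \<chi> i. of_int (f i))" by blast
  qed
  then show ?thesis by (rule countable_subset) simp
qed

lemma infinite_int_lattice: "infinite (int_lattice :: (real^'n) set)"
proof
  assume fin: "finite (int_lattice :: (real^'n) set)"
  have "range (\<lambda>k::nat. real k *\<^sub>R (axis undefined 1 :: real^'n)) \<subseteq> int_lattice"
    by (auto simp: int_lattice_def axis_def)
  moreover have "inj (\<lambda>k::nat. real k *\<^sub>R (axis undefined 1 :: real^'n))"
    by (auto simp: inj_on_def axis_eq_0_iff)
  ultimately show False
    using fin finite_subset range_inj_infinite by blast
qed

lemma int_lattice_add: "\<omega> \<in> int_lattice \<Longrightarrow> \<omega>' \<in> int_lattice \<Longrightarrow> \<omega> + \<omega>' \<in> int_lattice"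
  by (simp add: int_lattice_def)

lemma zero_in_int_lattice: "0 \<in> int_lattice"
  by (simp add: int_lattice_def)

lemma axis_in_int_lattice: "axis i 1 \<in> int_lattice"
  by (simp add: int_lattice_def axis_def)

lemma norm_int_lattice_ge_1:
  assumes "\<omega> \<in> int_lattice" "\<omega> \<noteq> 0"
  shows "1 \<le> norm \<omega>"
proof -
  obtain i where i: "\<omega> $ i \<noteq> 0" using assms(2) by (auto simp: vec_eq_iff)
  have "\<omega> $ i \<in> \<int>" using assms(1) by (simp add: int_lattice_def)
  then have "1 \<le> \<bar>\<omega> $ i\<bar>" using i Ints_nonzero_abs_ge1 by blast
  then show ?thesis using component_le_norm_cart[of \<omega> i] by linarith
qed

text \<open>
  The exponent \<open>2 n\<close> makes the weight at most the product over the coordinates of \<open>1 / (1 + \<bar>x\<^sub>i\<bar>)\<^sup>2\<close>, so that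
  its sum over the lattice factors into one-dimensional sums.
\<close>

definition decay_weight :: "real^'n \<Rightarrow> real" where
  "decay_weight x = 1 / (1 + norm x) ^ (2 * CARD('n))"

lemma decay_weight_pos: "0 < decay_weight x"
proof -
  have "0 < 1 + norm x" using norm_ge_zero[of x] by linarith
  then show ?thesis by (simp add: decay_weight_def)
qed

lemma sum_inverse_squares_bound:
  assumes "finite J" "J \<subseteq> \<int>"
  shows "(\<Sum>m\<in>J. 1 / (1 + \<bar>m\<bar>)\<^sup>2) \<le> 2 * (\<Sum>k. 1 / (1 + real k)\<^sup>2)"
proof -
  define h :: "nat \<Rightarrow> real" where "h k = 1 / (1 + real k)\<^sup>2" for k
  have summ: "summable h"
    using inverse_power_summable[of 2, where 'a = real] summable_Suc_iff[of "\<lambda>k. 1 / (real k)\<^sup>2"]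
    by (simp add: h_def[abs_def] inverse_eq_divide add.commute)
  have part: "(\<Sum>m\<in>K. 1 / (1 + \<bar>m\<bar>)\<^sup>2) \<le> suminf h"
    if K: "K \<subseteq> J" and inj: "inj_on abs K" for K
  proof -
    have fin: "finite K" using K assms(1) finite_subset by blast
    define q where "q m = nat \<lfloor>\<bar>m\<bar>\<rfloor>" for m :: real
    have q: "real (q m) = \<bar>m\<bar>" if "m \<in> K" for m
    proof -
      have "m \<in> \<int>" using that K assms(2) by blast
      then show ?thesis by (auto simp: q_def elim!: Ints_cases)
    qed
    have "inj_on q K"
      using inj q unfolding inj_on_def by metis
    then have "(\<Sum>m\<in>K. h (q m)) = (\<Sum>k\<in>q ` K. h k)"
      by (simp add: sum.reindex)
    also have "\<dots> \<le> suminf h"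
      by (intro sum_le_suminf summ) (auto simp: fin h_def)
    finally show ?thesis by (simp add: h_def q)
  qed
  have "(\<Sum>m\<in>J. 1 / (1 + \<bar>m\<bar>)\<^sup>2)
      = (\<Sum>m\<in>J \<inter> {0..}. 1 / (1 + \<bar>m\<bar>)\<^sup>2) + (\<Sum>m\<in>J \<inter> {..<0}. 1 / (1 + \<bar>m\<bar>)\<^sup>2)"
    using assms(1) by (subst sum.union_disjoint[symmetric]) (auto intro!: sum.cong)
  also have "\<dots> \<le> suminf h + suminf h"
    by (intro add_mono part) (auto simp: inj_on_def)
  finally show ?thesis by (simp add: h_def[abs_def])
qed

lemma decay_const_nonneg:
  assumes "\<And>x :: real^'n. \<bar>g x\<bar> \<le> C * decay_weight x"
  shows "0 \<le> C"
  using order_trans[OF abs_ge_zero assms[of 0]] decay_weight_pos[of "0 :: real^'n"]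
  by (simp add: zero_le_mult_iff)

lemma decay_weight_leI:
  assumes "(1 + norm (y :: real^'n)) ^ (2 * CARD('n)) \<le> c * (1 + norm (x :: real^'n)) ^ (2 * CARD('n))"
  shows "decay_weight x \<le> c * decay_weight y"
proof -
  have pos: "0 < 1 + norm x" "0 < 1 + norm y"
    using norm_ge_zero[of x] norm_ge_zero[of y] by linarith+
  have "1 / b \<le> c * (1 / a)" if "a \<le> c * b" "0 < a" "0 < b" for a b c :: real
    using that by (simp add: field_simps)
  from this[OF assms] show ?thesis using pos by (simp add: decay_weight_def)
qed

lemma summable_decay_weight: "(decay_weight :: real^'n \<Rightarrow> real) summable_on int_lattice"
proof (rule nonneg_bdd_above_summable_on)
  show "0 \<le> decay_weight x" for x :: "real^'n" using decay_weight_pos[of x] by simp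
  define W where "W = 2 * (\<Sum>k. 1 / (1 + real k)\<^sup>2)"
  show "bdd_above (sum decay_weight ` {F. F \<subseteq> (int_lattice :: (real^'n) set) \<and> finite F})"
  proof (rule bdd_aboveI2)
    fix F :: "(real^'n) set" assume "F \<in> {F. F \<subseteq> int_lattice \<and> finite F}"
    then have F: "F \<subseteq> int_lattice" "finite F" by auto
    define J where "J = (\<Union>i. (\<lambda>\<omega>. \<omega> $ i) ` F)"
    have J: "finite J" "J \<subseteq> \<int>" using F by (auto simp: J_def int_lattice_def)
    define w :: "real \<Rightarrow> real" where "w m = 1 / (1 + \<bar>m\<bar>)\<^sup>2" for m
    have w: "0 \<le> w m" for m by (simp add: w_def)
    have le: "decay_weight \<omega> \<le> (\<Prod>i\<in>UNIV. w (\<omega> $ i))" for \<omega> :: "real^'n"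
    proof -
      have "decay_weight \<omega> = (\<Prod>i\<in>(UNIV::'n set). 1 / (1 + norm \<omega>)\<^sup>2)"
        by (simp add: decay_weight_def power_mult power_one_over)
      also have "\<dots> \<le> (\<Prod>i\<in>UNIV. w (\<omega> $ i))"
        unfolding w_def using component_le_norm_cart[of \<omega>]
        by (intro prod_mono conjI divide_left_mono power_mono) (auto intro!: mult_pos_pos zero_less_power add_pos_nonneg)
      finally show ?thesis .
    qed
    have "sum decay_weight F \<le> (\<Sum>\<omega>\<in>F. \<Prod>i\<in>UNIV. w (\<omega> $ i))" by (intro sum_mono le)
    also have "\<dots> = (\<Sum>f\<in>vec_nth ` F. \<Prod>i\<in>UNIV. w (f i))"
      by (subst sum.reindex) (auto simp: inj_on_def vec_eq_iff)
    also have "\<dots> \<le> (\<Sum>f\<in>PiE (UNIV :: 'n set) (\<lambda>_. J). \<Prod>i\<in>UNIV. w (f i))"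
    proof (rule sum_mono2)
      show "finite (PiE (UNIV :: 'n set) (\<lambda>_. J))" using J by (intro finite_PiE) auto
      show "vec_nth ` F \<subseteq> PiE UNIV (\<lambda>_. J)" by (auto simp: J_def PiE_def)
    qed (auto intro!: prod_nonneg w)
    also have "\<dots> = (\<Prod>i\<in>(UNIV :: 'n set). \<Sum>m\<in>J. w m)"
      using J by (subst prod_sum_PiE) auto
    also have "\<dots> \<le> (\<Prod>i\<in>(UNIV :: 'n set). W)"
      using sum_inverse_squares_bound[OF J] w
      by (intro prod_mono) (auto simp: w_def W_def intro!: sum_nonneg)
    finally show "sum decay_weight F \<le> W ^ CARD('n)" by simp
  qed
qed

lemma decay_weight_add_le: "decay_weight (x + y) \<le> (1 + norm y) ^ (2 * CARD('n)) * decay_weight (x :: real^'n)"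
proof -
  have pos: "0 < 1 + norm x" "0 < 1 + norm (x + y)"
    using norm_ge_zero[of x] norm_ge_zero[of "x + y"] by linarith+
  have "norm x \<le> norm (x + y) + norm y" using norm_triangle_ineq4[of "x + y" y] by simp
  moreover have "0 \<le> norm (x + y) * norm y" by simp
  moreover have "(1 + norm y) * (1 + norm (x + y)) = 1 + norm y + norm (x + y) + norm (x + y) * norm y"
    by (simp add: algebra_simps)
  ultimately have "1 + norm x \<le> (1 + norm y) * (1 + norm (x + y))" by linarith
  then have "(1 + norm x) ^ (2 * CARD('n)) \<le> ((1 + norm y) * (1 + norm (x + y))) ^ (2 * CARD('n))"
    using pos by (intro power_mono) auto
  then show ?thesis by (intro decay_weight_leI) (simp only: power_mult_distrib)
qed

definition periodization :: "(real^'n \<Rightarrow> real) \<Rightarrow> real^'n \<Rightarrow> real" where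
  "periodization g x = (\<Sum>\<^sub>\<infinity>\<omega>\<in>int_lattice. g (\<omega> + x))"

lemma abs_summable_translate:
  assumes "\<And>x :: real^'n. \<bar>g x\<bar> \<le> C * decay_weight x"
  shows "(\<lambda>\<omega>. norm (g (\<omega> + x) :: real)) summable_on int_lattice"
proof (rule summable_on_comparison_test)
  have C: "0 \<le> C" using assms by (rule decay_const_nonneg)
  show "(\<lambda>\<omega> :: real^'n. C * (1 + norm x) ^ (2 * CARD('n)) * decay_weight \<omega>) summable_on int_lattice"
    by (intro summable_on_cmult_right summable_decay_weight)
  show "norm (g (\<omega> + x)) \<le> C * (1 + norm x) ^ (2 * CARD('n)) * decay_weight \<omega>" for \<omega>
    using order_trans[OF assms[of "\<omega> + x"] mult_left_mono[OF decay_weight_add_le C]]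
    by (simp add: mult.assoc)
qed auto

lemma periodization_has_sum:
  assumes "\<And>x :: real^'n. \<bar>g x\<bar> \<le> C * decay_weight x"
  shows "((\<lambda>\<omega>. g (\<omega> + x)) has_sum periodization g x) int_lattice"
  unfolding periodization_def
  using abs_summable_summable[OF abs_summable_translate[OF assms]] by (rule has_sum_infsum)

lemma periodization_sum:
  assumes "finite I" "\<And>i x. i \<in> I \<Longrightarrow> \<bar>g i x\<bar> \<le> C i * decay_weight (x :: real^'n)"
  shows "periodization (\<lambda>x. \<Sum>i\<in>I. c i * g i x) x = (\<Sum>i\<in>I. c i * periodization (g i) x)"
proof -
  have "((\<lambda>\<omega>. \<Sum>i\<in>I. c i * g i (\<omega> + x)) has_sum (\<Sum>i\<in>I. c i * periodization (g i) x)) int_lattice"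
    using assms
  proof (induction I rule: finite_induct)
    case (insert i I)
    then show ?case
      by (auto intro!: has_sum_add has_sum_cmult_right periodization_has_sum[of "g i" "C i"])
  qed simp
  then show ?thesis unfolding periodization_def by (rule infsumI)
qed

lemma periodization_lattice_shift:
  assumes "\<omega>0 \<in> int_lattice"
  shows "periodization g (x + \<omega>0) = periodization g x"
proof -
  have "bij_betw (\<lambda>\<omega>. \<omega> + \<omega>0) int_lattice int_lattice"
    by (rule bij_betwI[where g = "\<lambda>\<omega>. \<omega> + (- \<omega>0)"])
      (auto intro!: int_lattice_add assms simp: int_lattice_def Ints_diff assms[unfolded int_lattice_def mem_Collect_eq])
  from infsum_reindex_bij_betw[OF this, of "\<lambda>\<omega>. g (\<omega> + x)"]
  show ?thesis unfolding periodization_def by (simp add: ac_simps)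
qed

lemma lattice_reduction:
  fixes x :: "real^'n"
  obtains \<omega> y where "\<omega> \<in> int_lattice" "x = y + \<omega>" "norm y \<le> real CARD('n)"
proof -
  define \<omega> :: "real^'n" where "\<omega> = (\<chi> i. of_int \<lfloor>x $ i\<rfloor>)"
  have "norm (x - \<omega>) \<le> (\<Sum>i\<in>UNIV. \<bar>(x - \<omega>) $ i\<bar>)" by (rule norm_le_l1_cart)
  also have "\<dots> \<le> (\<Sum>i\<in>(UNIV :: 'n set). 1)"
    by (intro sum_mono) (simp add: \<omega>_def, linarith)
  finally have "norm (x - \<omega>) \<le> real CARD('n)" by simp
  moreover have "\<omega> \<in> int_lattice" by (simp add: \<omega>_def int_lattice_def)
  ultimately show ?thesis using that[of \<omega> "x - \<omega>"] by simp
qed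

definition lattice_const :: "'n::finite itself \<Rightarrow> real" where
  "lattice_const _ = (1 + real CARD('n)) ^ (2 * CARD('n)) * (\<Sum>\<^sub>\<infinity>\<omega>\<in>int_lattice. decay_weight (\<omega> :: real^'n))"

text \<open>
  The bound is uniform in \<open>x\<close> because periodicity reduces \<open>x\<close> to a bounded set.
\<close>

lemma abs_periodization_le:
  assumes "\<And>x :: real^'n. \<bar>g x\<bar> \<le> C * decay_weight x"
  shows "\<bar>periodization g x\<bar> \<le> C * lattice_const TYPE('n)"
proof -
  have C: "0 \<le> C" using assms by (rule decay_const_nonneg)
  obtain \<omega> y where y: "\<omega> \<in> int_lattice" "x = y + \<omega>" "norm y \<le> real CARD('n)"
    by (rule lattice_reduction)
  have "\<bar>periodization g x\<bar> = norm (periodization g y)"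
    using y by (simp add: periodization_lattice_shift)
  also have "\<dots> \<le> (\<Sum>\<^sub>\<infinity>\<omega>\<in>int_lattice. C * (1 + real CARD('n)) ^ (2 * CARD('n)) * decay_weight (\<omega> :: real^'n))"
    unfolding periodization_def
  proof (rule norm_infsum_le[OF periodization_has_sum[OF assms, unfolded periodization_def] has_sum_infsum])
    show "(\<lambda>\<omega> :: real^'n. C * (1 + real CARD('n)) ^ (2 * CARD('n)) * decay_weight \<omega>) summable_on int_lattice"
      by (intro summable_on_cmult_right summable_decay_weight)
    fix \<omega> :: "real^'n"
    have "\<bar>g (\<omega> + y)\<bar> \<le> C * ((1 + norm y) ^ (2 * CARD('n)) * decay_weight \<omega>)"
      using order_trans[OF assms[of "\<omega> + y"] mult_left_mono[OF decay_weight_add_le C]] .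
    also have "\<dots> \<le> C * ((1 + real CARD('n)) ^ (2 * CARD('n)) * decay_weight \<omega>)"
      using y(3) C less_imp_le[OF decay_weight_pos[of \<omega>]]
      by (intro mult_left_mono mult_right_mono power_mono) auto
    finally show "norm (g (\<omega> + y)) \<le> C * (1 + real CARD('n)) ^ (2 * CARD('n)) * decay_weight \<omega>"
      by (simp add: mult.assoc)
  qed
  also have "\<dots> = C * lattice_const TYPE('n)"
    by (simp add: lattice_const_def infsum_cmult_right' mult.assoc)
  finally show ?thesis .
qed

abbreviation lattice_enum :: "nat \<Rightarrow> real^'n" where
  "lattice_enum \<equiv> from_nat_into int_lattice"

lemma bij_lattice_enum: "bij_betw lattice_enum UNIV int_lattice"
  by (rule bij_betw_from_nat_into[OF countable_int_lattice infinite_int_lattice])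

lemma lattice_enum_in: "lattice_enum k \<in> int_lattice"
  using bij_lattice_enum by (auto simp: bij_betw_def)

lemma has_sum_imp_sums_enum:
  "(f has_sum S) int_lattice \<Longrightarrow> (\<lambda>k. f (lattice_enum k)) sums S"
  by (rule has_sum_imp_sums) (simp add: has_sum_reindex_bij_betw[OF bij_lattice_enum, of f])

lemma periodization_sums:
  assumes "\<And>x :: real^'n. \<bar>g x\<bar> \<le> C * decay_weight x"
  shows "(\<lambda>k. g (lattice_enum k + x)) sums periodization g x"
  using has_sum_imp_sums_enum[OF periodization_has_sum[OF assms]] .

lemma periodization_has_derivative:
  assumes g: "\<And>x :: real^'n. \<bar>g x\<bar> \<le> C * decay_weight x"
    and g': "\<And>x :: real^'n. \<bar>g' x\<bar> \<le> C' * decay_weight x"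
    and D: "\<And>y r. ((\<lambda>r. g (y + r *\<^sub>R v)) has_real_derivative g' (y + r *\<^sub>R v)) (at r)"
  shows "((\<lambda>r. periodization g (x + r *\<^sub>R v)) has_real_derivative periodization g' (x + r *\<^sub>R v)) (at r)"
proof -
  have C': "0 \<le> C'" using g' by (rule decay_const_nonneg)
  \<comment> \<open>A majorant of the differentiated terms on the unit ball about \<open>r\<close>.\<close>
  define M where "M = C' * (1 + (norm x + (\<bar>r\<bar> + 1) * norm v)) ^ (2 * CARD('n))"
  have "((\<lambda>r. \<Sum>k. g (lattice_enum k + x + r *\<^sub>R v)) has_real_derivative
     (\<Sum>k. g' (lattice_enum k + x + r *\<^sub>R v))) (at r)"
  proof (rule has_field_derivative_series'(2)[where S = "ball r 1" and x0 = r])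
    show "((\<lambda>r. g (lattice_enum k + x + r *\<^sub>R v)) has_real_derivative
        g' (lattice_enum k + x + t *\<^sub>R v)) (at t within ball r 1)" for k t
      by (rule has_field_derivative_at_within[OF D])
    show "uniformly_convergent_on (ball r 1) (\<lambda>n t. \<Sum>k<n. g' (lattice_enum k + x + t *\<^sub>R v))"
    proof (rule Weierstrass_m_test')
      show "summable (\<lambda>k. M * decay_weight (lattice_enum k :: real^'n))"
        using has_sum_imp_sums_enum[OF has_sum_infsum[OF summable_decay_weight]]
        by (intro summable_mult) (auto simp: sums_iff)
      fix k :: nat and t assume "t \<in> ball r 1"
      then have t: "\<bar>t\<bar> \<le> \<bar>r\<bar> + 1" by (auto simp: dist_real_def)
      have "norm (x + t *\<^sub>R v) \<le> norm x + \<bar>t\<bar> * norm v"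
        using norm_triangle_ineq[of x "t *\<^sub>R v"] by simp
      also have "\<dots> \<le> norm x + (\<bar>r\<bar> + 1) * norm v"
        using t by (intro add_left_mono mult_right_mono) auto
      finally have n: "norm (x + t *\<^sub>R v) \<le> norm x + (\<bar>r\<bar> + 1) * norm v" .
      have "norm (g' (lattice_enum k + (x + t *\<^sub>R v)))
          \<le> C' * ((1 + norm (x + t *\<^sub>R v)) ^ (2 * CARD('n)) * decay_weight (lattice_enum k :: real^'n))"
        using order_trans[OF g' mult_left_mono[OF decay_weight_add_le C']] by simp
      also have "\<dots> \<le> C' * ((1 + (norm x + (\<bar>r\<bar> + 1) * norm v)) ^ (2 * CARD('n)) * decay_weight (lattice_enum k :: real^'n))"
        using n C' less_imp_le[OF decay_weight_pos[of "lattice_enum k :: real^'n"]]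
        by (intro mult_left_mono mult_right_mono power_mono) auto
      finally show "norm (g' (lattice_enum k + x + t *\<^sub>R v)) \<le> M * decay_weight (lattice_enum k :: real^'n)"
        by (simp add: M_def mult.assoc add.assoc)
    qed
    show "summable (\<lambda>k. g (lattice_enum k + x + r *\<^sub>R v))"
      using periodization_sums[OF g, of "x + r *\<^sub>R v"] by (auto simp: sums_iff add.assoc)
  qed auto
  moreover have "(\<Sum>k. g (lattice_enum k + x + t *\<^sub>R v)) = periodization g (x + t *\<^sub>R v)" for t
    using periodization_sums[OF g, of "x + t *\<^sub>R v"] by (auto simp: sums_iff add.assoc)
  moreover have "(\<Sum>k. g' (lattice_enum k + x + t *\<^sub>R v)) = periodization g' (x + t *\<^sub>R v)" for t
    using periodization_sums[OF g', of "x + t *\<^sub>R v"] by (auto simp: sums_iff add.assoc)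
  ultimately show ?thesis by simp
qed

text \<open>
  Rolle's theorem on a lattice segment, whose endpoints have the same value.
\<close>

lemma periodization_derivative_vanishes:
  assumes g: "\<And>x :: real^'n. \<bar>g x\<bar> \<le> C * decay_weight x"
    and g': "\<And>x :: real^'n. \<bar>g' x\<bar> \<le> C' * decay_weight x"
    and D: "\<And>y r. ((\<lambda>r. g (y + r *\<^sub>R v)) has_real_derivative g' (y + r *\<^sub>R v)) (at r)"
    and v: "v \<in> int_lattice"
  obtains r where "0 < r" "r < 1" "periodization g' (x + r *\<^sub>R v) = 0"
proof -
  have "\<exists>r. 0 < r \<and> r < 1 \<and> periodization g (x + 1 *\<^sub>R v) - periodization g (x + 0 *\<^sub>R v)
      = (1 - 0) * periodization g' (x + r *\<^sub>R v)"
    by (rule MVT2) (auto intro!: periodization_has_derivative[OF g g' D])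
  then show ?thesis using that periodization_lattice_shift[OF v, of g x] by auto
qed

lemma periodization_mean_value:
  assumes g: "\<And>x :: real^'n. \<bar>g x\<bar> \<le> C * decay_weight x"
    and g': "\<And>x :: real^'n. \<bar>g' x\<bar> \<le> C' * decay_weight x"
    and D: "\<And>y r. ((\<lambda>r. g (y + r *\<^sub>R v)) has_real_derivative g' (y + r *\<^sub>R v)) (at r)"
  obtains r where "periodization g (x + v) - periodization g x = periodization g' (x + r *\<^sub>R v)"
proof -
  have "\<exists>r. 0 < r \<and> r < 1 \<and> periodization g (x + 1 *\<^sub>R v) - periodization g (x + 0 *\<^sub>R v)
      = (1 - 0) * periodization g' (x + r *\<^sub>R v)"
    by (rule MVT2) (auto intro!: periodization_has_derivative[OF g g' D])
  then show ?thesis using that by auto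
qed

section \<open>Oscillation of periodized functions along the flow\<close>

definition oscillation_le :: "(real^'n \<Rightarrow> real) \<Rightarrow> real \<Rightarrow> bool" where
  "oscillation_le g b \<longleftrightarrow> (\<forall>x y. (\<forall>i. \<bar>x $ i - y $ i\<bar> \<le> 1) \<longrightarrow> \<bar>g x - g y\<bar> \<le> b)"

lemma oscillation_leD:
  "oscillation_le g b \<Longrightarrow> (\<And>i. \<bar>x $ i - y $ i\<bar> \<le> 1) \<Longrightarrow> \<bar>g x - g y\<bar> \<le> b"
  unfolding oscillation_le_def by blast

text \<open>
  The class of functions is a parameter because the induction below passes from a function to its
  derivatives; only closure and one fixed rate of decay are used.
\<close>

definition schwartz_like :: "(real^'n \<Rightarrow> real) set \<Rightarrow> bool" where
  "schwartz_like \<G> \<longleftrightarrow> (\<forall>h\<in>\<G>. (\<forall>x. h differentiable (at x)) \<and> (\<forall>v. ddir v h \<in> \<G>) \<and>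
     (\<exists>C. \<forall>x. \<bar>h x\<bar> \<le> C * decay_weight x))"

lemma schwartz_likeD:
  assumes "schwartz_like \<G>" "h \<in> \<G>"
  shows "h differentiable (at x)" "ddir v h \<in> \<G>" "\<exists>C. \<forall>x. \<bar>h x\<bar> \<le> C * decay_weight x"
  using assms unfolding schwartz_like_def by blast+

lemma flat_has_derivative_zero:
  fixes h :: "real^'n \<Rightarrow> real"
  assumes "0 < r" "\<And>x. x \<noteq> 0 \<Longrightarrow> norm x < r \<Longrightarrow> \<bar>h x - h 0\<bar> \<le> D * (norm x)\<^sup>2"
  shows "(h has_derivative (\<lambda>v. 0)) (at 0)"
  unfolding has_derivative_at
proof (intro conjI bounded_linear_zero)
  have lim: "((\<lambda>x::real^'n. D * norm x) \<longlongrightarrow> D * 0) (at 0)"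
    by (intro tendsto_intros tendsto_norm_zero)
  have ev: "\<forall>\<^sub>F x in at (0::real^'n). x \<noteq> 0 \<and> norm x < r"
    unfolding eventually_at using assms(1) by (auto intro!: exI[of _ r] simp: dist_norm)
  show "(\<lambda>x. norm (h (0 + x) - h 0 - 0) / norm x) \<midarrow>0\<rightarrow> 0"
  proof (rule tendsto_sandwich[OF _ _ tendsto_const lim[simplified]])
    show "\<forall>\<^sub>F x in at 0. norm (h (0 + x) - h 0 - 0) / norm x \<le> D * norm x"
      using ev
    proof (rule eventually_mono)
      fix x :: "real^'n" assume x: "x \<noteq> 0 \<and> norm x < r"
      then have "\<bar>h x - h 0\<bar> \<le> D * (norm x)\<^sup>2" using assms(2) by blast
      then show "norm (h (0 + x) - h 0 - 0) / norm x \<le> D * norm x"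
        using x by (simp add: field_simps power2_eq_square)
    qed
  qed simp
qed

context homogeneous_function
begin

abbreviation flow_periodization :: "(real^'n \<Rightarrow> real) \<Rightarrow> real \<Rightarrow> real^'n \<Rightarrow> real" where
  "flow_periodization h u \<equiv> periodization (\<lambda>z. h (T (- u) z))"

lemma decay_weight_T_le:
  assumes "0 \<le> u"
  shows "decay_weight (T (- u) z) \<le>
    growth_const ^ (2 * CARD('n)) * exp (growth * (2 * CARD('n)) * u) * decay_weight z"
proof -
  have e: "1 \<le> growth_const * exp (growth * u)"
    using mult_mono[of 1 growth_const 1 "exp (growth * u)"] assms growth_pos growth_const_ge_1 by simp
  have pos: "0 < 1 + norm z" "0 < 1 + norm (T (- u) z)"
    using norm_ge_zero[of z] norm_ge_zero[of "T (- u) z"] by linarith+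
  have "norm z = norm (T u (T (- u) z))" by simp
  also have "\<dots> \<le> growth_const * exp (growth * u) * norm (T (- u) z)"
    using norm_T_le[of u "T (- u) z"] assms by simp
  finally have "1 + norm z \<le> growth_const * exp (growth * u) * (1 + norm (T (- u) z))"
    using e by (simp only: distrib_left mult_1_right)
  then have "(1 + norm z) ^ (2 * CARD('n)) \<le> (growth_const * exp (growth * u) * (1 + norm (T (- u) z))) ^ (2 * CARD('n))"
    using pos by (intro power_mono) auto
  then have "(1 + norm z) ^ (2 * CARD('n)) \<le> growth_const ^ (2 * CARD('n)) * exp (growth * (2 * CARD('n)) * u)
      * (1 + norm (T (- u) z)) ^ (2 * CARD('n))"
    by (simp add: power_mult_distrib exp_of_nat_mult[symmetric] mult_ac)
  then show ?thesis by (rule decay_weight_leI)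
qed

definition growth_exponent :: real where
  "growth_exponent = growth * (2 * CARD('n))"

lemma flow_decay:
  assumes "\<And>x. \<bar>h x\<bar> \<le> C * decay_weight x" "0 \<le> u"
  shows "\<bar>h (T (- u) z)\<bar> \<le> (C * growth_const ^ (2 * CARD('n)) * exp (growth_exponent * u)) * decay_weight z"
proof -
  have C: "0 \<le> C" using assms(1) by (rule decay_const_nonneg)
  show ?thesis
    using order_trans[OF assms(1) mult_left_mono[OF decay_weight_T_le[OF assms(2)] C], of z]
    by (simp add: mult_ac growth_exponent_def)
qed

lemma flow_directional_derivative:
  assumes "\<And>x. h differentiable (at x)"
  shows "((\<lambda>r. h (T (- u) (y + r *\<^sub>R v))) has_real_derivative
    ddir (T (- u) v) h (T (- u) (y + r *\<^sub>R v))) (at r)"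
proof -
  have "((\<lambda>r. T (- u) (y + r *\<^sub>R v)) has_derivative (\<lambda>t. T (- u) (t *\<^sub>R v))) (at r)"
    by (rule has_derivative_compose[OF _ T_has_derivative]) (auto intro!: derivative_eq_intros)
  from has_derivative_compose[OF this has_derivative_ddir[OF assms]]
  have "((\<lambda>r. h (T (- u) (y + r *\<^sub>R v))) has_derivative
      (\<lambda>t. ddir (T (- u) (t *\<^sub>R v)) h (T (- u) (y + r *\<^sub>R v)))) (at r)" .
  moreover have "ddir (T (- u) (t *\<^sub>R v)) h x = ddir (T (- u) v) h x * t" for t x
  proof -
    have lin: "linear (\<lambda>v. ddir v h x)"
      using has_derivative_ddir[OF assms] by (rule has_derivative_linear)
    show ?thesis by (simp add: linear_scale[OF T_linear] linear_scale[OF lin])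
  qed
  ultimately show ?thesis by (simp add: has_field_derivative_def)
qed

text \<open>
  Here \<open>q\<close> is the contraction rate of \<open>T (- u)\<close>.  A directional derivative of \<open>h \<circ> T (- u)\<close> is a combination of the
  functions \<open>(D\<^sub>j h) \<circ> T (- u)\<close> with coefficients of size \<open>q\<close>; in a lattice direction its periodization has a
  zero within distance 1, so it is bounded by the oscillations of the periodized \<open>D\<^sub>j h\<close>.  The mean value
  theorem then bounds the oscillation for \<open>h\<close>.
\<close>

lemma periodization_oscillation_step:
  assumes G: "schwartz_like \<G>" and h: "h \<in> \<G>" and u: "0 \<le> u"
    and contr: "\<And>x. norm (T (- u) x) \<le> q * norm x"
    and osc: "\<And>j. oscillation_le (flow_periodization (ddir (axis j 1) h) u) (B j)"
  shows "oscillation_le (flow_periodization h u) (real CARD('n) * (q * (\<Sum>j\<in>UNIV. B j)))"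
  unfolding oscillation_le_def
proof (intro allI impI)
  fix x y :: "real^'n" assume close: "\<forall>i. \<bar>x $ i - y $ i\<bar> \<le> 1"
  have diff: "\<And>x. h differentiable (at x)" using schwartz_likeD(1)[OF G h] .
  have dec: "\<exists>C. \<forall>z. \<bar>f (T (- u) z)\<bar> \<le> C * decay_weight z" if fG: "f \<in> \<G>" for f
  proof -
    obtain C where "\<And>x. \<bar>f x\<bar> \<le> C * decay_weight x" using schwartz_likeD(3)[OF G fG] by blast
    from flow_decay[OF this u] show ?thesis by blast
  qed
  have ddirG: "ddir v h \<in> \<G>" for v using schwartz_likeD(2)[OF G h] .
  obtain C where C: "\<And>z. \<bar>h (T (- u) z)\<bar> \<le> C * decay_weight z" using dec[OF h] by blast
  have "\<forall>v. \<exists>C. \<forall>z. \<bar>ddir v h (T (- u) z)\<bar> \<le> C * decay_weight z" using dec[OF ddirG] by blast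
  then obtain C' where C': "\<And>v z. \<bar>ddir v h (T (- u) z)\<bar> \<le> C' v * decay_weight z" by metis
  define P where "P j = flow_periodization (ddir (axis j 1) h) u" for j
  define Y where "Y v = periodization (\<lambda>z. ddir (T (- u) v) h (T (- u) z))" for v
  have Y: "Y v z = (\<Sum>j\<in>UNIV. T (- u) v $ j * P j z)" for v z
    unfolding Y_def P_def
    by (subst ddir_expand[OF diff]) (rule periodization_sum[OF _ C'], simp)
  have D: "((\<lambda>r. h (T (- u) (y + r *\<^sub>R v))) has_real_derivative
    ddir (T (- u) v) h (T (- u) (y + r *\<^sub>R v))) (at r)" for y v r
    by (rule flow_directional_derivative[OF diff])
  have q: "0 \<le> q" using order_trans[OF norm_ge_zero contr[of "axis undefined 1"]] by simp
  have Bpos: "0 \<le> B j" for j using oscillation_leD[OF osc[of j], of 0 0] by simp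
  \<comment> \<open>By Rolle, the derivative in a lattice direction vanishes somewhere on each unit segment.\<close>
  have Yaxis: "\<bar>Y (axis i 1) z\<bar> \<le> q * (\<Sum>j\<in>UNIV. B j)" for i z
  proof -
    obtain r where r: "0 < r" "r < 1" "Y (axis i 1) (z + r *\<^sub>R axis i 1) = 0"
      unfolding Y_def by (rule periodization_derivative_vanishes[OF C C' D axis_in_int_lattice])
    have near: "\<bar>z $ k - (z + r *\<^sub>R axis i 1) $ k\<bar> \<le> 1" for k using r by (simp add: axis_def)
    have "Y (axis i 1) z = Y (axis i 1) z - Y (axis i 1) (z + r *\<^sub>R axis i 1)" using r by simp
    also have "\<dots> = (\<Sum>j\<in>UNIV. T (- u) (axis i 1) $ j * (P j z - P j (z + r *\<^sub>R axis i 1)))"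
      by (simp add: Y sum_subtractf right_diff_distrib)
    also have "\<bar>\<dots>\<bar> \<le> (\<Sum>j\<in>UNIV. q * B j)"
    proof (rule order_trans[OF sum_abs sum_mono])
      fix j
      have "\<bar>T (- u) (axis i 1) $ j\<bar> \<le> q"
        using order_trans[OF component_le_norm_cart contr[of "axis i 1"]] by simp
      moreover have "\<bar>P j z - P j (z + r *\<^sub>R axis i 1)\<bar> \<le> B j"
        unfolding P_def by (rule oscillation_leD[OF osc near])
      ultimately show "\<bar>T (- u) (axis i 1) $ j * (P j z - P j (z + r *\<^sub>R axis i 1))\<bar> \<le> q * B j"
        using q by (simp add: abs_mult mult_mono)
    qed
    finally show ?thesis by (simp add: sum_distrib_left)
  qed
  define v where "v = x - y"
  have v: "\<bar>v $ i\<bar> \<le> 1" for i using close by (simp add: v_def)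
  obtain r where r: "flow_periodization h u (y + v) - flow_periodization h u y
     = Y v (y + r *\<^sub>R v)"
    unfolding Y_def by (rule periodization_mean_value[OF C C' D])
  have comp: "T (- u) v $ j = (\<Sum>i\<in>UNIV. v $ i * T (- u) (axis i 1) $ j)" for j
  proof -
    have "T (- u) v = T (- u) (\<Sum>i\<in>UNIV. v $ i *\<^sub>R axis i 1)"
      using basis_expansion[of v] by (simp add: scalar_mult_eq_scaleR)
    also have "\<dots> = (\<Sum>i\<in>UNIV. v $ i *\<^sub>R T (- u) (axis i 1))"
      by (simp add: linear_sum[OF T_linear] linear_scale[OF T_linear])
    finally show ?thesis by simp
  qed
  have "Y v z = (\<Sum>i\<in>UNIV. v $ i * Y (axis i 1) z)" for z
    unfolding Y comp sum_distrib_left sum_distrib_right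
    by (subst sum.swap) (simp add: mult.assoc)
  moreover have "\<bar>\<Sum>i\<in>UNIV. v $ i * Y (axis i 1) z\<bar> \<le> (\<Sum>i\<in>(UNIV :: 'n set). q * (\<Sum>j\<in>UNIV. B j))" for z
  proof (rule order_trans[OF sum_abs sum_mono])
    fix i
    have "\<bar>v $ i\<bar> * \<bar>Y (axis i 1) z\<bar> \<le> 1 * (q * (\<Sum>j\<in>UNIV. B j))"
      by (intro mult_mono v Yaxis) auto
    then show "\<bar>v $ i * Y (axis i 1) z\<bar> \<le> q * (\<Sum>j\<in>UNIV. B j)" by (simp add: abs_mult)
  qed
  ultimately have "\<bar>Y v z\<bar> \<le> real CARD('n) * (q * (\<Sum>j\<in>UNIV. B j))" for z by simp
  then show "\<bar>flow_periodization h u x - flow_periodization h u y\<bar> \<le> real CARD('n) * (q * (\<Sum>j\<in>UNIV. B j))"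
    using r by (simp add: v_def)
qed

text \<open>
  Starting from a crude exponential bound, every differentiation gains a factor \<open>exp (- \<delta> u)\<close>.
\<close>

lemma periodization_oscillation:
  assumes G: "schwartz_like \<G>"
  obtains \<delta> where "0 < \<delta>"
    "\<And>k h. h \<in> \<G> \<Longrightarrow> \<exists>C. \<forall>u\<ge>0.
      oscillation_le (flow_periodization h u) (C * exp ((growth_exponent - real k * \<delta>) * u))"
proof -
  obtain C0 \<delta> where C0: "0 < C0" "0 < \<delta>" "\<And>u x. 0 \<le> u \<Longrightarrow> norm (T (- u) x) \<le> C0 * exp (- \<delta> * u) * norm x"
    using T_contracts by blast
  have "\<exists>C. \<forall>u\<ge>0. oscillation_le (flow_periodization h u) (C * exp ((growth_exponent - real k * \<delta>) * u))"
    if "h \<in> \<G>" for k h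
    using that
  proof (induction k arbitrary: h)
    case 0
    obtain C where C: "\<And>x. \<bar>h x\<bar> \<le> C * decay_weight x" using schwartz_likeD(3)[OF G 0] by blast
    define B where "B = C * growth_const ^ (2 * CARD('n)) * lattice_const TYPE('n)"
    have b: "\<bar>flow_periodization h u x\<bar> \<le> B * exp (growth_exponent * u)" if "0 \<le> u" for u x
      using abs_periodization_le[OF flow_decay[OF C that], of x] by (simp add: B_def mult_ac)
    have "\<bar>flow_periodization h u x - flow_periodization h u y\<bar> \<le> 2 * B * exp (growth_exponent * u)"
      if "0 \<le> u" for u x y
      using b[OF that, of x] b[OF that, of y] by simp
    then show ?case by (intro exI[of _ "2 * B"]) (simp add: oscillation_le_def)
  next
    case (Suc k)
    have "ddir (axis j 1) h \<in> \<G>" for j using schwartz_likeD(2)[OF G Suc.prems] .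
    from Suc.IH[OF this] obtain B where B: "\<And>j u. 0 \<le> u \<Longrightarrow>
      oscillation_le (flow_periodization (ddir (axis j 1) h) u) (B j * exp ((growth_exponent - real k * \<delta>) * u))"
      by metis
    show ?case
    proof (intro exI[of _ "real CARD('n) * (C0 * (\<Sum>j\<in>UNIV. B j))"] allI impI)
      fix u :: real assume u: "0 \<le> u"
      have "exp (- \<delta> * u) * exp ((growth_exponent - real k * \<delta>) * u)
          = exp ((growth_exponent - real (Suc k) * \<delta>) * u)"
        by (simp add: exp_add[symmetric] algebra_simps)
      then have "real CARD('n) * (C0 * exp (- \<delta> * u) * (\<Sum>j\<in>UNIV. B j * exp ((growth_exponent - real k * \<delta>) * u)))
         = real CARD('n) * (C0 * (\<Sum>j\<in>UNIV. B j)) * exp ((growth_exponent - real (Suc k) * \<delta>) * u)"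
        by (simp add: sum_distrib_right[symmetric] mult_ac)
      from periodization_oscillation_step[OF G Suc.prems u C0(3)[OF u] B[OF u], unfolded this]
      show "oscillation_le (flow_periodization h u) (real CARD('n) * (C0 * (\<Sum>j\<in>UNIV. B j))
          * exp ((growth_exponent - real (Suc k) * \<delta>) * u))" .
    qed
  qed
  then show ?thesis using that[OF C0(2)] by blast
qed

text \<open>
  The value \<open>0\<close> at the origin is the continuous one, since the Gaussian beats every symbol there.  The
  class is closed under differentiation because the logarithmic derivative of the Gaussian is a polynomial.
\<close>

definition gauss_symbol :: "(real^'n \<Rightarrow> real) \<Rightarrow> bool" where
  "gauss_symbol h \<longleftrightarrow> (\<exists>b. symbol b \<and> h = (\<lambda>x. if x = 0 then 0 else std_normal_density (L x) * b x))"

definition \<psi> :: "real^'n \<Rightarrow> real" where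
  "\<psi> x = (if x = 0 then 1 else gauss_tail (L x))"

lemma gauss_symbol_rapid_decay:
  assumes "gauss_symbol h"
  shows "\<exists>C\<ge>0. \<forall>x. x \<noteq> 0 \<longrightarrow> \<bar>h x\<bar> \<le> C * exp (- k * \<bar>L x\<bar>)"
proof -
  obtain b where b: "symbol b" "h = (\<lambda>x. if x = 0 then 0 else std_normal_density (L x) * b x)"
    using assms unfolding gauss_symbol_def by blast
  obtain C m where C: "0 \<le> C" "0 \<le> m" "\<And>x. x \<noteq> 0 \<Longrightarrow> \<bar>b x\<bar> \<le> C * exp (m * \<bar>L x\<bar>)"
    using symbol_bound[OF b(1)] by blast
  have "\<bar>h x\<bar> \<le> exp ((k + m)\<^sup>2 / 2) * C * exp (- k * \<bar>L x\<bar>)" if "x \<noteq> 0" for x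
  proof -
    have "\<bar>h x\<bar> = std_normal_density (L x) * \<bar>b x\<bar>" using that by (simp add: b(2) abs_mult)
    also have "\<dots> \<le> (exp ((k + m)\<^sup>2 / 2) * exp (- (k + m) * \<bar>L x\<bar>)) * (C * exp (m * \<bar>L x\<bar>))"
      using C by (intro mult_mono gauss_le_exp C(3)[OF that]) auto
    also have "\<dots> = exp ((k + m)\<^sup>2 / 2) * C * (exp (- (k + m) * \<bar>L x\<bar>) * exp (m * \<bar>L x\<bar>))"
      by (simp only: mult_ac)
    also have "exp (- (k + m) * \<bar>L x\<bar>) * exp (m * \<bar>L x\<bar>) = exp (- k * \<bar>L x\<bar>)"
      by (simp add: exp_add[symmetric] algebra_simps)
    finally show ?thesis .
  qed
  moreover have "0 \<le> exp ((k + m)\<^sup>2 / 2) * C" using C by simp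
  ultimately show ?thesis by blast
qed

text \<open>
  Decay in \<open>\<bar>L\<bar>\<close> at a high enough rate is quadratic vanishing at the origin, which gives differentiability with
  derivative \<open>0\<close> there although \<open>\<phi>\<close> may be singular.
\<close>

lemma rapid_decay_flat:
  obtains k C where "0 \<le> k" "\<And>x. x \<noteq> 0 \<Longrightarrow> exp (- k * \<bar>L x\<bar>) \<le> C * (norm x)\<^sup>2"
proof -
  obtain C m where C: "0 < C" "0 < m" "\<And>x. 1 + norm x \<le> C * exp (m * \<bar>L x\<bar>)"
    "\<And>x. x \<noteq> 0 \<Longrightarrow> 1 \<le> C * exp (m * \<bar>L x\<bar>) * norm x"
    using norm_bounds_abs_L by blast
  have "exp (- (2 * m) * \<bar>L x\<bar>) \<le> C\<^sup>2 * (norm x)\<^sup>2" if "x \<noteq> 0" for x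
  proof -
    have "1\<^sup>2 \<le> (C * exp (m * \<bar>L x\<bar>) * norm x)\<^sup>2" by (rule power_mono[OF C(4)[OF that]]) simp
    then have "1 \<le> C\<^sup>2 * (norm x)\<^sup>2 * exp (2 * m * \<bar>L x\<bar>)"
      by (simp add: power_mult_distrib exp_double[symmetric] mult_ac)
    then show ?thesis by (simp add: exp_minus field_simps)
  qed
  then show ?thesis using C that[of "2 * m" "C\<^sup>2"] by auto
qed

lemma rapid_decay_weight:
  obtains k C where "0 \<le> k" "0 \<le> C" "\<And>x. exp (- k * \<bar>L x\<bar>) \<le> C * decay_weight x"
proof -
  obtain C m where C: "0 < C" "0 < m" "\<And>x. 1 + norm x \<le> C * exp (m * \<bar>L x\<bar>)"
    using norm_bounds_abs_L by metis
  have "exp (- (m * (2 * CARD('n))) * \<bar>L x\<bar>) \<le> C ^ (2 * CARD('n)) * decay_weight x" for x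
  proof -
    have pos: "0 < 1 + norm x" using norm_ge_zero[of x] by linarith
    have "(1 + norm x) ^ (2 * CARD('n)) \<le> (C * exp (m * \<bar>L x\<bar>)) ^ (2 * CARD('n))"
      using pos by (intro power_mono C(3)) auto
    also have "\<dots> = C ^ (2 * CARD('n)) * exp (m * (2 * CARD('n)) * \<bar>L x\<bar>)"
      by (simp only: power_mult_distrib exp_of_nat_mult[symmetric]) (simp add: mult_ac)
    finally have le: "(1 + norm x) ^ (2 * CARD('n)) \<le> C ^ (2 * CARD('n)) * exp (m * (2 * CARD('n)) * \<bar>L x\<bar>)" .
    have "inverse b \<le> c * (1 / a)" if "a \<le> c * b" "0 < a" "0 < b" for a b c :: real
      using that by (simp add: field_simps)
    from this[OF le] show ?thesis using pos by (simp add: decay_weight_def exp_minus)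
  qed
  moreover have "0 \<le> m * (2 * CARD('n))" "0 \<le> C ^ (2 * CARD('n))" using C by auto
  ultimately show ?thesis using that by blast
qed

lemma L_differentiable: "x \<noteq> 0 \<Longrightarrow> (L has_derivative (\<lambda>v. ddir v \<phi> x * inverse (\<phi> x))) (at x)"
proof -
  assume x: "x \<noteq> 0"
  have "\<phi> differentiable (at x)" using x by (intro Cinfinity_on_differentiable[OF phi_smooth]) simp
  from has_derivative_ln[OF phi_pos[OF x] has_derivative_ddir[OF this]]
  show ?thesis unfolding L_def[abs_def] .
qed

lemma gauss_symbol_derivative:
  assumes "gauss_symbol h"
  shows "h differentiable (at x)" "gauss_symbol (ddir v h)"
proof -
  obtain b where b: "symbol b" "h = (\<lambda>x. if x = 0 then 0 else std_normal_density (L x) * b x)"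
    using assms unfolding gauss_symbol_def by blast
  have D: "(h has_derivative (\<lambda>v. std_normal_density (L x) *
      (ddir v b x + (- 1) * (L x * (ddir v \<phi> x * (inverse (\<phi> x) * b x)))))) (at x)" if x: "x \<noteq> 0" for x
  proof -
    have "b differentiable (at x)"
      using b(1) x by (auto simp: symbol_def intro: Cinfinity_on_differentiable)
    from has_derivative_mult[OF DERIV_compose_FDERIV[OF gauss_has_derivative L_differentiable[OF x]] has_derivative_ddir[OF this]]
    have "((\<lambda>x. std_normal_density (L x) * b x) has_derivative (\<lambda>v. std_normal_density (L x) *
      (ddir v b x + (- 1) * (L x * (ddir v \<phi> x * (inverse (\<phi> x) * b x)))))) (at x)"
      by (rule has_derivative_eq_rhs) (simp add: fun_eq_iff algebra_simps)
    then show ?thesis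
      by (rule has_derivative_transform_within_open[OF _ open_punctured]) (use x in \<open>auto simp: b(2)\<close>)
  qed
  obtain k C where k: "0 \<le> k" "\<And>x. x \<noteq> 0 \<Longrightarrow> exp (- k * \<bar>L x\<bar>) \<le> C * (norm x)\<^sup>2"
    using rapid_decay_flat by blast
  obtain C' where C': "0 \<le> C'" "\<And>x. x \<noteq> 0 \<Longrightarrow> \<bar>h x\<bar> \<le> C' * exp (- k * \<bar>L x\<bar>)"
    using gauss_symbol_rapid_decay[OF assms] by blast
  have "\<bar>h x - h 0\<bar> \<le> C' * C * (norm x)\<^sup>2" if "x \<noteq> 0" for x
    using order_trans[OF C'(2)[OF that] mult_left_mono[OF k(2)[OF that] C'(1)]]
    by (simp add: b(2) mult.assoc)
  then have D0: "(h has_derivative (\<lambda>v. 0)) (at 0)"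
    by (intro flat_has_derivative_zero[of 1 h "C' * C"]) auto
  show "h differentiable (at x)"
  proof (cases "x = 0")
    case True
    then show ?thesis using D0 unfolding differentiable_def by blast
  next
    case False
    show ?thesis using D[OF False] unfolding differentiable_def by blast
  qed
  have "ddir v h = (\<lambda>x. if x = 0 then 0 else std_normal_density (L x) *
      (ddir v b x + (- 1) * (L x * (ddir v \<phi> x * (inverse (\<phi> x) * b x)))))"
  proof
    show "ddir v h x = (\<lambda>x. if x = 0 then 0 else std_normal_density (L x) *
      (ddir v b x + (- 1) * (L x * (ddir v \<phi> x * (inverse (\<phi> x) * b x))))) x" for x
      using ddir_eqI[OF D0, of v] ddir_eqI[OF D, of x v] by (cases "x = 0") simp_all
  qed
  moreover have "symbol (\<lambda>x. ddir v b x + (- 1) * (L x * (ddir v \<phi> x * (inverse (\<phi> x) * b x))))"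
    by (intro symbol_add symbol_mult symbol_const symbol_L symbol_ddir symbol_phi symbol_inverse_phi b(1))
  ultimately show "gauss_symbol (ddir v h)" unfolding gauss_symbol_def by blast
qed

lemma psi_derivative: "\<psi> differentiable (at x)" "gauss_symbol (ddir v \<psi>)"
proof -
  have D: "(\<psi> has_derivative (\<lambda>v. std_normal_density (L x) * ((- 1) * (ddir v \<phi> x * inverse (\<phi> x))))) (at x)"
    if x: "x \<noteq> 0" for x
  proof -
    from DERIV_compose_FDERIV[OF gauss_tail_has_derivative L_differentiable[OF x]]
    have "((\<lambda>x. gauss_tail (L x)) has_derivative (\<lambda>v. std_normal_density (L x) * ((- 1) * (ddir v \<phi> x * inverse (\<phi> x))))) (at x)"
      by (rule has_derivative_eq_rhs) (simp add: fun_eq_iff algebra_simps)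
    then show ?thesis
      by (rule has_derivative_transform_within_open[OF _ open_punctured]) (use x in \<open>auto simp: \<psi>_def\<close>)
  qed
  obtain k C where k: "0 \<le> k" "\<And>x. x \<noteq> 0 \<Longrightarrow> exp (- k * \<bar>L x\<bar>) \<le> C * (norm x)\<^sup>2"
    using rapid_decay_flat by blast
  \<comment> \<open>Near the origin \<open>\<phi> < 1\<close>, so that \<open>L\<close> is negative there.\<close>
  have "isCont \<phi> 0" using phi_continuous by (simp add: continuous_on_eq_continuous_at)
  then obtain r where r: "0 < r" "\<And>x. norm x < r \<Longrightarrow> \<bar>\<phi> x\<bar> < 1"
    unfolding continuous_at_eps_delta by (metis dist_0_norm dist_commute phi_zero zero_less_one dist_real_def diff_zero)
  have "\<bar>\<psi> x - \<psi> 0\<bar> \<le> exp (k\<^sup>2 / 2) * C * (norm x)\<^sup>2" if x: "x \<noteq> 0" "norm x < r" for x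
  proof -
    have "L x < 0" using r(2)[OF x(2)] phi_pos[OF x(1)] by (simp add: L_def)
    then have "\<bar>\<psi> x - \<psi> 0\<bar> \<le> exp (k\<^sup>2 / 2) * exp (- k * \<bar>L x\<bar>)"
      using gauss_tail_ge_exp[OF k(1), of "L x"] gauss_tail_le_1[of "L x"] x by (simp add: \<psi>_def)
    also have "\<dots> \<le> exp (k\<^sup>2 / 2) * (C * (norm x)\<^sup>2)"
      by (intro mult_left_mono k(2) x) auto
    finally show ?thesis by (simp add: mult.assoc)
  qed
  then have D0: "(\<psi> has_derivative (\<lambda>v. 0)) (at 0)"
    by (rule flat_has_derivative_zero[OF r(1)])
  show "\<psi> differentiable (at x)"
  proof (cases "x = 0")
    case True
    then show ?thesis using D0 unfolding differentiable_def by blast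
  next
    case False
    show ?thesis using D[OF False] unfolding differentiable_def by blast
  qed
  have "ddir v \<psi> = (\<lambda>x. if x = 0 then 0 else std_normal_density (L x) * ((- 1) * (ddir v \<phi> x * inverse (\<phi> x))))"
  proof
    show "ddir v \<psi> x = (\<lambda>x. if x = 0 then 0 else std_normal_density (L x) * ((- 1) * (ddir v \<phi> x * inverse (\<phi> x)))) x" for x
      using ddir_eqI[OF D0, of v] ddir_eqI[OF D, of x v] by (cases "x = 0") simp_all
  qed
  moreover have "symbol (\<lambda>x. (- 1) * (ddir v \<phi> x * inverse (\<phi> x)))"
    by (intro symbol_mult symbol_const symbol_ddir symbol_phi symbol_inverse_phi)
  ultimately show "gauss_symbol (ddir v \<psi>)" unfolding gauss_symbol_def by blast
qed

lemma psi_nonneg: "0 \<le> \<psi> x" and psi_le_1: "\<psi> x \<le> 1"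
  by (simp_all add: \<psi>_def gauss_tail_nonneg gauss_tail_le_1)

lemma psi_decay: obtains C where "\<And>x. \<bar>\<psi> x\<bar> \<le> C * decay_weight x"
proof -
  obtain k C where k: "0 \<le> k" "0 \<le> C" "\<And>x. exp (- k * \<bar>L x\<bar>) \<le> C * decay_weight x"
    using rapid_decay_weight by blast
  obtain C1 m where C1: "0 < C1" "0 < m" "\<And>x. 1 \<le> norm x \<Longrightarrow> norm x \<le> C1 * exp (m * L x)"
    using norm_le_exp_L by blast
  define R where "R = max 1 C1"
  have "\<bar>\<psi> x\<bar> \<le> (exp (k\<^sup>2 / 2) * C + (1 + R) ^ (2 * CARD('n))) * decay_weight x" for x
  proof (cases "norm x \<le> R")
    case True
    have pos: "0 < 1 + norm x" using norm_ge_zero[of x] by linarith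
    have "(1 + norm x) ^ (2 * CARD('n)) \<le> (1 + R) ^ (2 * CARD('n))"
      using True pos by (intro power_mono) auto
    then have "1 \<le> (1 + R) ^ (2 * CARD('n)) * decay_weight x"
      using pos by (simp add: decay_weight_def field_simps)
    moreover have "0 \<le> exp (k\<^sup>2 / 2) * C * decay_weight x"
      using k(2) less_imp_le[OF decay_weight_pos[of x]] by simp
    ultimately show ?thesis using psi_nonneg[of x] psi_le_1[of x] unfolding distrib_right by linarith
  next
    case False
    then have x: "1 \<le> norm x" "C1 < norm x" "x \<noteq> 0" by (auto simp: R_def)
    then have "C1 * 1 < C1 * exp (m * L x)" using C1(3)[OF x(1)] by linarith
    then have "0 < m * L x" using C1(1) by (simp only: mult_less_cancel_left_pos) simp
    then have "0 < L x" using C1(2) by (simp add: zero_less_mult_iff)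
    then have "\<bar>\<psi> x\<bar> \<le> exp (k\<^sup>2 / 2) * exp (- k * \<bar>L x\<bar>)"
      using gauss_tail_le_exp[OF k(1), of "L x"] gauss_tail_nonneg[of "L x"] x by (simp add: \<psi>_def)
    also have "\<dots> \<le> exp (k\<^sup>2 / 2) * (C * decay_weight x)" by (intro mult_left_mono k) auto
    finally have "\<bar>\<psi> x\<bar> \<le> exp (k\<^sup>2 / 2) * C * decay_weight x" by (simp add: mult.assoc)
    moreover have "0 \<le> (1 + R) ^ (2 * CARD('n)) * decay_weight x"
      using less_imp_le[OF decay_weight_pos[of x]] by (simp add: R_def)
    ultimately show ?thesis unfolding distrib_right by linarith
  qed
  then show ?thesis by (rule that)
qed

lemma schwartz_like_psi: "schwartz_like (insert \<psi> {h. gauss_symbol h})"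
  unfolding schwartz_like_def
proof (intro ballI conjI allI)
  fix h assume "h \<in> insert \<psi> {h. gauss_symbol h}"
  then consider "h = \<psi>" | "gauss_symbol h" by blast
  note h = this
  show "h differentiable (at x)" for x
    by (cases rule: h) (auto intro: psi_derivative gauss_symbol_derivative)
  show "ddir v h \<in> insert \<psi> {h. gauss_symbol h}" for v
    by (cases rule: h) (auto intro: psi_derivative gauss_symbol_derivative)
  show "\<exists>C. \<forall>x. \<bar>h x\<bar> \<le> C * decay_weight x"
  proof (cases rule: h)
    case 1
    then show ?thesis using psi_decay by metis
  next
    case 2
    obtain k C where k: "0 \<le> k" "0 \<le> C" "\<And>x. exp (- k * \<bar>L x\<bar>) \<le> C * decay_weight x"
      using rapid_decay_weight by blast
    obtain C' where C': "0 \<le> C'" "\<And>x. x \<noteq> 0 \<Longrightarrow> \<bar>h x\<bar> \<le> C' * exp (- k * \<bar>L x\<bar>)"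
      using gauss_symbol_rapid_decay[OF 2] by blast
    have "h 0 = 0" using 2 by (auto simp: gauss_symbol_def)
    then have "\<bar>h x\<bar> \<le> (C' * C) * decay_weight x" for x
      using order_trans[OF C'(2)[of x] mult_left_mono[OF k(3) C'(1)]] k C' less_imp_le[OF decay_weight_pos[of x]]
      by (cases "x = 0") (auto simp: mult.assoc)
    then show ?thesis by blast
  qed
qed

lemma psi_oscillation:
  "\<exists>C. \<forall>u\<ge>0. oscillation_le (flow_periodization \<psi> u) (C * exp (- k * u))"
proof -
  obtain \<delta> where \<delta>: "0 < \<delta>"
    "\<And>k h. h \<in> insert \<psi> {h. gauss_symbol h} \<Longrightarrow> \<exists>C. \<forall>u\<ge>0.
      oscillation_le (flow_periodization h u) (C * exp ((growth_exponent - real k * \<delta>) * u))"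
    using periodization_oscillation[OF schwartz_like_psi] by blast
  \<comment> \<open>Enough differentiations to beat the crude growth exponent.\<close>
  obtain j :: nat where "(growth_exponent + k) / \<delta> \<le> real j" using real_arch_simple by blast
  then have j: "growth_exponent - real j * \<delta> \<le> - k" using \<delta>(1) by (simp add: field_simps)
  obtain C where C: "\<And>u. 0 \<le> u \<Longrightarrow>
      oscillation_le (flow_periodization \<psi> u) (C * exp ((growth_exponent - real j * \<delta>) * u))"
    using \<delta>(2)[of \<psi> j] by blast
  have "C * exp ((growth_exponent - real j * \<delta>) * u) \<le> \<bar>C\<bar> * exp (- k * u)" if "0 \<le> u" for u
    using mult_right_mono[OF j that] by (intro mult_mono) auto
  then have "oscillation_le (flow_periodization \<psi> u) (\<bar>C\<bar> * exp (- k * u))" if "0 \<le> u" for u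
    using C[OF that] that unfolding oscillation_le_def by (meson order_trans)
  then show ?thesis by blast
qed

end

section \<open>Volumes of images under the matrix exponential\<close>

text \<open>
  A well-ordered copy of a finite type.  The determinant formula for the volume of a linear image is applied to
  vectors indexed by this copy; permuting coordinates preserves volume.
\<close>

typedef (overloaded) 'a ordered_index = "{..<CARD('a::finite)}"
  by (rule exI[of _ 0]) simp

lemma bij_betw_Rep_ordered_index:
  "bij_betw Rep_ordered_index (UNIV :: 'a::finite ordered_index set) {..<CARD('a)}"
  using type_definition_ordered_index type_definition.Rep_range
  by (metis Rep_ordered_index_inject bij_betw_def inj_onI)

instance ordered_index :: (finite) finite
proof
  show "finite (UNIV :: 'a ordered_index set)"
    using bij_betw_finite[OF bij_betw_Rep_ordered_index] by simp
qed

lemma card_ordered_index: "CARD('a::finite ordered_index) = CARD('a)"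
  using bij_betw_same_card[OF bij_betw_Rep_ordered_index] by simp

instantiation ordered_index :: (finite) wellorder
begin

definition "i \<le> j \<longleftrightarrow> Rep_ordered_index i \<le> Rep_ordered_index j"
definition "i < j \<longleftrightarrow> Rep_ordered_index i < Rep_ordered_index j"

instance
proof
  fix P :: "'a ordered_index \<Rightarrow> bool" and a
  assume step: "\<And>i. (\<And>j. j < i \<Longrightarrow> P j) \<Longrightarrow> P i"
  show "P a"
  proof (induction a rule: measure_induct_rule[where f = Rep_ordered_index])
    case (less i)
    then show ?case by (rule step) (simp add: less_ordered_index_def)
  qed
qed (auto simp: less_eq_ordered_index_def less_ordered_index_def Rep_ordered_index_inject)

end

lemma emeasure_lborel_box_cart:
  fixes l u :: "real^'n"
  assumes "\<And>i. l $ i \<le> u $ i"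
  shows "emeasure lborel (box l u) = ennreal (\<Prod>i\<in>UNIV. u $ i - l $ i)"
proof -
  have B: "(Basis :: (real^'n) set) = (\<lambda>i. axis i 1) ` UNIV" by (auto simp: Basis_vec_def)
  have "emeasure lborel (box l u) = (\<Prod>b\<in>Basis. (u - l) \<bullet> b)"
    by (rule emeasure_lborel_box) (auto simp: B inner_axis assms)
  also have "(\<Prod>b\<in>Basis. (u - l) \<bullet> b) = (\<Prod>i\<in>UNIV. (u - l) \<bullet> axis i 1)"
    unfolding B by (subst prod.reindex) (auto simp: inj_on_def axis_eq_axis)
  finally show ?thesis by (simp add: inner_axis)
qed

lemma lborel_distr_reindex:
  fixes \<tau> :: "'a::finite \<Rightarrow> 'b::finite"
  assumes "bij \<tau>"
  shows "distr lborel borel (\<lambda>x::real^'b. (\<chi> i. x $ \<tau> i) :: real^'a) = lborel"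
proof (rule lborel_eqI[symmetric])
  let ?R = "\<lambda>x::real^'b. (\<chi> i. x $ \<tau> i) :: real^'a"
  have cont: "continuous_on UNIV ?R" by (intro continuous_intros)
  then have meas: "?R \<in> borel_measurable borel" by (rule borel_measurable_continuous_onI)
  fix l u :: "real^'a" assume lu: "\<And>b. b \<in> Basis \<Longrightarrow> l \<bullet> b \<le> u \<bullet> b"
  have lu': "l $ i \<le> u $ i" for i
    using lu[of "axis i 1"] by (simp add: inner_axis axis_in_Basis_iff)
  define s where "s = inv \<tau>"
  have s: "s (\<tau> i) = i" "\<tau> (s j) = j" for i j
    using assms by (simp_all add: s_def bij_is_inj bij_is_surj surj_f_inv_f)
  have pre: "?R -` box l u = box (\<chi> j. l $ s j) (\<chi> j. u $ s j)"
  proof -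
    have "(\<forall>i. l $ i < x $ \<tau> i \<and> x $ \<tau> i < u $ i) \<longleftrightarrow> (\<forall>j. l $ s j < x $ j \<and> x $ j < u $ s j)" for x :: "real^'b"
      using s by metis
    then show ?thesis by (auto simp: mem_box_cart)
  qed
  have "emeasure (distr lborel borel ?R) (box l u) = emeasure lborel (?R -` box l u)"
    using meas by (subst emeasure_distr) auto
  also have "\<dots> = ennreal (\<Prod>j\<in>UNIV. u $ s j - l $ s j)"
    unfolding pre by (subst emeasure_lborel_box_cart) (auto simp: lu')
  also have "(\<Prod>j\<in>UNIV. u $ s j - l $ s j) = (\<Prod>i\<in>UNIV. u $ i - l $ i)"
    using bij_imp_bij_inv[OF assms] by (intro prod.reindex_bij_betw[where h = s]) (simp add: s_def)
  also have "ennreal \<dots> = emeasure lborel (box l u)"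
    by (rule emeasure_lborel_box_cart[symmetric]) (rule lu')
  also have "\<dots> = (\<Prod>b\<in>Basis. (u - l) \<bullet> b)" by (rule emeasure_lborel_box) (rule lu)
  finally show "emeasure (distr lborel borel ?R) (box l u) = (\<Prod>b\<in>Basis. (u - l) \<bullet> b)" .
qed simp

lemma mat_exp_reindex:
  fixes A :: "real^'n^'n" and \<sigma> :: "'m::finite \<Rightarrow> 'n"
  assumes "bij \<sigma>"
  shows "mat_exp (u *\<^sub>R (\<chi> i j. A $ \<sigma> i $ \<sigma> j)) = (\<chi> i j. mat_exp (u *\<^sub>R A) $ \<sigma> i $ \<sigma> j)"
proof -
  have "mat_pow (\<chi> i j. A $ \<sigma> i $ \<sigma> j) k $ i $ j = mat_pow A k $ \<sigma> i $ \<sigma> j" for k i j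
  proof (induction k arbitrary: i j)
    case 0
    then show ?case using assms by (auto simp: mat_def bij_def inj_eq)
  next
    case (Suc k)
    have "(\<Sum>l\<in>UNIV. A $ \<sigma> i $ \<sigma> l * mat_pow A k $ \<sigma> l $ \<sigma> j) = (\<Sum>l\<in>UNIV. A $ \<sigma> i $ l * mat_pow A k $ l $ \<sigma> j)"
      using assms by (rule sum.reindex_bij_betw)
    then show ?case by (simp add: mat_pow_Suc matrix_mult_entry Suc.IH)
  qed
  then show ?thesis by (simp add: vec_eq_iff mat_exp_entry_eq)
qed

lemma open_mat_exp_image:
  fixes A :: "real^'n^'n"
  assumes "open X"
  shows "open ((\<lambda>x. mat_exp (u *\<^sub>R A) *v x) ` X)"
proof -
  have "(\<lambda>x. mat_exp (u *\<^sub>R A) *v x) ` X = (\<lambda>x. mat_exp ((- u) *\<^sub>R A) *v x) -` X"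
  proof (intro equalityI subsetI)
    fix y assume "y \<in> (\<lambda>x. mat_exp (u *\<^sub>R A) *v x) ` X"
    then show "y \<in> (\<lambda>x. mat_exp ((- u) *\<^sub>R A) *v x) -` X"
      using mat_exp_minus_mult[of u A] by (auto simp: matrix_vector_mul_assoc simp del: scaleR_minus_left)
  next
    fix y assume "y \<in> (\<lambda>x. mat_exp ((- u) *\<^sub>R A) *v x) -` X"
    moreover have "y = mat_exp (u *\<^sub>R A) *v (mat_exp ((- u) *\<^sub>R A) *v y)"
      using mat_exp_minus_mult[of "- u" A] by (simp add: matrix_vector_mul_assoc)
    ultimately show "y \<in> (\<lambda>x. mat_exp (u *\<^sub>R A) *v x) ` X" by blast
  qed
  then show ?thesis
    using assms by (simp add: continuous_open_vimage matrix_vector_mult_linear_continuous_at)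
qed

text \<open>
  Only the trace of \<open>A\<close> has to be compared with that of the reindexed matrix, because \<open>det_mat_exp\<close>
  expresses the determinant through it.
\<close>

lemma measure_mat_exp_image:
  fixes A :: "real^'n^'n"
  assumes "open S" "bounded S"
  shows "measure lborel ((\<lambda>x. mat_exp (u *\<^sub>R A) *v x) ` S) = exp (u * trace A) * measure lborel S"
proof -
  obtain \<sigma> :: "'n ordered_index \<Rightarrow> 'n" where \<sigma>: "bij \<sigma>"
    using finite_same_card_bij[of "UNIV :: 'n ordered_index set" "UNIV :: 'n set"] card_ordered_index[where 'a = 'n]
    by auto
  define s where "s = inv \<sigma>"
  have s: "s (\<sigma> i) = i" "\<sigma> (s j) = j" for i j
    using \<sigma> by (simp_all add: s_def bij_is_inj bij_is_surj surj_f_inv_f)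
  have bs: "bij s" unfolding s_def by (rule bij_imp_bij_inv[OF \<sigma>])
  define R :: "real^('n ordered_index) \<Rightarrow> real^'n" where "R x = (\<chi> j. x $ s j)" for x
  define R' :: "real^'n \<Rightarrow> real^('n ordered_index)" where "R' x = (\<chi> i. x $ \<sigma> i)" for x
  have inv: "R (R' x) = x" "R' (R y) = y" for x y by (simp_all add: R_def R'_def s vec_eq_iff)
  have cont: "continuous_on UNIV R" "continuous_on UNIV R'"
    unfolding R_def R'_def by (intro continuous_intros)+
  have meas: "R \<in> borel_measurable borel" using cont(1) by (rule borel_measurable_continuous_onI)
  have preserve: "measure lborel (R' ` X) = measure lborel X" if "open X" for X
  proof -
    have "measure lborel X = measure (distr lborel borel R) X"
      unfolding R_def lborel_distr_reindex[OF bs] ..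
    also have "\<dots> = measure lborel (R -` X)"
      using meas that by (subst measure_distr) auto
    also have "R -` X = R' ` X"
      by (auto simp: inv image_iff) (metis inv(2))
    finally show ?thesis by simp
  qed
  define A' where "A' = (\<chi> i j. A $ \<sigma> i $ \<sigma> j)"
  define M where "M = mat_exp (u *\<^sub>R A)"
  define M' where "M' = mat_exp (u *\<^sub>R A')"
  have M': "M' $ i $ j = M $ \<sigma> i $ \<sigma> j" for i j
    unfolding M'_def M_def A'_def mat_exp_reindex[OF \<sigma>] by simp
  have conj: "R' (M *v x) = M' *v R' x" for x
  proof -
    have "(\<Sum>j\<in>UNIV. M $ \<sigma> i $ j * x $ j) = (\<Sum>j\<in>UNIV. M $ \<sigma> i $ \<sigma> j * x $ \<sigma> j)" for i
      using sum.reindex_bij_betw[OF \<sigma>, of "\<lambda>j. M $ \<sigma> i $ j * x $ j"] by simp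
    then show ?thesis by (simp add: vec_eq_iff matrix_vector_mult_def R'_def M')
  qed
  have trace: "trace A' = trace A"
    unfolding trace_def A'_def using sum.reindex_bij_betw[OF \<sigma>, of "\<lambda>i. A $ i $ i"] by simp
  have det: "det M' = exp (u * trace A)" by (simp add: M'_def det_mat_exp trace)
  have openR: "open (R' ` S)"
  proof -
    have "R' ` S = R -` S" by (auto simp: inv image_iff) (metis inv(2))
    then show ?thesis using open_vimage[OF assms(1) cont(1)] by simp
  qed
  have linR: "linear R'" unfolding R'_def by (rule linearI) (auto simp: vec_eq_iff)
  have lm: "R' ` S \<in> lmeasurable"
    using openR assms(2) linR by (intro lmeasurable_open bounded_linear_image) (auto simp: linear_conv_bounded_linear)
  have "measure lborel ((\<lambda>x. M *v x) ` S) = measure lborel (R' ` (\<lambda>x. M *v x) ` S)"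
    unfolding M_def by (rule preserve[symmetric]) (rule open_mat_exp_image[OF assms(1)])
  also have "R' ` (\<lambda>x. M *v x) ` S = (\<lambda>x. M' *v x) ` (R' ` S)" by (simp add: image_image conj)
  also have "measure lborel \<dots> = measure lebesgue ((\<lambda>x. M' *v x) ` (R' ` S))"
    using open_mat_exp_image[OF openR, of u A'] by (simp add: measure_completion M'_def)
  also have "\<dots> = exp (u * trace A) * measure lebesgue (R' ` S)"
    using measure_linear_image[OF matrix_vector_mul_linear lm, of M'] by (simp add: det)
  also have "measure lebesgue (R' ` S) = measure lborel S"
    using openR preserve[OF assms(1)] by (simp add: measure_completion)
  finally show ?thesis by (simp add: M_def)
qed

section \<open>A smoothed count of lattice points\<close>

definition unit_cube :: "(real^'n) set" where
  "unit_cube = {x. \<forall>i. 0 \<le> x $ i \<and> x $ i < 1}"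

lemma unit_cube_measurable [measurable]: "unit_cube \<in> sets borel"
proof -
  have eq: "unit_cube = (\<Inter>i. {x::real^'n. 0 \<le> x $ i} \<inter> {x. x $ i < 1})" by (auto simp: unit_cube_def)
  have "{x::real^'n. 0 \<le> x $ i} \<in> sets borel" for i
    by (intro borel_closed closed_Collect_le continuous_intros)
  moreover have "{x::real^'n. x $ i < 1} \<in> sets borel" for i
    by (intro borel_open open_Collect_less continuous_intros)
  ultimately show ?thesis unfolding eq by (intro sets.finite_INT sets.Int) auto
qed

lemma emeasure_unit_cube: "emeasure lborel (unit_cube :: (real^'n) set) = 1"
proof (rule antisym)
  let ?one = "(\<chi> i. 1) :: real^'n"
  have b: "emeasure lborel (box 0 ?one) = 1"
    by (subst emeasure_lborel_box_cart) auto
  then have c: "emeasure lborel (cbox 0 ?one) = 1"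
    by (simp only: emeasure_lborel_box_eq emeasure_lborel_cbox_eq)
  show "emeasure lborel (unit_cube :: (real^'n) set) \<le> 1"
    unfolding c[symmetric] by (rule emeasure_mono) (auto simp: unit_cube_def mem_box_cart less_imp_le)
  show "1 \<le> emeasure lborel (unit_cube :: (real^'n) set)"
    unfolding b[symmetric] by (rule emeasure_mono) (auto simp: unit_cube_def mem_box_cart less_imp_le)
qed

lemma lattice_translates_disjoint:
  "disjoint_family (\<lambda>k. (+) (lattice_enum k) ` (unit_cube :: (real^'n) set))"
  unfolding disjoint_family_on_def
proof (intro ballI impI)
  fix j k :: nat assume jk: "j \<noteq> k"
  have inj: "inj (lattice_enum :: nat \<Rightarrow> real^'n)" using bij_lattice_enum by (auto simp: bij_betw_def)
  show "(+) (lattice_enum j) ` unit_cube \<inter> (+) (lattice_enum k) ` (unit_cube :: (real^'n) set) = {}"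
  proof (rule ccontr)
    assume "\<not> ?thesis"
    then obtain x y :: "real^'n" where xy: "x \<in> unit_cube" "y \<in> unit_cube" "lattice_enum j + x = lattice_enum k + y"
      by auto
    have mem: "(lattice_enum l :: real^'n) \<in> int_lattice" for l by (rule lattice_enum_in)
    have "(lattice_enum j :: real^'n) $ i = lattice_enum k $ i" for i
    proof -
      have "(lattice_enum j :: real^'n) $ i \<in> \<int>" "(lattice_enum k :: real^'n) $ i \<in> \<int>"
        using mem by (auto simp: int_lattice_def)
      moreover have "\<bar>(lattice_enum j :: real^'n) $ i - lattice_enum k $ i\<bar> < 1"
      proof -
        have "lattice_enum j $ i + x $ i = lattice_enum k $ i + y $ i"
          using arg_cong[OF xy(3), of "\<lambda>v. v $ i"] by simp
        moreover have "0 \<le> x $ i" "x $ i < 1" "0 \<le> y $ i" "y $ i < 1"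
          using xy(1,2) by (auto simp: unit_cube_def)
        ultimately show ?thesis by linarith
      qed
      ultimately show ?thesis
        by (metis Ints_diff Ints_nonzero_abs_less1 right_minus_eq)
    qed
    then have "(lattice_enum j :: real^'n) = lattice_enum k" by (simp add: vec_eq_iff)
    then show False using jk inj by (auto dest: injD)
  qed
qed

lemma lattice_translates_cover:
  obtains k where "(x :: real^'n) \<in> (+) (lattice_enum k) ` unit_cube"
proof -
  define \<omega> :: "real^'n" where "\<omega> = (\<chi> i. of_int \<lfloor>x $ i\<rfloor>)"
  have "\<omega> \<in> int_lattice" by (simp add: \<omega>_def int_lattice_def)
  then obtain k where k: "\<omega> = lattice_enum k" using bij_lattice_enum by (auto simp: bij_betw_def)
  have "x - \<omega> \<in> unit_cube" by (simp add: unit_cube_def \<omega>_def) linarith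
  then show ?thesis using k that[of k] by (metis add_diff_cancel_left' diff_add_cancel image_eqI add.commute)
qed

text \<open>
  Integrating the periodization over a fundamental domain gives the integral over the whole space.
\<close>

lemma nn_integral_lattice_tiling:
  fixes f :: "real^'n \<Rightarrow> ennreal"
  assumes [measurable]: "f \<in> borel_measurable borel"
  shows "(\<integral>\<^sup>+x. f x \<partial>lborel) = (\<integral>\<^sup>+x. (\<Sum>k. f (lattice_enum k + x)) * indicator unit_cube x \<partial>lborel)"
proof -
  have shift: "(+) (\<omega> :: real^'n) \<in> borel_measurable borel" for \<omega> by measurable
  have cube: "(+) \<omega> ` unit_cube \<in> sets borel" for \<omega> :: "real^'n"
  proof -
    have "(+) \<omega> ` unit_cube = (+) (- \<omega>) -` unit_cube"
      by (auto simp: image_iff intro!: bexI[of _ "- \<omega> + _"])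
    then show ?thesis using measurable_sets[OF shift unit_cube_measurable, of "- \<omega>"] by simp
  qed
  have pointwise: "f x = (\<Sum>k. f x * indicator ((+) (lattice_enum k) ` unit_cube) x)" for x :: "real^'n"
  proof -
    obtain k where "x \<in> (+) (lattice_enum k) ` unit_cube" by (rule lattice_translates_cover)
    from suminf_cmult_indicator[OF lattice_translates_disjoint this, of "\<lambda>_. f x"] show ?thesis by simp
  qed
  have "(\<integral>\<^sup>+x. f x \<partial>lborel) = (\<integral>\<^sup>+x. (\<Sum>k. f x * indicator ((+) (lattice_enum k) ` unit_cube) x) \<partial>lborel)"
    by (subst pointwise) simp
  also have "\<dots> = (\<Sum>k. \<integral>\<^sup>+x. f x * indicator ((+) (lattice_enum k) ` unit_cube) x \<partial>lborel)"
    using cube by (intro nn_integral_suminf) simp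
  also have "\<dots> = (\<Sum>k. \<integral>\<^sup>+x. f (lattice_enum k + x) * indicator unit_cube x \<partial>lborel)"
  proof (rule arg_cong[where f = suminf], rule ext)
    fix k
    let ?\<omega> = "lattice_enum k :: real^'n"
    have "(\<integral>\<^sup>+x. f x * indicator ((+) ?\<omega> ` unit_cube) x \<partial>lborel)
        = (\<integral>\<^sup>+x. f x * indicator ((+) ?\<omega> ` unit_cube) x \<partial>distr lborel borel ((+) ?\<omega>))"
      by (simp add: lborel_distr_plus)
    also have "\<dots> = (\<integral>\<^sup>+x. f (?\<omega> + x) * indicator ((+) ?\<omega> ` unit_cube) (?\<omega> + x) \<partial>lborel)"
      using cube by (intro nn_integral_distr) simp_all
    finally show "(\<integral>\<^sup>+x. f x * indicator ((+) ?\<omega> ` unit_cube) x \<partial>lborel)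
        = (\<integral>\<^sup>+x. f (?\<omega> + x) * indicator unit_cube x \<partial>lborel)"
      by (simp add: indicator_def image_iff)
  qed
  also have "\<dots> = (\<integral>\<^sup>+x. (\<Sum>k. f (lattice_enum k + x) * indicator unit_cube x) \<partial>lborel)"
    by (intro nn_integral_suminf[symmetric]) measurable
  finally show ?thesis by simp
qed

context homogeneous_function
begin

lemma phi_measurable [measurable]: "\<phi> \<in> borel_measurable borel"
  by (rule borel_measurable_continuous_onI[OF phi_continuous])

lemma open_B_set: "open (B_set \<phi>)"
  unfolding B_set_def by (intro open_Collect_less phi_continuous continuous_intros)

lemma bounded_B_set: "bounded (B_set \<phi>)"
proof -
  obtain C m where C: "0 < C" "0 < m" "\<And>x. 1 \<le> norm x \<Longrightarrow> norm x \<le> C * exp (m * L x)"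
    using norm_le_exp_L by blast
  have "norm x \<le> max 1 C" if "\<phi> x < 1" for x
  proof (cases "1 \<le> norm x")
    case True
    then have "x \<noteq> 0" by auto
    then have "L x \<le> 0" using phi_pos[of x] that by (simp add: L_def)
    then have "C * exp (m * L x) \<le> C * 1" using C by (intro mult_left_mono) (auto simp: mult_nonneg_nonpos)
    then show ?thesis using C(3)[OF True] by simp
  qed auto
  then show ?thesis unfolding B_set_def bounded_iff by blast
qed

definition volume :: real where
  "volume = measure lborel (B_set \<phi>)"

lemma volume_pos: "0 < volume"
proof -
  have "0 \<in> B_set \<phi>" by (simp add: B_set_def)
  then obtain r where r: "0 < r" "ball 0 r \<subseteq> B_set \<phi>" using open_B_set open_contains_ball by blast
  have "0 < measure lborel (ball (0::real^'n) r)" using content_ball_pos[OF r(1)] .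
  also have "\<dots> \<le> volume"
    unfolding volume_def using open_B_set emeasure_bounded_finite[OF bounded_B_set]
    by (intro measure_mono_fmeasurable r(2)) (auto simp: fmeasurable_def)
  finally show ?thesis .
qed

lemma emeasure_sublevel:
  "emeasure lborel {x. \<phi> x < exp w} = ennreal (exp (w * trace A) * volume)"
proof -
  have eq: "{x. \<phi> x < exp w} = (\<lambda>x. mat_exp (w *\<^sub>R A) *v x) ` B_set \<phi>"
  proof -
    have "x \<in> T w ` B_set \<phi>" if "\<phi> x < exp w" for x
    proof (rule image_eqI)
      show "x = T w (T (- w) x)" by simp
      show "T (- w) x \<in> B_set \<phi>" using that by (simp add: B_set_def phi_T exp_minus field_simps)
    qed
    moreover have "\<phi> (T w x) < exp w" if "x \<in> B_set \<phi>" for x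
      using that by (simp add: B_set_def phi_T)
    ultimately have "{x. \<phi> x < exp w} = T w ` B_set \<phi>" by blast
    then show ?thesis by (simp add: T_def)
  qed
  have "bounded ((\<lambda>x. mat_exp (w *\<^sub>R A) *v x) ` B_set \<phi>)"
    by (intro bounded_linear_image bounded_B_set) (simp add: linear_conv_bounded_linear[symmetric])
  from emeasure_eq_ennreal_measure[of lborel, OF less_imp_neq[OF emeasure_bounded_finite[OF this, unfolded infinity_ennreal_def]]]
  show ?thesis
    by (simp add: eq measure_mat_exp_image[OF open_B_set bounded_B_set] volume_def)
qed

text \<open>
  For large \<open>U\<close> the map \<open>T (- U)\<close> sends the ball of radius 2 into the unit ball, so its determinant
  \<open>exp (- U trace A)\<close> is less than 1.
\<close>

lemma trace_pos: "0 < trace A"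
proof -
  obtain U where U: "0 < U" "\<And>u x. U \<le> u \<Longrightarrow> 2 * norm x \<le> norm (T u x)" using T_expands by blast
  have sub: "(\<lambda>x. mat_exp ((- U) *\<^sub>R A) *v x) ` ball (0::real^'n) 2 \<subseteq> ball 0 1"
  proof safe
    fix x :: "real^'n" assume "x \<in> ball 0 2"
    moreover have "2 * norm (T (- U) x) \<le> norm x" using U(2)[of U "T (- U) x"] by simp
    ultimately show "mat_exp ((- U) *\<^sub>R A) *v x \<in> ball 0 1" by (simp add: T_def)
  qed
  have "exp (- U * trace A) * measure lborel (ball (0::real^'n) 2)
      = measure lborel ((\<lambda>x. mat_exp ((- U) *\<^sub>R A) *v x) ` ball (0::real^'n) 2)"
    by (rule measure_mat_exp_image[symmetric]) auto
  also have "\<dots> \<le> measure lborel (ball (0::real^'n) 1)"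
  proof (rule measure_mono_fmeasurable[OF sub])
    show "(\<lambda>x. mat_exp ((- U) *\<^sub>R A) *v x) ` ball (0::real^'n) 2 \<in> sets lborel"
      using open_mat_exp_image[of "ball 0 2" "- U" A] by simp
  qed (use emeasure_lborel_ball_finite[of "0::real^'n" 1] in \<open>simp add: fmeasurable_def\<close>)
  also have "\<dots> < measure lborel (ball (0::real^'n) 2)"
    using content_ball_conv_unit_ball[of 2 "0::real^'n"] content_ball_pos[of 1 "0::real^'n"]
      power_strict_increasing[of 0 "CARD('n)" "2::real"] by simp
  finally have "exp (- U * trace A) < 1"
    using content_ball_pos[of 2 "0::real^'n"] by simp
  then show "0 < trace A" using U(1) by (simp add: zero_less_mult_iff)
qed

text \<open>
  The integral of \<open>\<psi>\<close>.
\<close>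

definition main_const :: real where
  "main_const = exp ((trace A)\<^sup>2 / 2) * volume"

text \<open>
  The layer cake formula: \<open>\<psi> (T (- u) y)\<close> is the Gaussian measure of the set of \<open>w\<close> with \<open>\<phi> y < exp (u + w)\<close>.
  After exchanging integrals the inner one is the volume of a sublevel set, an exponential in \<open>u + w\<close>, and
  the outer one a moment generating function.
\<close>

lemma psi_flow_integral:
  "(\<integral>\<^sup>+y. ennreal (\<psi> (T (- u) y)) \<partial>lborel) = ennreal (exp (u * trace A) * main_const)"
proof -
  have ae: "AE y in lborel. ennreal (\<psi> (T (- u) y))
      = (\<integral>\<^sup>+w. indicator {w. \<phi> y < exp (u + w)} w * ennreal (std_normal_density w) \<partial>lborel)"
  proof (rule AE_mp[OF AE_lborel_singleton[of 0]], rule AE_I2, rule impI)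
    fix y :: "real^'n" assume y: "y \<noteq> 0"
    have set_eq: "{w. \<phi> y < exp (u + w)} = {L y - u<..}"
      using exp_L[OF y] by (auto simp flip: exp_L[OF y])
    have "ennreal (\<psi> (T (- u) y)) = ennreal (LINT w|lborel. indicator {L y - u<..} w * std_normal_density w)"
      using y by (simp add: \<psi>_def L_T gauss_tail_def)
    also have "\<dots> = (\<integral>\<^sup>+w. ennreal (indicator {L y - u<..} w * std_normal_density w) \<partial>lborel)"
      by (rule nn_integral_eq_integral[symmetric]) auto
    also have "\<dots> = (\<integral>\<^sup>+w. indicator {w. \<phi> y < exp (u + w)} w * ennreal (std_normal_density w) \<partial>lborel)"
      unfolding set_eq by (intro nn_integral_cong) (auto simp: indicator_def)
    finally show "ennreal (\<psi> (T (- u) y))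
      = (\<integral>\<^sup>+w. indicator {w. \<phi> y < exp (u + w)} w * ennreal (std_normal_density w) \<partial>lborel)" .
  qed
  have ind: "indicator {w. \<phi> y < exp (u + w)} w = (indicator {y. \<phi> y < exp (u + w)} y :: ennreal)" for y w
    by (simp add: indicator_def)
  have "(\<integral>\<^sup>+y. ennreal (\<psi> (T (- u) y)) \<partial>lborel)
      = (\<integral>\<^sup>+y. (\<integral>\<^sup>+w. indicator {w. \<phi> y < exp (u + w)} w * ennreal (std_normal_density w) \<partial>lborel) \<partial>lborel)"
    by (rule nn_integral_cong_AE[OF ae])
  also have "\<dots> = (\<integral>\<^sup>+w. (\<integral>\<^sup>+y. indicator {w. \<phi> y < exp (u + w)} w * ennreal (std_normal_density w) \<partial>lborel) \<partial>lborel)"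
    by (intro lborel_pair.Fubini') measurable
  also have "\<dots> = (\<integral>\<^sup>+w. ennreal (exp (u * trace A) * volume * (std_normal_density w * exp (trace A * w))) \<partial>lborel)"
  proof (rule nn_integral_cong)
    fix w :: real
    have "(\<integral>\<^sup>+y. indicator {w. \<phi> y < exp (u + w)} w * ennreal (std_normal_density w) \<partial>lborel)
       = emeasure lborel {y. \<phi> y < exp (u + w)} * ennreal (std_normal_density w)"
      unfolding ind by (subst nn_integral_multc) auto
    also have "\<dots> = ennreal (exp (u * trace A) * volume * (std_normal_density w * exp (trace A * w)))"
      using volume_pos unfolding emeasure_sublevel
      by (simp add: ennreal_mult'[symmetric] algebra_simps exp_add)
    finally show "(\<integral>\<^sup>+y. indicator {w. \<phi> y < exp (u + w)} w * ennreal (std_normal_density w) \<partial>lborel)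
       = ennreal (exp (u * trace A) * volume * (std_normal_density w * exp (trace A * w)))" .
  qed
  also have "\<dots> = ennreal (LINT w|lborel. exp (u * trace A) * volume * (std_normal_density w * exp (trace A * w)))"
    using gauss_exp_integrable[of "trace A"] volume_pos
    by (intro nn_integral_eq_integral) auto
  also have "\<dots> = ennreal (exp (u * trace A) * main_const)"
    unfolding integral_mult_right_zero gauss_exp_integral main_const_def by (simp add: mult_ac)
  finally show ?thesis .
qed

lemma psi_measurable [measurable]: "\<psi> \<in> borel_measurable borel"
  by (intro borel_measurable_continuous_onI differentiable_imp_continuous_on
      differentiable_at_imp_differentiable_on psi_derivative)

lemma T_measurable [measurable]: "T u \<in> borel_measurable borel"
  by (intro borel_measurable_continuous_onI linear_continuous_on) (simp add: T_linear linear_conv_bounded_linear[symmetric])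

text \<open>
  The integral of the periodization over the unit cube is the main term, and on the cube the periodization differs from
  its value at \<open>0\<close> by at most the oscillation.
\<close>

lemma psi_periodization_asymptotics:
  "\<exists>C. \<forall>u\<ge>0. \<bar>flow_periodization \<psi> u 0 - exp (u * trace A) * main_const\<bar> \<le> C * exp (- k * u)"
proof -
  obtain C where C: "\<And>u. 0 \<le> u \<Longrightarrow> oscillation_le (flow_periodization \<psi> u) (C * exp (- k * u))"
    using psi_oscillation[of k] by blast
  obtain D where D: "\<And>x. \<bar>\<psi> x\<bar> \<le> D * decay_weight x" by (rule psi_decay) (rule that)
  show ?thesis
  proof (intro exI[of _ C] allI impI)
    fix u :: real assume u: "0 \<le> u"
    define P where "P = flow_periodization \<psi> u"
    define \<epsilon> where "\<epsilon> = C * exp (- k * u)"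
    define I where "I = exp (u * trace A) * main_const"
    have I0: "0 \<le> I" using volume_pos by (simp add: I_def main_const_def)
    have close: "\<bar>P x - P 0\<bar> \<le> \<epsilon>" if "x \<in> unit_cube" for x
      unfolding P_def \<epsilon>_def using that by (intro oscillation_leD[OF C[OF u]]) (auto simp: unit_cube_def abs_le_iff less_imp_le)
    have close': "P x \<le> P 0 + \<epsilon>" "P 0 - \<epsilon> \<le> P x" if "x \<in> unit_cube" for x
      using close[OF that] by linarith+
    have \<epsilon>0: "0 \<le> \<epsilon>" using close[of 0] by (simp add: unit_cube_def)
    have sums: "(\<lambda>j. \<psi> (T (- u) (lattice_enum j + x))) sums P x" for x
      unfolding P_def by (rule periodization_sums[OF flow_decay[OF D u]])
    have P0: "0 \<le> P x" for x by (rule sums_le[OF _ sums_zero sums]) (simp add: psi_nonneg)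
    have "ennreal I = (\<integral>\<^sup>+x. (\<Sum>j. ennreal (\<psi> (T (- u) (lattice_enum j + x)))) * indicator unit_cube x \<partial>lborel)"
      unfolding I_def psi_flow_integral[symmetric] by (rule nn_integral_lattice_tiling) measurable
    also have "\<dots> = (\<integral>\<^sup>+x. ennreal (P x) * indicator unit_cube x \<partial>lborel)"
      using sums by (simp add: suminf_ennreal2 psi_nonneg sums_iff)
    finally have int: "ennreal I = (\<integral>\<^sup>+x. ennreal (P x) * indicator unit_cube x \<partial>lborel)" .
    have const: "(\<integral>\<^sup>+x. ennreal c * indicator (unit_cube :: (real^'n) set) x \<partial>lborel) = ennreal c" for c
      by (simp add: nn_integral_cmult_indicator emeasure_unit_cube)
    have "ennreal I \<le> (\<integral>\<^sup>+x. ennreal (P 0 + \<epsilon>) * indicator (unit_cube :: (real^'n) set) x \<partial>lborel)"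
      unfolding int using close' by (intro nn_integral_mono) (auto simp: indicator_def intro!: ennreal_leI)
    then have 1: "I \<le> P 0 + \<epsilon>" using P0[of 0] \<epsilon>0 unfolding const by (simp del: ennreal_plus)
    have "(\<integral>\<^sup>+x. ennreal (P 0 - \<epsilon>) * indicator (unit_cube :: (real^'n) set) x \<partial>lborel) \<le> ennreal I"
      unfolding int using close' by (intro nn_integral_mono) (auto simp: indicator_def intro!: ennreal_leI)
    then have 2: "P 0 - \<epsilon> \<le> I" using I0 unfolding const by simp
    show "\<bar>flow_periodization \<psi> u 0 - exp (u * trace A) * main_const\<bar> \<le> C * exp (- k * u)"
      using 1 2 by (simp add: P_def I_def \<epsilon>_def abs_le_iff)
  qed
qed

definition lattice_count :: "real \<Rightarrow> real" where
  "lattice_count u = (\<Sum>\<^sub>\<infinity>\<omega>\<in>int_lattice - {0}. gauss_tail (L \<omega> - u))"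

text \<open>
  Convergence of the zeta series far to the right, from the polynomial growth of \<open>\<phi>\<close>; the exact abscissa
  \<open>trace A\<close> comes only from the asymptotics of the smoothed count.
\<close>

lemma exp_L_summable:
  obtains k where "0 \<le> k" "\<And>j. k \<le> j \<Longrightarrow> (\<lambda>\<omega>. exp (- j * L \<omega>)) summable_on (int_lattice - {0})"
proof -
  obtain C m where C: "0 < C" "0 < m" "\<And>x. 1 \<le> norm x \<Longrightarrow> norm x \<le> C * exp (m * L x)"
    using norm_le_exp_L by blast
  \<comment> \<open>At this rate the summands are bounded by a multiple of \<open>decay_weight\<close>; a larger rate only costs a constant,
      because \<open>L\<close> is bounded below on the nonzero lattice points.\<close>
  define k where "k = m * (2 * CARD('n))"
  have k: "0 \<le> k" using C by (simp add: k_def)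
  have le: "exp (- j * L \<omega>) \<le> exp ((j - k) * (ln C / m)) * (2 * C) ^ (2 * CARD('n)) * decay_weight \<omega>"
    if j: "k \<le> j" and \<omega>: "\<omega> \<in> int_lattice - {0}" for j \<omega>
  proof -
    have n1: "1 \<le> norm \<omega>" using norm_int_lattice_ge_1 \<omega> by blast
    have n: "norm \<omega> \<le> C * exp (m * L \<omega>)" by (rule C(3)[OF n1])
    have "1 \<le> C * exp (m * L \<omega>)" using n n1 by linarith
    then have "ln 1 \<le> ln (C * exp (m * L \<omega>))" using C by (intro ln_mono) auto
    then have "- L \<omega> \<le> ln C / m" using C by (simp add: ln_mult field_simps)
    then have 1: "exp ((j - k) * - L \<omega>) \<le> exp ((j - k) * (ln C / m))"
      using j mult_left_mono[of "- L \<omega>" "ln C / m" "j - k"] by (simp only: exp_le_cancel_iff diff_ge_0_iff_ge)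
    have "exp (- m * L \<omega>) * (1 + norm \<omega>) \<le> exp (- m * L \<omega>) * (2 * (C * exp (m * L \<omega>)))"
      using n n1 by (intro mult_left_mono) auto
    also have "\<dots> = 2 * C" by (simp add: exp_minus)
    finally have "(exp (- m * L \<omega>) * (1 + norm \<omega>)) ^ (2 * CARD('n)) \<le> (2 * C) ^ (2 * CARD('n))"
      using n1 by (intro power_mono) auto
    then have "exp (- k * L \<omega>) * (1 + norm \<omega>) ^ (2 * CARD('n)) \<le> (2 * C) ^ (2 * CARD('n))"
      by (simp add: power_mult_distrib exp_of_nat_mult[symmetric] k_def mult_ac)
    moreover have "0 < (1 + norm \<omega>) ^ (2 * CARD('n))" using n1 by (intro zero_less_power) linarith
    ultimately have 2: "exp (- k * L \<omega>) \<le> (2 * C) ^ (2 * CARD('n)) * decay_weight \<omega>"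
      by (simp add: decay_weight_def field_simps)
    have "exp (- j * L \<omega>) = exp ((j - k) * - L \<omega>) * exp (- k * L \<omega>)"
      by (simp add: exp_add[symmetric] algebra_simps)
    also have "\<dots> \<le> exp ((j - k) * (ln C / m)) * ((2 * C) ^ (2 * CARD('n)) * decay_weight \<omega>)"
      by (intro mult_mono 1 2) auto
    finally show ?thesis by (simp add: mult.assoc)
  qed
  show ?thesis
  proof (rule that[OF k])
    fix j assume j: "k \<le> j"
    show "(\<lambda>\<omega>. exp (- j * L \<omega>)) summable_on (int_lattice - {0})"
    proof (rule summable_on_comparison_test)
      show "(\<lambda>\<omega>. exp ((j - k) * (ln C / m)) * (2 * C) ^ (2 * CARD('n)) * decay_weight \<omega>) summable_on (int_lattice - {0})"
        by (intro summable_on_cmult_right summable_on_subset_banach[OF summable_decay_weight]) auto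
    qed (use le[OF j] in auto)
  qed
qed

lemma gauss_tail_L_le:
  assumes "0 \<le> k"
  shows "gauss_tail (L x - u) \<le> exp (k\<^sup>2 / 2) * exp (k * u) * exp (- k * L x)"
proof -
  have "exp (- k * (L x - u)) = exp (k * u) * exp (- k * L x)"
    by (simp add: exp_add[symmetric] algebra_simps)
  then show ?thesis using gauss_tail_le_exp[OF assms, of "L x - u"] by (simp add: mult.assoc)
qed

lemma gauss_tail_lattice_summable:
  "(\<lambda>\<omega>. gauss_tail (L \<omega> - u)) summable_on (int_lattice - {0})"
proof -
  obtain k where k: "0 \<le> k" "\<And>j. k \<le> j \<Longrightarrow> (\<lambda>\<omega>. exp (- j * L \<omega>)) summable_on (int_lattice - {0})"
    using exp_L_summable by blast
  show ?thesis
  proof (rule summable_on_comparison_test)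
    show "(\<lambda>\<omega>. exp (k\<^sup>2 / 2) * exp (k * u) * exp (- k * L \<omega>)) summable_on (int_lattice - {0})"
      by (intro summable_on_cmult_right k) simp
    show "gauss_tail (L \<omega> - u) \<le> exp (k\<^sup>2 / 2) * exp (k * u) * exp (- k * L \<omega>)" for \<omega>
    by (rule gauss_tail_L_le) (rule k(1))
  qed (simp add: gauss_tail_nonneg)
qed

lemma lattice_count_nonneg: "0 \<le> lattice_count u"
  unfolding lattice_count_def by (rule infsum_nonneg) (simp add: gauss_tail_nonneg)

lemma lattice_count_at_bot:
  "\<exists>C. \<forall>u\<le>0. lattice_count u \<le> C * exp (k * u)"
proof -
  obtain k0 where k0: "0 \<le> k0" "\<And>j. k0 \<le> j \<Longrightarrow> (\<lambda>\<omega>. exp (- j * L \<omega>)) summable_on (int_lattice - {0})"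
    using exp_L_summable by blast
  define j where "j = max k k0"
  have j: "0 \<le> j" "k0 \<le> j" "k \<le> j" using k0(1) by (auto simp: j_def)
  define S where "S = (\<Sum>\<^sub>\<infinity>\<omega>\<in>int_lattice - {0}. exp (- j * L \<omega>))"
  have S: "0 \<le> S" unfolding S_def by (rule infsum_nonneg) simp
  show ?thesis
  proof (intro exI[of _ "exp (j\<^sup>2 / 2) * S"] allI impI)
    fix u :: real assume u: "u \<le> 0"
    have "lattice_count u \<le> (\<Sum>\<^sub>\<infinity>\<omega>\<in>int_lattice - {0}. exp (j\<^sup>2 / 2) * exp (j * u) * exp (- j * L \<omega>))"
      unfolding lattice_count_def
    proof (rule infsum_mono[OF gauss_tail_lattice_summable])
      show "(\<lambda>\<omega>. exp (j\<^sup>2 / 2) * exp (j * u) * exp (- j * L \<omega>)) summable_on (int_lattice - {0})"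
        by (intro summable_on_cmult_right k0 j)
      show "gauss_tail (L \<omega> - u) \<le> exp (j\<^sup>2 / 2) * exp (j * u) * exp (- j * L \<omega>)" for \<omega>
      by (rule gauss_tail_L_le) (rule j(1))
    qed
    also have "\<dots> = exp (j\<^sup>2 / 2) * S * exp (j * u)"
      unfolding S_def infsum_cmult_right' by (simp only: mult_ac)
    also have "\<dots> \<le> exp (j\<^sup>2 / 2) * S * exp (k * u)"
      using S j(3) u by (intro mult_left_mono) (auto intro: mult_right_mono_neg)
    finally show "lattice_count u \<le> exp (j\<^sup>2 / 2) * S * exp (k * u)" .
  qed
qed

text \<open>
  The difference is the term of the lattice point \<open>0\<close>, at which \<open>\<psi>\<close> is \<open>1\<close>.
\<close>

lemma lattice_count_eq_periodization:
  assumes "0 \<le> u"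
  shows "lattice_count u = flow_periodization \<psi> u 0 - 1"
proof -
  obtain D where D: "\<And>x. \<bar>\<psi> x\<bar> \<le> D * decay_weight x" by (rule psi_decay) (rule that)
  have "((\<lambda>\<omega>. \<psi> (T (- u) \<omega>)) has_sum flow_periodization \<psi> u 0) int_lattice"
    using periodization_has_sum[OF flow_decay[OF D assms], of 0] by simp
  moreover have "((\<lambda>\<omega>. \<psi> (T (- u) \<omega>)) has_sum 1) {0}"
    by (simp add: has_sum_finite_iff \<psi>_def)
  ultimately have "((\<lambda>\<omega>. \<psi> (T (- u) \<omega>)) has_sum (flow_periodization \<psi> u 0 - 1)) (int_lattice - {0})"
    by (rule has_sum_Diff) (simp add: zero_in_int_lattice)
  then have "(\<Sum>\<^sub>\<infinity>\<omega>\<in>int_lattice - {0}. \<psi> (T (- u) \<omega>)) = flow_periodization \<psi> u 0 - 1"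
    by (rule infsumI)
  moreover have "lattice_count u = (\<Sum>\<^sub>\<infinity>\<omega>\<in>int_lattice - {0}. \<psi> (T (- u) \<omega>))"
    unfolding lattice_count_def by (rule infsum_cong) (simp add: \<psi>_def L_T)
  ultimately show ?thesis by simp
qed

lemma lattice_count_at_top:
  "\<exists>C. \<forall>u\<ge>0. \<bar>lattice_count u - (exp (u * trace A) * main_const - 1)\<bar> \<le> C * exp (- k * u)"
  using psi_periodization_asymptotics[of k] by (simp add: lattice_count_eq_periodization)

end

section \<open>Analytic continuation\<close>

lemma integral_sums_dominated:
  fixes f :: "nat \<Rightarrow> real \<Rightarrow> complex"
  assumes meas: "\<And>n. f n \<in> borel_measurable borel"
    and norms: "\<And>u. (\<lambda>n. norm (f n u)) sums g u" and g: "integrable lborel g"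
    and sums: "\<And>u. (\<lambda>n. f n u) sums F u"
  shows "integrable lborel F" "(\<lambda>n. LINT u|lborel. f n u) sums (LINT u|lborel. F u)"
    "summable (\<lambda>n. norm (LINT u|lborel. f n u))"
proof -
  have partial: "(\<Sum>n\<le>m. norm (f n u)) \<le> g u" for m u
    using norms[of u] sum_le_suminf[of "\<lambda>n. norm (f n u)" "{..m}"] by (auto simp: sums_iff)
  have single: "norm (f n u) \<le> g u" for n u
    using partial[where m = n and u = u] member_le_sum[of n "{..n}" "\<lambda>n. norm (f n u)"] by simp
  have int_f: "integrable lborel (f n)" for n
    by (rule Bochner_Integration.integrable_bound[OF g])
      (use meas in \<open>auto intro!: AE_I2 order_trans[OF single]\<close>)
  have summ: "summable (\<lambda>n. LINT u|lborel. norm (f n u))"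
  proof (rule bounded_imp_summable)
    fix m
    have "(\<Sum>n\<le>m. LINT u|lborel. norm (f n u)) = (LINT u|lborel. (\<Sum>n\<le>m. norm (f n u)))"
      by (rule Bochner_Integration.integral_sum[symmetric]) (simp add: int_f)
    also have "\<dots> \<le> (LINT u|lborel. g u)"
      by (intro integral_mono g partial Bochner_Integration.integrable_sum) (simp add: int_f)
    finally show "(\<Sum>n\<le>m. LINT u|lborel. norm (f n u)) \<le> (LINT u|lborel. g u)" .
  qed simp
  have ae: "AE u in lborel. summable (\<lambda>n. norm (f n u))"
    using norms by (auto simp: sums_iff)
  have eq: "(\<lambda>u. \<Sum>n. f n u) = F" using sums by (auto simp: sums_iff)
  show "integrable lborel F" "(\<lambda>n. LINT u|lborel. f n u) sums (LINT u|lborel. F u)"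
    using integrable_suminf[OF int_f ae summ] sums_integral[OF int_f ae summ] unfolding eq .
  show "summable (\<lambda>n. norm (LINT u|lborel. f n u))"
    by (rule summable_comparison_test'[OF summ]) (simp add: integral_norm_bound)
qed

text \<open>
  Expanding the exponential and integrating termwise gives a power series that converges everywhere, since \<open>r\<close> decays
  faster than every exponential.
\<close>

lemma laplace_transform_entire:
  fixes r :: "real \<Rightarrow> real"
  assumes meas [measurable]: "r \<in> borel_measurable borel"
    and bound: "\<And>k. \<exists>C. \<forall>u. \<bar>r u\<bar> \<le> C * exp (- k * \<bar>u\<bar>)"
  shows "integrable lborel (\<lambda>u. of_real (r u) * exp (- s * complex_of_real u))"
    and "(\<lambda>s. LINT u|lborel. of_real (r u) * exp (- s * complex_of_real u)) holomorphic_on UNIV"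
proof -
  have dom: "integrable lborel (\<lambda>u. \<bar>r u\<bar> * exp (norm s * \<bar>u\<bar>))" for s :: complex
  proof -
    obtain C where C: "\<And>u. \<bar>r u\<bar> \<le> C * exp (- (norm s + 1) * \<bar>u\<bar>)" using bound by blast
    show ?thesis
    proof (rule Bochner_Integration.integrable_bound)
      show "integrable lborel (\<lambda>u. C * exp (- 1 * \<bar>u\<bar>))"
        by (intro integrable_mult_right exp_abs_integrable) simp
      have "\<bar>r u\<bar> * exp (norm s * \<bar>u\<bar>) \<le> C * exp (- 1 * \<bar>u\<bar>)" for u
      proof -
        have "\<bar>r u\<bar> * exp (norm s * \<bar>u\<bar>) \<le> (C * exp (- (norm s + 1) * \<bar>u\<bar>)) * exp (norm s * \<bar>u\<bar>)"
          by (intro mult_right_mono C) simp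
        also have "\<dots> = C * (exp (- (norm s + 1) * \<bar>u\<bar>) * exp (norm s * \<bar>u\<bar>))" by (simp only: mult.assoc)
        also have "exp (- (norm s + 1) * \<bar>u\<bar>) * exp (norm s * \<bar>u\<bar>) = exp (- 1 * \<bar>u\<bar>)"
          by (simp add: exp_add[symmetric] algebra_simps)
        finally show ?thesis .
      qed
      then show "AE u in lborel. norm (\<bar>r u\<bar> * exp (norm s * \<bar>u\<bar>)) \<le> norm (C * exp (- 1 * \<bar>u\<bar>))"
        by (intro AE_I2) (simp, meson abs_ge_self order_trans)
    qed measurable
  qed
  define f where "f s n u = of_real (r u) * ((- s * complex_of_real u) ^ n /\<^sub>R fact n)" for s n u
  have f_meas [measurable]: "f s n \<in> borel_measurable borel" for s n unfolding f_def by measurable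
  have norm_f: "norm (f s n u) = \<bar>r u\<bar> * ((norm s * \<bar>u\<bar>) ^ n /\<^sub>R fact n)" for s n u
    by (simp add: f_def norm_mult norm_power)
  have f_sums: "(\<lambda>n. f s n u) sums (of_real (r u) * exp (- s * complex_of_real u))" for s u
    unfolding f_def by (intro sums_mult exp_converges)
  have norm_sums: "(\<lambda>n. norm (f s n u)) sums (\<bar>r u\<bar> * exp (norm s * \<bar>u\<bar>))" for s u
    unfolding norm_f by (intro sums_mult exp_converges)
  show "integrable lborel (\<lambda>u. of_real (r u) * exp (- s * complex_of_real u))"
    by (rule integral_sums_dominated(1)[OF f_meas norm_sums dom f_sums])
  define a where "a n = (LINT u|lborel. f 1 n u)" for n
  have scale: "(LINT u|lborel. f s n u) = a n * (s - 0) ^ n" for s n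
  proof -
    have "f s n u = f 1 n u * s ^ n" for u
      by (simp add: f_def power_mult_distrib power_minus[of s] power_minus[of "complex_of_real u"] power_minus[of "s * complex_of_real u"])
    then show ?thesis by (simp add: a_def)
  qed
  have sums: "(\<lambda>n. a n * (s - 0) ^ n) sums (LINT u|lborel. of_real (r u) * exp (- s * complex_of_real u))" for s
    using integral_sums_dominated(2)[OF f_meas norm_sums dom f_sums, of s] unfolding scale .
  show "(\<lambda>s. LINT u|lborel. of_real (r u) * exp (- s * complex_of_real u)) holomorphic_on UNIV"
  proof (rule holomorphic_onI)
    fix s :: complex
    have "(\<lambda>s. LINT u|lborel. of_real (r u) * exp (- s * complex_of_real u)) holomorphic_on ball 0 (norm s + 1)"
      by (rule power_series_holomorphic[OF sums])
    then show "(\<lambda>s. LINT u|lborel. of_real (r u) * exp (- s * complex_of_real u)) field_differentiable at s within UNIV"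
      by (auto simp: holomorphic_on_open field_differentiable_def)
  qed
qed

lemma simple_pole_quotient:
  assumes "f holomorphic_on UNIV" "f z \<noteq> 0"
  shows "is_pole (\<lambda>w. f w / (w - z)) z" "zorder (\<lambda>w. f w / (w - z)) z = - 1"
    "residue (\<lambda>w. f w / (w - z)) z = f z"
proof -
  show "residue (\<lambda>w. f w / (w - z)) z = f z"
    by (rule residue_simple[OF open_UNIV UNIV_I assms(1)])
  show "zorder (\<lambda>w. f w / (w - z)) z = - 1"
    by (rule zorder_eqI[OF open_UNIV UNIV_I assms]) (simp add: power_int_minus field_simps)
  have "isCont f z"
    using holomorphic_on_imp_continuous_on[OF assms(1)] by (simp add: continuous_on_eq_continuous_at)
  moreover have "filterlim (\<lambda>w. w - z) (at 0) (at z)"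
    by (auto simp: filterlim_at eventually_at_filter intro!: tendsto_eq_intros)
  ultimately show "is_pole (\<lambda>w. f w / (w - z)) z"
    using assms(2) by (rule is_pole_divide)
qed

context homogeneous_function
begin

abbreviation nonzero_enum :: "nat \<Rightarrow> real^'n" where
  "nonzero_enum \<equiv> from_nat_into (int_lattice - {0})"

lemma bij_nonzero_enum: "bij_betw nonzero_enum UNIV (int_lattice - {0})"
  by (rule bij_betw_from_nat_into) (simp_all add: countable_int_lattice infinite_int_lattice)

lemma nonzero_enum_in: "nonzero_enum k \<in> int_lattice" "nonzero_enum k \<noteq> 0"
  using bij_nonzero_enum by (auto simp: bij_betw_def)

lemma lattice_count_sums: "(\<lambda>k. gauss_tail (L (nonzero_enum k) - u)) sums lattice_count u"
proof (rule has_sum_imp_sums)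
  have "((\<lambda>\<omega>. gauss_tail (L \<omega> - u)) has_sum lattice_count u) (int_lattice - {0})"
    unfolding lattice_count_def by (rule has_sum_infsum[OF gauss_tail_lattice_summable])
  then show "((\<lambda>k. gauss_tail (L (nonzero_enum k) - u)) has_sum lattice_count u) UNIV"
    by (simp add: has_sum_reindex_bij_betw[OF bij_nonzero_enum, of "\<lambda>\<omega>. gauss_tail (L \<omega> - u)"])
qed

lemma lattice_count_measurable [measurable]: "lattice_count \<in> borel_measurable borel"
proof -
  have "(\<lambda>u. \<Sum>k. gauss_tail (L (nonzero_enum k) - u)) \<in> borel_measurable borel" by measurable
  moreover have "(\<lambda>u. \<Sum>k. gauss_tail (L (nonzero_enum k) - u)) = lattice_count"
    using lattice_count_sums by (simp add: fun_eq_iff sums_iff)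
  ultimately show ?thesis by simp
qed

definition remainder :: "real \<Rightarrow> real" where
  "remainder u = lattice_count u - indicator {0..} u * (main_const * exp (trace A * u) - 1)"

lemma remainder_measurable [measurable]: "remainder \<in> borel_measurable borel"
  unfolding remainder_def[abs_def] by measurable

lemma remainder_bound: "\<exists>C. \<forall>u. \<bar>remainder u\<bar> \<le> C * exp (- k * \<bar>u\<bar>)"
proof -
  obtain C1 where C1: "\<And>u. u \<le> 0 \<Longrightarrow> lattice_count u \<le> C1 * exp (k * u)"
    using lattice_count_at_bot[of k] by blast
  obtain C2 where C2: "\<And>u. 0 \<le> u \<Longrightarrow> \<bar>lattice_count u - (exp (u * trace A) * main_const - 1)\<bar> \<le> C2 * exp (- k * u)"
    using lattice_count_at_top[of k] by blast
  have "\<bar>remainder u\<bar> \<le> max C1 C2 * exp (- k * \<bar>u\<bar>)" for u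
  proof (cases "0 \<le> u")
    case True
    then have "\<bar>remainder u\<bar> \<le> C2 * exp (- k * \<bar>u\<bar>)"
      using C2[OF True] by (simp add: remainder_def mult.commute)
    also have "\<dots> \<le> max C1 C2 * exp (- k * \<bar>u\<bar>)" by (intro mult_right_mono) auto
    finally show ?thesis .
  next
    case False
    then have "\<bar>remainder u\<bar> \<le> C1 * exp (- k * \<bar>u\<bar>)"
      using C1[of u] lattice_count_nonneg[of u] by (simp add: remainder_def)
    also have "\<dots> \<le> max C1 C2 * exp (- k * \<bar>u\<bar>)" by (intro mult_right_mono) auto
    finally show ?thesis .
  qed
  then show ?thesis by blast
qed

definition remainder_transform :: "complex \<Rightarrow> complex" where
  "remainder_transform s = (LINT u|lborel. of_real (remainder u) * exp (- s * complex_of_real u))"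

lemma remainder_transform_entire: "remainder_transform holomorphic_on UNIV"
  unfolding remainder_transform_def[abs_def]
  by (rule laplace_transform_entire(2)[OF remainder_measurable remainder_bound])

text \<open>
  The Laplace transform of \<open>lattice_count\<close>: that of \<open>remainder\<close>, plus those of the two main terms on the half line.
\<close>

definition count_transform :: "complex \<Rightarrow> complex" where
  "count_transform s = remainder_transform s + (of_real main_const * (1 / (s - of_real (trace A))) - 1 / s)"

lemma lattice_count_laplace:
  assumes s: "trace A < Re s"
  shows "has_bochner_integral lborel (\<lambda>u. of_real (lattice_count u) * exp (- s * complex_of_real u))
    (count_transform s)"
proof -
  have "has_bochner_integral lborel (\<lambda>u. of_real (remainder u) * exp (- s * complex_of_real u)) (remainder_transform s)"
    using laplace_transform_entire(1)[OF remainder_measurable remainder_bound]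
    by (simp add: has_bochner_integral_iff remainder_transform_def)
  moreover have "has_bochner_integral lborel (\<lambda>u. of_real main_const *
      (indicator {0..} u *\<^sub>R exp (- (s - of_real (trace A)) * complex_of_real u)) -
      indicator {0..} u *\<^sub>R exp (- s * complex_of_real u))
      (of_real main_const * (1 / (s - of_real (trace A))) - 1 / s)"
    using s trace_pos by (intro has_bochner_integral_diff has_bochner_integral_mult_right half_line_complex_exp) auto
  ultimately have "has_bochner_integral lborel (\<lambda>u. of_real (remainder u) * exp (- s * complex_of_real u) +
      (of_real main_const *
      (indicator {0..} u *\<^sub>R exp (- (s - of_real (trace A)) * complex_of_real u)) -
      indicator {0..} u *\<^sub>R exp (- s * complex_of_real u)))
    (count_transform s)"
    unfolding count_transform_def by (rule has_bochner_integral_add)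
  moreover have "of_real (remainder u) * exp (- s * complex_of_real u) +
      (of_real main_const *
      (indicator {0..} u *\<^sub>R exp (- (s - of_real (trace A)) * complex_of_real u)) -
      indicator {0..} u *\<^sub>R exp (- s * complex_of_real u))
      = of_real (lattice_count u) * exp (- s * complex_of_real u)" for u
  proof -
    have "exp (- (s - of_real (trace A)) * complex_of_real u)
       = complex_of_real (exp (trace A * u)) * exp (- s * complex_of_real u)"
      by (simp add: exp_of_real[symmetric] exp_add[symmetric] algebra_simps del: exp_of_real)
    then show ?thesis by (simp add: remainder_def indicator_def algebra_simps)
  qed
  ultimately show ?thesis by simp
qed

lemma zeta_term_eq: "\<omega> \<noteq> 0 \<Longrightarrow> zeta_term \<phi> s \<omega> = exp (- s * of_real (L \<omega>))"
  using phi_pos[of \<omega>] by (simp add: zeta_term_def powr_def Ln_of_real L_def)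

text \<open>
  The transform of the smoothed count, computed termwise.  Since the weights are positive, the case of the real
  exponent \<open>Re s\<close> dominates and shows absolute convergence in the whole half plane.
\<close>

lemma zeta_terms_sum:
  assumes s: "trace A < Re s"
  shows "summable (\<lambda>k. norm (zeta_term \<phi> s (nonzero_enum k)))"
    and "(\<lambda>k. zeta_term \<phi> s (nonzero_enum k)) sums
      (exp (- s\<^sup>2 / 2) * (s * count_transform s))"
proof -
  have Re: "0 < Re s" using s trace_pos by linarith
  then have s0: "s \<noteq> 0" by auto
  define f where "f k u = of_real (gauss_tail (L (nonzero_enum k) - u)) * exp (- s * complex_of_real u)" for k u
  \<comment> \<open>The zero-free factor that relates the two transforms.\<close>
  define I where "I = exp (s\<^sup>2 / 2) / s"
  have I: "I \<noteq> 0" using s0 by (simp add: I_def)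
  have f: "has_bochner_integral lborel (f k) (zeta_term \<phi> s (nonzero_enum k) * I)" for k
    using gauss_tail_laplace[OF Re, of "L (nonzero_enum k)"]
    by (simp add: f_def[abs_def] I_def zeta_term_eq[OF nonzero_enum_in(2)])
  define F where "F u = of_real (lattice_count u) * exp (- s * complex_of_real u)" for u
  have F: "has_bochner_integral lborel F (count_transform s)"
    unfolding F_def[abs_def] by (rule lattice_count_laplace[OF s])
  have f_meas: "f k \<in> borel_measurable borel" for k
    unfolding f_def[abs_def] by measurable
  have f_sums: "(\<lambda>k. f k u) sums F u" for u
    unfolding f_def F_def by (intro sums_mult2 sums_of_real lattice_count_sums)
  have norm_f: "norm (f k u) = gauss_tail (L (nonzero_enum k) - u) * exp (- Re s * u)" for k u
    by (simp add: f_def norm_mult gauss_tail_nonneg)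
  have norm_sums: "(\<lambda>k. norm (f k u)) sums (lattice_count u * exp (- Re s * u))" for u
    unfolding norm_f by (intro sums_mult2 lattice_count_sums)
  have "norm (F u) = lattice_count u * exp (- Re s * u)" for u
    by (simp add: F_def norm_mult lattice_count_nonneg)
  then have dom: "integrable lborel (\<lambda>u. lattice_count u * exp (- Re s * u))"
    using integrable_norm[of lborel F] F by (simp add: has_bochner_integral_iff)
  note termwise = integral_sums_dominated[OF f_meas norm_sums dom f_sums]
  have int_eq: "(LINT u|lborel. f k u) = zeta_term \<phi> s (nonzero_enum k) * I" for k
    using f by (rule has_bochner_integral_integral_eq)
  have "summable (\<lambda>k. norm (zeta_term \<phi> s (nonzero_enum k)) * norm I)"
    using termwise(3) by (simp add: int_eq norm_mult)
  from summable_mult2[OF this, of "inverse (norm I)"]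
  show "summable (\<lambda>k. norm (zeta_term \<phi> s (nonzero_enum k)))"
    using I by (simp add: mult.assoc)
  have "(\<lambda>k. zeta_term \<phi> s (nonzero_enum k) * I) sums count_transform s"
    using termwise(2) has_bochner_integral_integral_eq[OF F] unfolding int_eq by simp
  from sums_mult2[OF this, of "inverse I"]
  have "(\<lambda>k. zeta_term \<phi> s (nonzero_enum k)) sums (count_transform s * inverse I)"
    using I by (simp only: mult.assoc right_inverse mult_1_right not_False_eq_True)
  moreover have "count_transform s * inverse I = exp (- s\<^sup>2 / 2) * (s * count_transform s)"
  proof -
    have "inverse I = s / exp (s\<^sup>2 / 2)" by (simp add: I_def)
    moreover have "exp (- s\<^sup>2 / 2) = 1 / exp (s\<^sup>2 / 2)" by (simp add: exp_minus inverse_eq_divide)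
    moreover have "count_transform s * (s / e) = 1 / e * (s * count_transform s)" for e by (simp add: mult.commute)
    ultimately show ?thesis by (simp only:)
  qed
  ultimately show "(\<lambda>k. zeta_term \<phi> s (nonzero_enum k)) sums (exp (- s\<^sup>2 / 2) * (s * count_transform s))"
    by (simp only:)
qed

lemma zeta_series_has_sum:
  assumes s: "trace A < Re s"
  shows "(zeta_term \<phi> s has_sum
      (exp (- s\<^sup>2 / 2) * (s * count_transform s)))
    (int_lattice - {0})"
  using norm_summable_imp_has_sum[OF zeta_terms_sum[OF s]]
  by (simp add: has_sum_reindex_bij_betw[OF bij_nonzero_enum, of "zeta_term \<phi> s"])

text \<open>
  The zeta function with its pole cleared, written as an entire function.
\<close>

definition numerator :: "complex \<Rightarrow> complex" where
  "numerator s = exp (- s\<^sup>2 / 2) *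
    ((s * remainder_transform s - 1) * (s - of_real (trace A)) + s * of_real main_const)"

definition continued_zeta :: "complex \<Rightarrow> complex" where
  "continued_zeta s = numerator s / (s - of_real (trace A))"

lemma numerator_entire: "numerator holomorphic_on UNIV"
  unfolding numerator_def[abs_def] by (intro holomorphic_intros remainder_transform_entire) auto

lemma numerator_at_trace: "numerator (of_real (trace A)) = of_real (trace A * volume)"
proof -
  have "exp (- (trace A)\<^sup>2 / 2) * main_const = volume"
    by (simp add: main_const_def exp_minus)
  moreover have "numerator (of_real (trace A)) = of_real (trace A * (exp (- (trace A)\<^sup>2 / 2) * main_const))"
    by (simp add: numerator_def exp_of_real[symmetric] del: exp_of_real)
  ultimately show ?thesis by simp
qed

lemma continued_zeta_holomorphic: "continued_zeta holomorphic_on (UNIV - {of_real (trace A)})"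
  unfolding continued_zeta_def[abs_def]
  by (intro holomorphic_intros holomorphic_on_subset[OF numerator_entire]) auto

lemma continued_zeta_eq:
  assumes s: "trace A < Re s"
  shows "continued_zeta s = zeta_series \<phi> s"
proof -
  have "s \<noteq> 0" "s - of_real (trace A) \<noteq> 0" using s trace_pos by auto
  then have "continued_zeta s =
      exp (- s\<^sup>2 / 2) * (s * count_transform s)"
    by (simp add: continued_zeta_def numerator_def count_transform_def field_simps)
  then show ?thesis
    unfolding zeta_series_def using infsumI[OF zeta_series_has_sum[OF s]] by simp
qed

lemma zeta_series_holomorphic: "zeta_series \<phi> holomorphic_on {s. trace A < Re s}"
proof -
  have "continued_zeta holomorphic_on {s. trace A < Re s}"
    by (rule holomorphic_on_subset[OF continued_zeta_holomorphic]) auto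
  then show ?thesis by (rule holomorphic_transform) (simp add: continued_zeta_eq)
qed

lemma continued_zeta_pole:
  "is_pole continued_zeta (of_real (trace A))"
  "zorder continued_zeta (of_real (trace A)) = - 1"
  "residue continued_zeta (of_real (trace A)) = of_real (trace A * volume)"
proof -
  have "numerator (of_real (trace A)) \<noteq> 0"
    using trace_pos volume_pos by (simp add: numerator_at_trace)
  from simple_pole_quotient[OF numerator_entire this]
  show "is_pole continued_zeta (of_real (trace A))"
    "zorder continued_zeta (of_real (trace A)) = - 1"
    "residue continued_zeta (of_real (trace A)) = of_real (trace A * volume)"
    by (simp_all add: continued_zeta_def[abs_def] numerator_at_trace)
qed

lemma continued_zeta_0: "continued_zeta 0 = - 1"
  using trace_pos by (simp add: continued_zeta_def numerator_def)

lemma volume_eq_lebesgue: "volume = measure lebesgue (B_set \<phi>)"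
  using open_B_set by (simp add: volume_def measure_completion)

end

theorem theorem1p1:
  fixes A :: "real^'n^'n" and \<phi> :: "real^'n \<Rightarrow> real" and \<alpha> :: real
  assumes "A \<in> M_plus"
    and "\<alpha> = trace A"
    and "continuous_on UNIV \<phi>"
    and "Cinfinity_on (UNIV - {0}) \<phi>"
    and "positive_homogeneous A \<phi>"
  shows "(\<forall>s. \<alpha> < Re s \<longrightarrow> zeta_term \<phi> s summable_on (int_lattice - {0})) \<and>
    zeta_series \<phi> holomorphic_on {s. \<alpha> < Re s} \<and>
    (\<exists>Z. Z holomorphic_on (UNIV - {complex_of_real \<alpha>}) \<and>
      (\<forall>s. \<alpha> < Re s \<longrightarrow> Z s = zeta_series \<phi> s) \<and>
      is_pole Z (complex_of_real \<alpha>) \<and>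
      zorder Z (complex_of_real \<alpha>) = - 1 \<and>
      residue Z (complex_of_real \<alpha>) = complex_of_real (\<alpha> * measure lebesgue (B_set \<phi>)) \<and>
      Z 0 = - 1)"
proof -
  interpret homogeneous_function A \<phi>
    using assms(3-5) by unfold_locales
  have "zeta_term \<phi> s summable_on (int_lattice - {0})" if "\<alpha> < Re s" for s
    using zeta_series_has_sum[of s] that assms(2) by (auto simp: summable_on_def)
  moreover have "zeta_series \<phi> holomorphic_on {s. \<alpha> < Re s}"
    using zeta_series_holomorphic assms(2) by simp
  moreover have "continued_zeta holomorphic_on (UNIV - {complex_of_real \<alpha>}) \<and>
      (\<forall>s. \<alpha> < Re s \<longrightarrow> continued_zeta s = zeta_series \<phi> s) \<and>
      is_pole continued_zeta (complex_of_real \<alpha>) \<and>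
      zorder continued_zeta (complex_of_real \<alpha>) = - 1 \<and>
      residue continued_zeta (complex_of_real \<alpha>) = complex_of_real (\<alpha> * measure lebesgue (B_set \<phi>)) \<and>
      continued_zeta 0 = - 1"
    using continued_zeta_holomorphic continued_zeta_eq continued_zeta_pole continued_zeta_0
    by (simp add: assms(2) volume_eq_lebesgue)
  ultimately show ?thesis by blast
qed

end
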